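(* Let $k$ be a field and let $I$ be a monomial ideal in $k[x_1,\dots,x_n,y_1,\dots,y_r]$, with generators in the variables $x_1,\dots,x_n$. Let $w$ be a monic monomial in the variables $y_1,\dots,y_r$ and fix an integer $h\geq 1$. Then $$\beta_0\big((I+(w))^h\big)=\sum_{\ell=1}^h\beta_0(I^\ell)+1,$$ and $$\beta_i\big((I+(w))^h\big)=\sum_{\ell=1}^h\left[\beta_i(I^\ell)+\beta_{i-1}(I^\ell)\right]\quad\text{for every integer } i\ge 1.$$ In particular, if $\beta_i^{\mathbb{Z}_p}(I^h)\neq\beta_i^{\mathbb{Q}}(I^h)$ for some prime number $p$ and some $i\geq 1$, then for every integer $q\ge h$ $$\beta_i^{\mathbb{Z}_p}\big((I+(w))^q\big)\neq\beta_i^{\mathbb{Q}}\big((I+(w))^q\big).$$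
   Context: A monomial ideal $I$ has a unique minimal system $G(I)$ of monic monomial generators, which makes sense over every coefficient field. For a field $k$, $\beta_i^k(I)=\dim_k\mathrm{Tor}_i^R(I,k)$ denotes the $i$-th (total) Betti number of the ideal generated by $G(I)$ in the polynomial ring $R$ over $k$ in the same variables (of $I$ as a module, not of $R/I$); the superscript $k$ is omitted when it is not important to specify the field. "With generators in the variables $x_1,\dots,x_n$" means that all elements of $G(I)$ are monomials in $x_1,\dots,x_n$ only. $\mathbb{Z}_p$ denotes the field with $p$ elements.
   Formalization: It is additionally assumed that I is a proper ideal and that the monomial w is not 1; otherwise the formula for β_0 fails, e.g. for I=(x_1), w=1, h=1, where the left side is 1 and the right side is 2. *)

theory Defs
  imports Complex_Main "HOL-Library.Poly_Mapping" "HOL-Library.Cardinality" "HOL-Computational_Algebra.Primes"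
begin

text \<open>
  The polynomial ring over a field \<open>'k\<close> in the variables \<open>'v\<close> is the convolution ring of finitely
  supported functions on exponent vectors.
\<close>

type_synonym 'v expo = "'v \<Rightarrow>\<^sub>0 nat"
type_synonym ('v, 'k) mpoly = "'v expo \<Rightarrow>\<^sub>0 'k"

definition monomial :: "'v expo \<Rightarrow> ('v, 'k::field) mpoly" where
  "monomial a = Poly_Mapping.single a 1"


section \<open>Ideals\<close>

text \<open>Ideals are the submodules of a commutative ring regarded as a module over itself.\<close>

abbreviation ideal_of :: "'r::comm_ring_1 set \<Rightarrow> 'r set" where
  "ideal_of S \<equiv> module.span (*) S"

definition ideal_add :: "'r::comm_ring_1 set \<Rightarrow> 'r set \<Rightarrow> 'r set" where
  "ideal_add I J = {a + b |a b. a \<in> I \<and> b \<in> J}"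

definition ideal_mult :: "'r::comm_ring_1 set \<Rightarrow> 'r set \<Rightarrow> 'r set" where
  "ideal_mult I J = ideal_of {a * b |a b. a \<in> I \<and> b \<in> J}"

primrec ideal_pow :: "'r::comm_ring_1 set \<Rightarrow> nat \<Rightarrow> 'r set" where
  "ideal_pow I 0 = UNIV"
| "ideal_pow I (Suc n) = ideal_mult I (ideal_pow I n)"

definition monomial_ideal :: "('v, 'k::field) mpoly set \<Rightarrow> bool" where
  "monomial_ideal I \<longleftrightarrow> (\<exists>A. I = ideal_of (monomial ` A))"

text \<open>
  The unique minimal system of monic monomial generators, as a set of exponent vectors; in this form
  it makes sense over every coefficient field.
\<close>

definition min_gens :: "('v, 'k::field) mpoly set \<Rightarrow> 'v expo set" where
  "min_gens I = (THE A. I = ideal_of (monomial ` A) \<and> (\<forall>B. B \<subset> A \<longrightarrow> ideal_of (monomial ` B) \<noteq> I))"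


section \<open>Free modules and free resolutions\<close>

text \<open>
  The free module on a set \<open>S\<close> of basis elements consists of the finitely supported functions with
  keys in \<open>S\<close>.
\<close>

definition fscale :: "'r::comm_ring_1 \<Rightarrow> ('b \<Rightarrow>\<^sub>0 'r) \<Rightarrow> ('b \<Rightarrow>\<^sub>0 'r)" where
  "fscale r f = Poly_Mapping.map ((*) r) f"

lemma lookup_fscale: "Poly_Mapping.lookup (fscale r f) x = r * Poly_Mapping.lookup f x"
  unfolding fscale_def by (simp add: Poly_Mapping.map.rep_eq when_def)

lemma module_fscale: "module fscale"
  by unfold_locales (auto intro!: poly_mapping_eqI simp: lookup_fscale lookup_add algebra_simps)

lemma module_ring_self: "module ((*) :: 'r::comm_ring_1 \<Rightarrow> 'r \<Rightarrow> 'r)"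
  by unfold_locales (auto simp: algebra_simps)

definition free_on :: "'b set \<Rightarrow> ('b \<Rightarrow>\<^sub>0 'r::comm_ring_1) set" where
  "free_on S = {f. Poly_Mapping.keys f \<subseteq> S}"

text \<open>
  An exact sequence \<open>\<dots> \<longrightarrow> F\<^sub>2 \<longrightarrow> F\<^sub>1 \<longrightarrow> F\<^sub>0 \<longrightarrow> M \<longrightarrow> 0\<close>, where \<open>F\<^sub>j\<close> is free on \<open>S j\<close>, the map
  \<open>F\<^sub>j\<^sub>+\<^sub>1 \<longrightarrow> F\<^sub>j\<close> is the restriction of \<open>d j\<close>, and the augmentation is the restriction of \<open>e\<close>. Bases are
  at most countable, which suffices for every finitely generated module over a noetherian ring. Since
  a linear map on \<open>F\<^sub>j\<close> extends to the free module on all of \<open>nat\<close>, asking for globally linear \<open>d j\<close>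
  and \<open>e\<close> is no restriction.
\<close>

definition free_resolution ::
  "('r::comm_ring_1 \<Rightarrow> 'm::ab_group_add \<Rightarrow> 'm) \<Rightarrow> 'm set \<Rightarrow>
   (nat \<Rightarrow> nat set) \<Rightarrow> (nat \<Rightarrow> (nat \<Rightarrow>\<^sub>0 'r) \<Rightarrow> (nat \<Rightarrow>\<^sub>0 'r)) \<Rightarrow> ((nat \<Rightarrow>\<^sub>0 'r) \<Rightarrow> 'm) \<Rightarrow> bool" where
  "free_resolution s M S d e \<longleftrightarrow>
     module_hom fscale s e \<and> (\<forall>j. module_hom fscale fscale (d j)) \<and>
     e ` free_on (S 0) = M \<and>
     d 0 ` free_on (S 1) = {f \<in> free_on (S 0). e f = 0} \<and>
     (\<forall>j. d (Suc j) ` free_on (S (j + 2)) = {f \<in> free_on (S (Suc j)). d j f = 0})"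


section \<open>Tensor products and Tor\<close>

text \<open>
  The tensor product of \<open>M\<close> and \<open>N\<close> is the free module on \<open>M \<times> N\<close> modulo the following submodule.
\<close>

definition tensor_rel ::
  "('r::comm_ring_1 \<Rightarrow> 'm::ab_group_add \<Rightarrow> 'm) \<Rightarrow> ('r \<Rightarrow> 'n::ab_group_add \<Rightarrow> 'n) \<Rightarrow>
   'm set \<Rightarrow> 'n set \<Rightarrow> ('m \<times> 'n \<Rightarrow>\<^sub>0 'r) set" where
  "tensor_rel s t M N = module.span fscale
     ({Poly_Mapping.single (m + m', n) 1 - Poly_Mapping.single (m, n) 1 - Poly_Mapping.single (m', n) 1
         |m m' n. m \<in> M \<and> m' \<in> M \<and> n \<in> N}
      \<union> {Poly_Mapping.single (m, n + n') 1 - Poly_Mapping.single (m, n) 1 - Poly_Mapping.single (m, n') 1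
         |m n n'. m \<in> M \<and> n \<in> N \<and> n' \<in> N}
      \<union> {Poly_Mapping.single (s r m, n) 1 - Poly_Mapping.single (m, n) r |r m n. m \<in> M \<and> n \<in> N}
      \<union> {Poly_Mapping.single (m, t r n) 1 - Poly_Mapping.single (m, n) r |r m n. m \<in> M \<and> n \<in> N})"

text \<open>The map \<open>f \<otimes> id\<close> on representatives.\<close>

definition tensor_map :: "('m \<Rightarrow> 'm) \<Rightarrow> ('m \<times> 'n \<Rightarrow>\<^sub>0 'r::comm_ring_1) \<Rightarrow> ('m \<times> 'n \<Rightarrow>\<^sub>0 'r)" where
  "tensor_map f z =
     (\<Sum>(m, n)\<in>Poly_Mapping.keys z. Poly_Mapping.single (f m, n) (Poly_Mapping.lookup z (m, n)))"

text \<open>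
  Cycles and boundaries of the complex \<open>F \<otimes> N\<close>, both represented by their preimages in the free
  module on \<open>F\<^sub>i \<times> N\<close>; both contain the tensor relations, so that the quotient of the cycles by the
  boundaries is the \<open>i\<close>-th homology module of \<open>F \<otimes> N\<close>.
\<close>

definition tor_cycles ::
  "('r::comm_ring_1 \<Rightarrow> 'n::ab_group_add \<Rightarrow> 'n) \<Rightarrow> 'n set \<Rightarrow>
   (nat \<Rightarrow> nat set) \<Rightarrow> (nat \<Rightarrow> (nat \<Rightarrow>\<^sub>0 'r) \<Rightarrow> (nat \<Rightarrow>\<^sub>0 'r)) \<Rightarrow> nat \<Rightarrow> ((nat \<Rightarrow>\<^sub>0 'r) \<times> 'n \<Rightarrow>\<^sub>0 'r) set" where
  "tor_cycles t N S d i =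
     (case i of
        0 \<Rightarrow> free_on (free_on (S 0) \<times> N)
      | Suc j \<Rightarrow> {z \<in> free_on (free_on (S (Suc j)) \<times> N).
                   tensor_map (d j) z \<in> tensor_rel fscale t (free_on (S j)) N})"

definition tor_boundaries ::
  "('r::comm_ring_1 \<Rightarrow> 'n::ab_group_add \<Rightarrow> 'n) \<Rightarrow> 'n set \<Rightarrow>
   (nat \<Rightarrow> nat set) \<Rightarrow> (nat \<Rightarrow> (nat \<Rightarrow>\<^sub>0 'r) \<Rightarrow> (nat \<Rightarrow>\<^sub>0 'r)) \<Rightarrow> nat \<Rightarrow> ((nat \<Rightarrow>\<^sub>0 'r) \<times> 'n \<Rightarrow>\<^sub>0 'r) set" where
  "tor_boundaries t N S d i =
     {tensor_map (d i) y + x |y x. y \<in> free_on (free_on (S (Suc i)) \<times> N) \<and>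
                                   x \<in> tensor_rel fscale t (free_on (S i)) N}"

text \<open>
  \<open>quot_basis s Z B C\<close>: the classes of the elements of \<open>C\<close> are pairwise distinct and form a basis of
  the quotient vector space \<open>Z/B\<close>. As for \<^const>\<open>vector_space.dim\<close>, the dimension is \<open>0\<close> if it is not
  finite.
\<close>

definition quot_basis ::
  "('k::field \<Rightarrow> 'a::ab_group_add \<Rightarrow> 'a) \<Rightarrow> 'a set \<Rightarrow> 'a set \<Rightarrow> 'a set \<Rightarrow> bool" where
  "quot_basis s Z B C \<longleftrightarrow>
     C \<subseteq> Z \<and>
     (\<forall>T u. finite T \<and> T \<subseteq> C \<and> (\<Sum>c\<in>T. s (u c) c) \<in> B \<longrightarrow> (\<forall>c\<in>T. u c = 0)) \<and>
     (\<forall>z\<in>Z. \<exists>x\<in>module.span s C. z - x \<in> B)"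

definition quot_dim :: "('k::field \<Rightarrow> 'a::ab_group_add \<Rightarrow> 'a) \<Rightarrow> 'a set \<Rightarrow> 'a set \<Rightarrow> nat" where
  "quot_dim s Z B = card (SOME C. quot_basis s Z B C)"


section \<open>Betti numbers\<close>

text \<open>The field as a module over the polynomial ring, all variables acting as zero.\<close>

definition residue_scale :: "('v, 'k::field) mpoly \<Rightarrow> 'k \<Rightarrow> 'k" where
  "residue_scale p c = Poly_Mapping.lookup p 0 * c"

text \<open>
  The dimension over \<open>'k\<close> of \<open>Tor\<^sub>i(M, 'k)\<close> for a submodule \<open>M\<close> of an ambient module with scalar
  multiplication \<open>s\<close>, computed from a chosen free resolution of \<open>M\<close>. The field acts on the homology
  through the constant polynomials.
\<close>

definition dim_tor ::
  "(('v, 'k::field) mpoly \<Rightarrow> 'm::ab_group_add \<Rightarrow> 'm) \<Rightarrow> 'm set \<Rightarrow> nat \<Rightarrow> nat" where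
  "dim_tor s M i =
     (let (S, d, e) = (SOME (S, d, e). free_resolution s M S d e)
      in quot_dim (\<lambda>c. fscale (Poly_Mapping.single 0 c))
           (tor_cycles residue_scale UNIV S d i) (tor_boundaries residue_scale UNIV S d i))"

text \<open>
  The first argument is the field over which the Betti number of the ideal generated by the minimal
  monomial generators of \<open>I\<close> is taken; it need not be the coefficient field \<open>'k\<close> of \<open>I\<close>.
\<close>

definition betti :: "'f::field itself \<Rightarrow> nat \<Rightarrow> ('v, 'k::field) mpoly set \<Rightarrow> nat" where
  "betti F i I = dim_tor (*) (ideal_of (monomial ` min_gens I :: ('v, 'f) mpoly set)) i"

end

theory Submission
  imports Defs "HOL-Analysis.Cartesian_Space"
begin

text \<open>
  The Tor modules of a monomial ideal are computed by the Koszul complex, whose piece in degree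
  \<open>a\<close> is the chain complex of the simplicial complex of all squarefree \<open>\<sigma> \<le> a\<close> such that
  \<open>x\<^sup>a\<close> divided by \<open>x\<^sup>\<sigma>\<close> lies in the ideal. Betti numbers thus become sums of ranks of integer
  matrices, and ranks can only drop when passing from \<open>\<rat>\<close> to another field.

  Write \<open>J\<^sub>n = (I + (w))\<^sup>n\<close>. Then \<open>J\<^sub>n\<^sub>+\<^sub>1 = I\<^sup>n\<^sup>+\<^sup>1 + w J\<^sub>n\<close> and the two summands intersect in
  \<open>w I\<^sup>n\<^sup>+\<^sup>1\<close>. In every degree the complex of the intersection lies in a cone inside the complex of
  \<open>I\<^sup>n\<^sup>+\<^sup>1\<close>, with apex a variable of \<open>w\<close>, and in a cone inside the complex of \<open>w J\<^sub>n\<close>, since dividing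
  an element of \<open>I\<^sup>n\<^sup>+\<^sup>1\<close> by a variable leaves an element of \<open>I\<^sup>n\<close>. Hence the Mayer--Vietoris
  sequence splits and \<open>\<beta>\<^sub>i(J\<^sub>n\<^sub>+\<^sub>1) = \<beta>\<^sub>i(I\<^sup>n\<^sup>+\<^sup>1) + \<beta>\<^sub>i\<^sub>-\<^sub>1(I\<^sup>n\<^sup>+\<^sup>1) + \<beta>\<^sub>i(J\<^sub>n)\<close>.
\<close>

section \<open>Dimensions of quotients\<close>

text \<open>Betti numbers are defined through an arbitrarily chosen free resolution, so the Koszul
  complex has to be compared with every resolution. No double complex is formed: the connecting maps
  of the short exact sequences of syzygies, free module and module are followed along the
  resolution, and every comparison maps two quotients onto a common one or obtains both from a
  common one.

  Ideals are represented by their sets of exponents. Such a set does not know a coefficient field,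
  which is why the same ideal can be studied over several fields at once.

  The cone inside the complex of \<open>w J\<close> needs a variable of the quotient of the degree
  by \<open>w\<close>. In degree \<open>w\<close> itself there is none; there the intersection has
  no faces because \<open>I\<close> is a proper ideal.

  The comparison of ranks serves the last claim: a discrepancy between two fields at one power of
  \<open>I\<close> could be cancelled in the sum by discrepancies elsewhere, unless all of them have
  the same sign.\<close>

lemma (in vector_space) ex_linear_with_kernel:
  assumes "subspace B"
  shows "\<exists>\<pi>. Vector_Spaces.linear scale scale \<pi> \<and> (\<forall>x. \<pi> x = 0 \<longleftrightarrow> x \<in> B)"
proof -
  interpret P: vector_space_pair scale scale ..
  obtain B0 where B0: "B0 \<subseteq> B" "independent B0" "B \<subseteq> span B0"
    by (rule basis_exists)
  define D where "D = extend_basis B0"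
  have D: "independent D" "B0 \<subseteq> D" "span D = UNIV"
    using B0(2) unfolding D_def
    by (simp_all add: independent_extend_basis extend_basis_superset span_extend_basis)
  \<comment> \<open>Killing the basis of \<open>B\<close> and fixing the other basis vectors
    projects along \<open>B\<close> onto a complement, which serves as a model of the quotient by
    \<open>B\<close>.\<close>
  define \<pi> where "\<pi> = P.construct D (\<lambda>b. if b \<in> B0 then 0 else b)"
  have lin: "Vector_Spaces.linear scale scale \<pi>"
    unfolding \<pi>_def by (rule P.linear_construct[OF D(1)])
  interpret \<pi>: module_hom scale scale \<pi> using lin by (simp add: module_hom_iff_linear)
  have basis: "\<pi> b = (if b \<in> B0 then 0 else b)" if "b \<in> D" for b
    unfolding \<pi>_def by (rule P.construct_basis[OF D(1) that])
  have \<pi>0: "\<pi> y = 0" if "y \<in> span B0" for y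
    by (rule \<pi>.eq_0_on_span[OF _ that]) (use basis D(2) in auto)
  have \<pi>id: "\<pi> z = z" if "z \<in> span (D - B0)" for z
  proof -
    interpret h: module_hom scale scale "\<lambda>x. \<pi> x - x"
      by unfold_locales (simp_all add: \<pi>.add \<pi>.scale scale_right_diff_distrib)
    have "\<pi> z - z = 0" by (rule h.eq_0_on_span[OF _ that]) (use basis in auto)
    then show ?thesis by simp
  qed
  have spB: "span B0 = B" using B0 assms by (simp add: span_subspace)
  have "\<pi> x = 0 \<longleftrightarrow> x \<in> B" for x
  proof -
    have "x \<in> span (B0 \<union> (D - B0))" using D by (simp add: Un_absorb1)
    then obtain y z where yz: "x = y + z" "y \<in> span B0" "z \<in> span (D - B0)"
      unfolding span_Un by blast
    have "\<pi> x = z" using yz \<pi>0 \<pi>id by (simp add: \<pi>.add)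
    then show ?thesis using yz \<pi>0[of x] by (auto simp: spB)
  qed
  then show ?thesis using lin by blast
qed

context vector_space
begin

text \<open>With kernel \<open>B\<close>, the map \<open>\<pi>\<close> plays the role of the
  quotient map. Classes modulo \<open>B\<close> become honest vectors, and facts on bases and
  dimension carry over to quotients.\<close>

lemma quot_basis_iff_projection:
  assumes lin: "Vector_Spaces.linear scale scale \<pi>" and ker: "\<And>x. \<pi> x = 0 \<longleftrightarrow> x \<in> B"
  shows "quot_basis scale Z B C \<longleftrightarrow>
    C \<subseteq> Z \<and> inj_on \<pi> C \<and> independent (\<pi> ` C) \<and> \<pi> ` Z \<subseteq> span (\<pi> ` C)"
proof -
  interpret \<pi>: module_hom scale scale \<pi> using lin by (simp add: module_hom_iff_linear)
  have span_eq: "(\<forall>z\<in>Z. \<exists>x\<in>span C. z - x \<in> B) \<longleftrightarrow> \<pi> ` Z \<subseteq> span (\<pi> ` C)"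
    by (simp add: \<pi>.span_image subset_iff image_iff ker[symmetric] \<pi>.diff) blast
  have sum_eq: "(\<Sum>c\<in>T. scale (u c) c) \<in> B \<longleftrightarrow> (\<Sum>c\<in>T. scale (u c) (\<pi> c)) = 0" for T u
    by (simp add: ker[symmetric] \<pi>.sum \<pi>.scale)
  have "(\<forall>T u. finite T \<and> T \<subseteq> C \<and> (\<Sum>c\<in>T. scale (u c) (\<pi> c)) = 0 \<longrightarrow> (\<forall>c\<in>T. u c = 0))
    \<longleftrightarrow> inj_on \<pi> C \<and> independent (\<pi> ` C)" (is "?L \<longleftrightarrow> ?R")
  proof
    assume L: ?L
    have inj: "inj_on \<pi> C"
    proof (rule inj_onI, rule ccontr)
      fix x y assume xy: "x \<in> C" "y \<in> C" "\<pi> x = \<pi> y" "x \<noteq> y"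
      have "(\<Sum>c\<in>{x,y}. scale (if c = x then 1 else -1) (\<pi> c)) = 0" using xy by simp
      with L[rule_format, of "{x,y}" "\<lambda>c. if c = x then 1 else -1" x] xy show False by simp
    qed
    moreover have "independent (\<pi> ` C)"
    proof (unfold independent_explicit_finite_subsets, intro allI impI ballI)
      fix T u v assume T: "T \<subseteq> \<pi> ` C" "finite T" "(\<Sum>x\<in>T. scale (u x) x) = 0" "v \<in> T"
      obtain T' where T': "T' \<subseteq> C" "finite T'" "T = \<pi> ` T'"
        using T by (meson finite_subset_image)
      have "inj_on \<pi> T'" using inj T'(1) by (rule inj_on_subset)
      then have "(\<Sum>c\<in>T'. scale (u (\<pi> c)) (\<pi> c)) = 0"
        using T(3) T'(3) by (simp add: sum.reindex)
      then have "\<forall>c\<in>T'. u (\<pi> c) = 0" using L[rule_format, of T' "\<lambda>c. u (\<pi> c)"] T' by blast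
      then show "u v = 0" using T(4) T'(3) by auto
    qed
    ultimately show ?R by blast
  next
    assume R: ?R
    show ?L
    proof (intro allI impI ballI)
      fix T u c assume T: "finite T \<and> T \<subseteq> C \<and> (\<Sum>c\<in>T. scale (u c) (\<pi> c)) = 0" and c: "c \<in> T"
      have inj: "inj_on \<pi> T" using R T by (blast intro: inj_on_subset)
      have "(\<Sum>x\<in>\<pi> ` T. scale (u (inv_into T \<pi> x)) x) = 0"
        using T inj by (simp add: sum.reindex)
      from independentD[OF _ _ _ this, of "\<pi> ` C" "\<pi> c"] have "u (inv_into T \<pi> (\<pi> c)) = 0"
        using R T c by blast
      then show "u c = 0" using inj c by simp
    qed
  qed
  then show ?thesis unfolding quot_basis_def span_eq sum_eq by (simp only: conj_assoc)
qed

lemma ex_quot_basis: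
  assumes "subspace B"
  shows "\<exists>C. quot_basis scale Z B C"
proof -
  obtain \<pi> where \<pi>: "Vector_Spaces.linear scale scale \<pi>" "\<And>x. \<pi> x = 0 \<longleftrightarrow> x \<in> B"
    using ex_linear_with_kernel[OF assms] by blast
  obtain b where b: "b \<subseteq> \<pi> ` Z" "independent b" "\<pi> ` Z \<subseteq> span b"
    by (rule basis_exists)
  obtain C where C: "C \<subseteq> Z" "inj_on \<pi> C" "\<pi> ` C = b"
    using b(1) unfolding subset_image_inj by blast
  show ?thesis using C b by (auto simp: quot_basis_iff_projection[OF \<pi>])
qed

text \<open>All such bases have as many elements as the dimension of the projected \<open>Z\<close>,
  so the choice made in \<open>quot_dim\<close> is immaterial.\<close>

lemma quot_dim_eq_card:
  assumes B: "subspace B" and C: "quot_basis scale Z B C"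
  shows "quot_dim scale Z B = card C"
proof -
  obtain \<pi> where \<pi>: "Vector_Spaces.linear scale scale \<pi>" "\<And>x. \<pi> x = 0 \<longleftrightarrow> x \<in> B"
    using ex_linear_with_kernel[OF assms(1)] by blast
  have "card D = dim (\<pi> ` Z)" if "quot_basis scale Z B D" for D
  proof -
    have D: "D \<subseteq> Z" "inj_on \<pi> D" "independent (\<pi> ` D)" "\<pi> ` Z \<subseteq> span (\<pi> ` D)"
      using that by (simp_all add: quot_basis_iff_projection[OF \<pi>])
    have "card D = card (\<pi> ` D)" using D by (simp add: card_image)
    also have "\<dots> = dim (\<pi> ` Z)"
      by (rule basis_card_eq_dim[OF image_mono[OF D(1)] D(4,3)])
    finally show ?thesis .
  qed
  then show ?thesis
    unfolding quot_dim_def using someI[of "quot_basis scale Z B", OF C] C by metis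
qed

lemma quot_basis_quot_dim:
  assumes "subspace B"
  obtains C where "quot_basis scale Z B C" "card C = quot_dim scale Z B"
  using ex_quot_basis[OF assms, of Z] quot_dim_eq_card[OF assms] by metis

end

text \<open>\<open>f\<close> maps \<open>P\<close> onto \<open>Z\<close>, and \<open>Q\<close> meets
  \<open>P\<close> in the preimage of \<open>B\<close>; hence \<open>f\<close> induces an
  isomorphism from \<open>P/Q\<close> to \<open>Z/B\<close>. Homology spaces are compared below by
  obtaining both from one pair \<open>P\<close>, \<open>Q\<close>, or by mapping both to a third
  one.\<close>

lemma quot_dim_image:
  assumes s: "vector_space s" and t: "vector_space t" and f: "module_hom s t f"
    and P: "module.subspace s P" and Q: "module.subspace s Q" and B: "module.subspace t B"
    and fP: "f ` P = Z" and fQ: "\<And>x. x \<in> P \<Longrightarrow> f x \<in> B \<longleftrightarrow> x \<in> Q"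
  shows "quot_dim s P Q = quot_dim t Z B"
proof -
  interpret s: vector_space s by fact
  interpret t: vector_space t by fact
  interpret f: module_hom s t f by fact
  obtain C where C: "quot_basis s P Q C" "card C = quot_dim s P Q"
    using s.quot_basis_quot_dim[OF Q] by blast
  note C' = C(1)[unfolded quot_basis_def]
  have indep: "\<forall>c\<in>T. u c = 0" if "finite T" "T \<subseteq> C" "(\<Sum>c\<in>T. t (u c) (f c)) \<in> B" for T u
  proof -
    have "(\<Sum>c\<in>T. s (u c) c) \<in> P"
      using C' that by (intro s.subspace_sum[OF P] s.subspace_scale[OF P]) auto
    from fQ[OF this] have "(\<Sum>c\<in>T. s (u c) c) \<in> Q" using that(3) by (simp add: f.sum f.scale)
    then show ?thesis using C'[THEN conjunct2, THEN conjunct1, rule_format, of T u] that by blast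
  qed
  have inj: "inj_on f C"
  proof (rule inj_onI, rule ccontr)
    fix x y assume xy: "x \<in> C" "y \<in> C" "f x = f y" "x \<noteq> y"
    have "(\<Sum>c\<in>{x,y}. t (if c = x then 1 else -1) (f c)) \<in> B"
      using xy by (simp add: t.subspace_0[OF B])
    from indep[OF _ _ this] xy show False by auto
  qed
  have "quot_basis t Z B (f ` C)"
    unfolding quot_basis_def
  proof (intro conjI allI impI ballI)
    show "f ` C \<subseteq> Z" using C' fP by auto
  next
    fix T u c assume T: "finite T \<and> T \<subseteq> f ` C \<and> (\<Sum>c\<in>T. t (u c) c) \<in> B" and c: "c \<in> T"
    then obtain T' where T': "T' \<subseteq> C" "finite T'" "T = f ` T'"
      by (meson finite_subset_image)
    have "inj_on f T'" using inj T'(1) by (rule inj_on_subset)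
    then have "(\<Sum>c\<in>T'. t (u (f c)) (f c)) \<in> B" using T T'(3) by (simp add: sum.reindex)
    from indep[OF T'(2,1) this] show "u c = 0" using c T'(3) by auto
  next
    fix z assume "z \<in> Z"
    then obtain p where p: "p \<in> P" "z = f p" using fP by auto
    then obtain x where x: "x \<in> s.span C" "p - x \<in> Q" using C' by blast
    have "C \<subseteq> P" using C' by simp
    then have "x \<in> P" using s.span_minimal[OF _ P] x(1) by blast
    with p have "p - x \<in> P" by (simp add: s.subspace_diff[OF P])
    then have "f (p - x) \<in> B" using fQ x by simp
    then show "\<exists>y\<in>t.span (f ` C). z - y \<in> B"
      using x(1) p by (auto simp: f.span_image f.diff)
  qed
  from t.quot_dim_eq_card[OF B this] C(2) inj show ?thesis by (simp add: card_image)
qed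

context vector_space begin

text \<open>A basis of \<open>B\<close> is extended to one of \<open>Z\<close>, and the added
  vectors represent a basis of the quotient. Finiteness is recorded separately because
  \<open>quot_dim\<close> alone cannot tell an infinite basis from an empty one.\<close>

lemma quot_dim_plus_dim:
  assumes Z: "subspace Z" and B: "subspace B" "B \<subseteq> Z" and fin: "finite W" "Z \<subseteq> span W"
  shows "quot_dim scale Z B + dim B = dim Z" "\<exists>C. finite C \<and> quot_basis scale Z B C"
proof -
  obtain B0 where B0: "B0 \<subseteq> B" "independent B0" "B \<subseteq> span B0" "card B0 = dim B"
    by (rule basis_exists)
  have "B0 \<subseteq> Z" using B0 B by blast
  obtain D where D: "B0 \<subseteq> D" "D \<subseteq> Z" "independent D" "Z \<subseteq> span D"
    by (rule maximal_independent_subset_extend[OF \<open>B0 \<subseteq> Z\<close> B0(2)])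
  have finD: "finite D"
    using independent_span_bound[OF fin(1) D(3)] D(2) fin(2) by blast
  have spB: "span B0 = B" using B0 B by (simp add: span_subspace)
  have "quot_basis scale Z B (D - B0)"
    unfolding quot_basis_def
  proof (intro conjI allI impI ballI)
    show "D - B0 \<subseteq> Z" using D by blast
  next
    fix T u c assume T: "finite T \<and> T \<subseteq> D - B0 \<and> (\<Sum>c\<in>T. scale (u c) c) \<in> B" and c: "c \<in> T"
    show "u c = 0"
    proof (rule ccontr)
      assume uc: "u c \<noteq> 0"
      have "B0 \<subseteq> D - {c}" using T c D by blast
      then have 1: "(\<Sum>c\<in>T. scale (u c) c) \<in> span (D - {c})"
        using T spB span_mono by blast
      have 2: "(\<Sum>c\<in>T - {c}. scale (u c) c) \<in> span (D - {c})"
        using T by (intro span_sum span_scale span_base) auto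
      have "scale (u c) c \<in> span (D - {c})"
        using span_diff[OF 1 2] T c by (simp add: sum.remove)
      then have "scale (inverse (u c)) (scale (u c) c) \<in> span (D - {c})" by (rule span_scale)
      then have "c \<in> span (D - {c})" using uc by simp
      then show False using D(3) T c by (auto simp: dependent_def)
    qed
  next
    fix z assume "z \<in> Z"
    then have "z \<in> span (B0 \<union> (D - B0))" using D by (auto simp: Un_absorb1)
    then obtain y x where "z = y + x" "y \<in> span B0" "x \<in> span (D - B0)"
      unfolding span_Un by blast
    then show "\<exists>x\<in>span (D - B0). z - x \<in> B" using spB by auto
  qed
  moreover from this have "quot_dim scale Z B = card (D - B0)" by (rule quot_dim_eq_card[OF B(1)])
  moreover have "card D = dim Z" by (rule basis_card_eq_dim[OF D(2,4,3)])
  moreover have "card B0 \<le> card D" using D(1) finD by (rule card_mono[rotated])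
  ultimately show "quot_dim scale Z B + dim B = dim Z" "\<exists>C. finite C \<and> quot_basis scale Z B C"
    using B0(4) D(1) finD by (auto simp: card_Diff_subset finite_subset)
qed

end

text \<open>Rank-nullity on a subspace, from the isomorphism between \<open>Z\<close> modulo the
  kernel and the image.\<close>

lemma (in finite_dimensional_vector_space) dim_image_plus_kernel:
  assumes f: "Vector_Spaces.linear scale scale f" and Z: "subspace Z"
  shows "dim (f ` Z) + dim {x \<in> Z. f x = 0} = dim Z"
proof -
  interpret f: Vector_Spaces.linear scale scale f by fact
  let ?K = "{x \<in> Z. f x = 0}"
  have K: "subspace ?K"
    using subspace_inter[OF Z f.subspace_kernel] by (simp add: Int_def)
  have "quot_dim scale Z ?K = quot_dim scale (f ` Z) {0}"
    by (rule quot_dim_image[where f = f])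
      (use vector_space_axioms f.module_hom_axioms Z K in auto)
  moreover have "quot_dim scale Z ?K + dim ?K = dim Z"
    by (rule quot_dim_plus_dim[OF Z K _ finite_Basis]) (auto simp: span_Basis)
  moreover have "quot_dim scale (f ` Z) {0} + dim {0} = dim (f ` Z)"
    by (rule quot_dim_plus_dim[OF f.subspace_image[OF Z] _ _ finite_Basis])
      (auto simp: span_Basis f.zero intro: image_eqI[of _ _ 0] subspace_0[OF Z])
  ultimately show ?thesis by simp
qed

section \<open>Koszul differentials\<close>

text \<open>The signs of the Koszul complex need a linear order of the variables, and the type
  \<open>'v\<close> carries none; any injective numbering will do.\<close>

definition vidx :: "'v::finite \<Rightarrow> nat" where
  "vidx = (SOME f. inj f)"

lemma inj_vidx: "inj (vidx :: 'v::finite \<Rightarrow> nat)"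
proof -
  have "\<exists>f :: 'v \<Rightarrow> nat. inj f"
    using finite_imp_inj_to_nat_seg[of "UNIV :: 'v set"] by auto
  then show ?thesis unfolding vidx_def by (rule someI_ex)
qed

lemma vidx_eq_iff [simp]: "vidx u = vidx v \<longleftrightarrow> u = v"
  by (rule inj_eq[OF inj_vidx])

text \<open>The sign that sorts the exterior product of \<open>v\<close> with the elements of
  \<open>\<tau>\<close>: one factor \<open>-1\<close> for each smaller element that \<open>v\<close>
  has to pass.\<close>

definition ksgn :: "'v::finite \<Rightarrow> 'v set \<Rightarrow> 'r::comm_ring_1" where
  "ksgn v \<tau> = (- 1) ^ card {u \<in> \<tau>. vidx u < vidx v}"

lemma ksgn_square [simp]: "ksgn v \<tau> * ksgn v \<tau> = (1 :: 'r::comm_ring_1)"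
  by (simp add: ksgn_def flip: power_add mult_2)

lemma ksgn_square_left [simp]: "ksgn v \<tau> * (ksgn v \<tau> * x) = (x :: 'r::comm_ring_1)"
  by (simp flip: mult.assoc)

text \<open>Anticommutativity of the exterior product: of two new variables, the larger one changes
  its sign when the smaller one is inserted, while the smaller one does not notice the
  larger.\<close>

lemma ksgn_swap:
  assumes "u \<noteq> v" "u \<notin> \<tau>" "v \<notin> \<tau>"
  shows "ksgn v \<tau> * ksgn u (insert v \<tau>) = - (ksgn u \<tau> * ksgn v (insert u \<tau>) :: 'r::comm_ring_1)"
proof -
  have *: "ksgn v \<tau> * ksgn u (insert v \<tau>) = - (ksgn u \<tau> * ksgn v (insert u \<tau>) :: 'r)"
    if "vidx u < vidx v" "u \<notin> \<tau>" for u v :: 'a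
  proof -
    have "{x \<in> insert v \<tau>. vidx x < vidx u} = {x \<in> \<tau>. vidx x < vidx u}"
      using that by auto
    moreover have "{x \<in> insert u \<tau>. vidx x < vidx v} = insert u {x \<in> \<tau>. vidx x < vidx v}"
      using that by auto
    ultimately show ?thesis using that by (simp add: ksgn_def)
  qed
  have "vidx u \<noteq> vidx v" using assms(1) by simp
  then consider "vidx u < vidx v" | "vidx v < vidx u" by linarith
  then show ?thesis
    by cases (use *[of u v] *[of v u] assms in auto)
qed

text \<open>The Koszul differential on coefficient functions, where \<open>c \<sigma>\<close> is the
  coefficient of the exterior basis element of \<open>\<sigma>\<close>. One formula covers two uses:
  \<open>x = var\<close> gives the Koszul complex of a module, constant \<open>x = 1\<close> the
  simplicial boundary.\<close>

definition kd :: "('r::comm_ring_1 \<Rightarrow> 'm::ab_group_add \<Rightarrow> 'm) \<Rightarrow> ('v::finite \<Rightarrow> 'r) \<Rightarrow>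
    ('v set \<Rightarrow> 'm) \<Rightarrow> 'v set \<Rightarrow> 'm" where
  "kd s x c \<tau> = (\<Sum>v\<in>-\<tau>. s (ksgn v \<tau> * x v) (c (insert v \<tau>)))"

text \<open>The pairs \<open>(u, v)\<close> and \<open>(v, u)\<close> are matched and each match
  cancels. Showing that the sum equals its own negative would be too weak, as characteristic two is
  allowed.\<close>

lemma sum_antisymmetric_pairs:
  fixes f :: "'v::finite \<Rightarrow> 'v \<Rightarrow> 'm::ab_group_add"
  assumes "\<And>u v. u \<in> S \<Longrightarrow> v \<in> S \<Longrightarrow> u \<noteq> v \<Longrightarrow> f u v = - f v u"
  shows "(\<Sum>u\<in>S. \<Sum>v\<in>S - {u}. f u v) = 0"
proof -
  define A where "A = {(u, v). u \<in> S \<and> v \<in> S \<and> vidx u < vidx v}"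
  have eq: "Sigma S (\<lambda>u. S - {u}) = A \<union> prod.swap ` A"
  proof (intro set_eqI iffI)
    fix p assume "p \<in> Sigma S (\<lambda>u. S - {u})"
    moreover from this have "fst p \<noteq> snd p" by auto
    then have "vidx (fst p) < vidx (snd p) \<or> vidx (snd p) < vidx (fst p)"
      using vidx_eq_iff[of "fst p" "snd p"] by linarith
    ultimately show "p \<in> A \<union> prod.swap ` A"
      by (cases p) (auto simp: A_def image_iff)
  qed (auto simp: A_def)
  have disj: "A \<inter> prod.swap ` A = {}" by (auto simp: A_def)
  have "(\<Sum>u\<in>S. \<Sum>v\<in>S - {u}. f u v) = (\<Sum>(u, v)\<in>Sigma S (\<lambda>u. S - {u}). f u v)"
    by (simp add: sum.Sigma)
  also have "\<dots> = (\<Sum>(u, v)\<in>A. f u v) + (\<Sum>(u, v)\<in>prod.swap ` A. f u v)"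
    unfolding eq by (rule sum.union_disjoint) (use disj in auto)
  also have "(\<Sum>(u, v)\<in>prod.swap ` A. f u v) = (\<Sum>(u, v)\<in>A. f v u)"
    by (subst sum.reindex) (auto simp: case_prod_unfold)
  also have "(\<Sum>(u, v)\<in>A. f u v) + (\<Sum>(u, v)\<in>A. f v u) = (\<Sum>(u, v)\<in>A. f u v + f v u)"
    by (simp add: sum.distrib case_prod_unfold)
  also have "\<dots> = 0"
  proof (intro sum.neutral ballI)
    fix p assume "p \<in> A"
    then have "f (fst p) (snd p) = - f (snd p) (fst p)" by (intro assms) (auto simp: A_def)
    then show "(case p of (u, v) \<Rightarrow> f u v + f v u) = 0" by (simp add: case_prod_unfold)
  qed
  finally show ?thesis .
qed

lemma kd_kd:
  fixes s :: "'r::comm_ring_1 \<Rightarrow> 'm::ab_group_add \<Rightarrow> 'm" and c :: "'v::finite set \<Rightarrow> 'm"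
  assumes "module s"
  shows "kd s x (kd s x c) = (\<lambda>_. 0)"
proof
  interpret module s by fact
  fix \<tau> :: "'v set"
  let ?f = "\<lambda>v u. s ((ksgn v \<tau> * ksgn u (insert v \<tau>)) * (x v * x u)) (c (insert u (insert v \<tau>)))"
  have "kd s x (kd s x c) \<tau> = (\<Sum>v\<in>-\<tau>. \<Sum>u\<in>-\<tau>-{v}. ?f v u)"
    unfolding kd_def
  proof (intro sum.cong refl)
    fix v assume "v \<in> -\<tau>"
    have "- insert v \<tau> = - \<tau> - {v}" by auto
    then show "s (ksgn v \<tau> * x v) (\<Sum>u\<in>-insert v \<tau>. s (ksgn u (insert v \<tau>) * x u) (c (insert u (insert v \<tau>))))
      = (\<Sum>u\<in>-\<tau>-{v}. ?f v u)"
      by (simp add: scale_sum_right mult_ac)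
  qed
  also have "\<dots> = 0"
  proof (rule sum_antisymmetric_pairs)
    fix u v assume "u \<in> -\<tau>" "v \<in> -\<tau>" "u \<noteq> v"
    then have "ksgn v \<tau> * ksgn u (insert v \<tau>) = - (ksgn u \<tau> * ksgn v (insert u \<tau>) :: 'r)"
      by (intro ksgn_swap) auto
    then show "?f u v = - ?f v u" by (simp add: insert_commute mult.commute)
  qed
  finally show "kd s x (kd s x c) \<tau> = 0" .
qed

section \<open>Cones as contracting homotopies\<close>

definition cone :: "'v::finite \<Rightarrow> ('v set \<Rightarrow> 'k::comm_ring_1) \<Rightarrow> 'v set \<Rightarrow> 'k" where
  "cone v g \<sigma> = (if v \<in> \<sigma> then ksgn v (\<sigma> - {v}) * g (\<sigma> - {v}) else 0)"

text \<open>Exterior multiplication by \<open>v\<close> contracts the complex of all subsets. If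
  \<open>v\<close> is not in \<open>\<tau>\<close>, only inserting \<open>v\<close> contributes;
  otherwise \<open>g \<tau>\<close> arises where the differential reinserts the removed
  \<open>v\<close>, and the remaining terms of the two summands cancel.\<close>

lemma kd_cone:
  "kd (*) (\<lambda>_. 1) (cone v g) \<tau> + cone v (kd (*) (\<lambda>_. 1) g) \<tau> = (g \<tau> :: 'k::comm_ring_1)"
proof (cases "v \<in> \<tau>")
  case False
  have "kd (*) (\<lambda>_. 1) (cone v g) \<tau> = (\<Sum>u\<in>{v}. ksgn u \<tau> * cone v g (insert u \<tau>))"
    unfolding kd_def by (simp only: mult_1_right, rule sum.mono_neutral_cong_right) (use False in \<open>auto simp: cone_def\<close>)
  also have "\<dots> = g \<tau>" using False by (simp add: cone_def)
  finally show ?thesis using False by (simp add: cone_def)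
next
  case True
  define \<rho> where "\<rho> = \<tau> - {v}"
  have \<tau>: "\<tau> = insert v \<rho>" "v \<notin> \<rho>" using True by (auto simp: \<rho>_def)
  have "-\<rho> = insert v (-\<tau>)" "v \<notin> -\<tau>" using True by (auto simp: \<rho>_def)
  then have "cone v (kd (*) (\<lambda>_. 1) g) \<tau> =
      g \<tau> + (\<Sum>u\<in>-\<tau>. ksgn v \<rho> * ksgn u \<rho> * g (insert u \<rho>))"
    using True by (simp add: cone_def kd_def \<rho>_def[symmetric] distrib_left sum_distrib_left mult.assoc)
      (simp add: \<tau>(1))
  moreover have "kd (*) (\<lambda>_. 1) (cone v g) \<tau> = (\<Sum>u\<in>-\<tau>. - (ksgn v \<rho> * ksgn u \<rho> * g (insert u \<rho>)))"
    unfolding kd_def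
  proof (intro sum.cong refl)
    fix u assume u: "u \<in> -\<tau>"
    have e: "insert u \<tau> - {v} = insert u \<rho>" using u \<tau> by auto
    have "ksgn v \<rho> * ksgn u (insert v \<rho>) = - (ksgn u \<rho> * ksgn v (insert u \<rho>) :: 'k)"
      using u \<tau> by (intro ksgn_swap) auto
    \<comment> \<open>Multiplying by \<open>ksgn v \<rho>\<close> and
      \<open>ksgn v (insert u \<rho>)\<close>, both of square one, solves the swap identity for the
      sign needed here.\<close>
    then have "ksgn v \<rho> * (ksgn v \<rho> * ksgn u \<tau>) * ksgn v (insert u \<rho>) =
        - (ksgn v \<rho> * ksgn u \<rho> * (ksgn v (insert u \<rho>) * ksgn v (insert u \<rho>)) :: 'k)"
      by (simp only: \<tau>(1) mult_minus_right mult_minus_left mult.assoc)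
    then have sgn: "ksgn u \<tau> * ksgn v (insert u \<rho>) = - (ksgn v \<rho> * ksgn u \<rho> :: 'k)" by simp
    have "ksgn u \<tau> * 1 * cone v g (insert u \<tau>) = ksgn u \<tau> * ksgn v (insert u \<rho>) * g (insert u \<rho>)"
      using True by (simp add: cone_def e mult.assoc)
    then show "ksgn u \<tau> * 1 * cone v g (insert u \<tau>) = - (ksgn v \<rho> * ksgn u \<rho> * g (insert u \<rho>))"
      unfolding sgn by simp
  qed
  ultimately show ?thesis by (simp add: sum_negf)
qed

section \<open>Homology of simplicial complexes\<close>

text \<open>
  A simplicial complex is a downward closed set of faces; chains are graded by the cardinality of
  faces, so that \<open>{}\<close> sits in degree \<open>0\<close> and homology is reduced, with indices shifted by one.
\<close>

definition sbd :: "'k::field ^ 'v::finite set \<Rightarrow> 'k ^ 'v set" where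
  "sbd g = (\<chi> \<tau>. kd (*) (\<lambda>_. 1) (($) g) \<tau>)"

definition faces :: "'v set set \<Rightarrow> nat \<Rightarrow> 'v set set" where
  "faces \<Delta> i = {\<sigma> \<in> \<Delta>. card \<sigma> = i}"

text \<open>Chains of all complexes and all degrees are subspaces of one coordinate space, cut out
  by their support, so that unions and intersections of complexes become sums and intersections of
  subspaces.\<close>

definition schain :: "'v::finite set set \<Rightarrow> nat \<Rightarrow> ('k::field ^ 'v set) set" where
  "schain \<Delta> i = {g. \<forall>\<sigma>. \<sigma> \<notin> faces \<Delta> i \<longrightarrow> g $ \<sigma> = 0}"

definition srank :: "'k::field itself \<Rightarrow> nat \<Rightarrow> 'v::finite set set \<Rightarrow> nat" where
  "srank F i \<Delta> = vec.dim (sbd ` schain \<Delta> i :: ('k ^ 'v set) set)"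

text \<open>The homology dimension is written in ranks of boundary matrices because these can be
  compared between fields. The truncated subtraction is exact for
  \<open>down_closed \<Delta>\<close>, by \<open>hdim_plus_ranks\<close>.\<close>

definition hdim :: "'k::field itself \<Rightarrow> nat \<Rightarrow> 'v::finite set set \<Rightarrow> nat" where
  "hdim F i \<Delta> = card (faces \<Delta> i) - srank F i \<Delta> - srank F (Suc i) \<Delta>"

definition down_closed :: "'v set set \<Rightarrow> bool" where
  "down_closed \<Delta> \<longleftrightarrow> (\<forall>\<sigma>\<in>\<Delta>. \<forall>\<tau>\<subseteq>\<sigma>. \<tau> \<in> \<Delta>)"

lemma sbd_nth: "sbd g $ \<tau> = kd (*) (\<lambda>_. 1) (($) g) \<tau>"
  by (simp add: sbd_def)

lemma linear_sbd: "Vector_Spaces.linear (*s) (*s) (sbd :: 'k::field ^ 'v::finite set \<Rightarrow> _)"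
  by unfold_locales
    (auto simp: vec_eq_iff sbd_nth kd_def algebra_simps sum.distrib sum_distrib_left)

lemma sbd_sbd: "sbd (sbd g) = 0"
proof -
  have "kd (*) (\<lambda>_. 1) (kd (*) (\<lambda>_. 1) (($) g)) = (\<lambda>_. 0)"
    by (rule kd_kd[OF module_ring_self])
  then show ?thesis by (simp add: vec_eq_iff sbd_nth fun_eq_iff kd_def)
qed

lemma subspace_schain: "vec.subspace (schain \<Delta> i :: ('k::field ^ 'v::finite set) set)"
  by (auto simp: vec.subspace_def schain_def)

lemma dim_schain: "vec.dim (schain \<Delta> i :: ('k::field ^ 'v::finite set) set) = card (faces \<Delta> i)"
  unfolding schain_def by (rule dim_substandard_cart)

lemma subspace_sbd_schain:
  "vec.subspace (sbd ` schain \<Delta> i :: ('k::field ^ 'v::finite set) set)"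
  by (rule module_hom.subspace_image[OF _ subspace_schain])
    (simp add: module_hom_iff_linear linear_sbd)

lemma faces_Un: "faces (A \<union> B) i = faces A i \<union> faces B i"
  by (auto simp: faces_def)

lemma faces_Int: "faces (A \<inter> B) i = faces A i \<inter> faces B i"
  by (auto simp: faces_def)

lemma schain_Int:
  "(schain (A \<inter> B) i :: ('k::field ^ 'v::finite set) set) = schain A i \<inter> schain B i"
  by (auto simp: schain_def faces_def)

lemma sbd_schain:
  fixes g :: "'k::field ^ 'v::finite set"
  assumes "down_closed \<Delta>" "g \<in> schain \<Delta> (Suc i)"
  shows "sbd g \<in> schain \<Delta> i"
  unfolding schain_def
proof (intro CollectI allI impI)
  fix \<tau> assume \<tau>: "\<tau> \<notin> faces \<Delta> i"
  have "insert v \<tau> \<notin> faces \<Delta> (Suc i)" if "v \<notin> \<tau>" for v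
    using \<tau> that assms(1) by (auto simp: faces_def down_closed_def)
  then show "sbd g $ \<tau> = 0"
    using assms(2) by (auto simp: sbd_nth kd_def schain_def intro!: sum.neutral)
qed

lemma srank_0 [simp]: "srank F 0 (\<Delta> :: 'v::finite set set) = 0"
proof -
  have "sbd g = 0" if "g \<in> schain \<Delta> 0" for g :: "'a ^ 'v set"
    using that by (auto simp: vec_eq_iff sbd_nth kd_def schain_def faces_def intro!: sum.neutral)
  then have "(sbd ` schain \<Delta> 0 :: ('a ^ 'v set) set) \<subseteq> {0}" by auto
  then show ?thesis using vec.dim_subset[of _ "{0}"] by (auto simp: srank_def)
qed

definition scycle :: "'v::finite set set \<Rightarrow> nat \<Rightarrow> ('k::field ^ 'v set) set" where
  "scycle \<Delta> i = {g \<in> schain \<Delta> i. sbd g = 0}"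

lemma subspace_scycle: "vec.subspace (scycle \<Delta> i :: ('k::field ^ 'v::finite set) set)"
proof -
  interpret sbd: module_hom "(*s)" "(*s)" "sbd :: 'k ^ 'v set \<Rightarrow> _"
    by (simp add: module_hom_iff_linear linear_sbd)
  show ?thesis
    using vec.subspace_inter[OF subspace_schain sbd.subspace_kernel]
    by (simp add: scycle_def Int_def)
qed

lemma dim_scycle:
  "srank TYPE('k::field) i \<Delta> + vec.dim (scycle \<Delta> i :: ('k ^ 'v::finite set) set) = card (faces \<Delta> i)"
  unfolding srank_def scycle_def
  using vec.dim_image_plus_kernel[OF linear_sbd subspace_schain, of \<Delta> i] by (simp add: dim_schain)

lemma boundary_subset_scycle:
  "down_closed \<Delta> \<Longrightarrow> sbd ` schain \<Delta> (Suc i) \<subseteq> scycle \<Delta> i"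
  by (auto simp: scycle_def sbd_schain sbd_sbd)

lemma hdim_plus_ranks:
  fixes \<Delta> :: "'v::finite set set"
  assumes "down_closed \<Delta>"
  shows "hdim F i \<Delta> + srank F i \<Delta> + srank F (Suc i) \<Delta> = card (faces \<Delta> i)"
proof -
  have "srank F (Suc i) \<Delta> \<le> vec.dim (scycle \<Delta> i :: ('a ^ 'v set) set)"
    unfolding srank_def by (rule vec.dim_subset[OF boundary_subset_scycle[OF assms]])
  then show ?thesis using dim_scycle[where 'k = 'a, of i \<Delta>]
    by (simp add: hdim_def srank_def)
qed

text \<open>Identifies the rank formula with the dimension of an actual quotient. The finite bases
  are later glued together over all multidegrees.\<close>

lemma quot_dim_scycle:
  fixes \<Delta> :: "'v::finite set set"
  assumes "down_closed \<Delta>"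
  shows "quot_dim (*s) (scycle \<Delta> i) (sbd ` schain \<Delta> (Suc i) :: ('k::field ^ 'v set) set)
      = hdim TYPE('k) i \<Delta>"
    "\<exists>C. finite C \<and> quot_basis (*s) (scycle \<Delta> i) (sbd ` schain \<Delta> (Suc i) :: ('k ^ 'v set) set) C"
proof -
  have "scycle \<Delta> i \<subseteq> vec.span (cart_basis :: ('k ^ 'v set) set)" by simp
  note * = vec.quot_dim_plus_dim[OF subspace_scycle subspace_sbd_schain
      boundary_subset_scycle[OF assms] finite_cart_basis this]
  show "quot_dim (*s) (scycle \<Delta> i) (sbd ` schain \<Delta> (Suc i) :: ('k ^ 'v set) set)
      = hdim TYPE('k) i \<Delta>"
    using *(1) dim_scycle[where 'k = 'k, of i \<Delta>] hdim_plus_ranks[OF assms, of "TYPE('k)" i]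
    by (simp add: srank_def)
  show "\<exists>C. finite C \<and> quot_basis (*s) (scycle \<Delta> i) (sbd ` schain \<Delta> (Suc i) :: ('k ^ 'v set) set) C"
    by (rule *(2))
qed

section \<open>Homology killed by coning, and unions of complexes\<close>

definition vcone :: "'v::finite \<Rightarrow> 'k::field ^ 'v set \<Rightarrow> 'k ^ 'v set" where
  "vcone v g = (\<chi> \<sigma>. cone v (($) g) \<sigma>)"

lemma sbd_vcone:
  fixes g :: "'k::field ^ 'v::finite set"
  assumes "sbd g = 0"
  shows "sbd (vcone v g) = g"
proof -
  have "kd (*) (\<lambda>_. 1) (($) g) = (\<lambda>_. 0)" using assms by (simp add: vec_eq_iff sbd_nth fun_eq_iff)
  then have "kd (*) (\<lambda>_. 1) (cone v (($) g)) \<tau> = g $ \<tau>" for \<tau>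
    using kd_cone[of v "($) g" \<tau>] by (simp add: cone_def split: if_splits)
  moreover have "($) (vcone v g) = cone v (($) g)" by (simp add: vcone_def fun_eq_iff)
  ultimately show ?thesis by (simp add: vec_eq_iff sbd_nth)
qed

text \<open>The cone over a cycle is supported in \<open>A\<close> and has the cycle as its
  boundary, so homology classes of \<open>C\<close> die in \<open>A\<close>. With
  \<open>C = A\<close> this is the acyclicity of a cone; with \<open>C\<close> an intersection it
  splits the Mayer--Vietoris sequence.\<close>

lemma scycle_subset_boundary:
  fixes C A :: "'v::finite set set"
  assumes "\<And>\<tau>. \<tau> \<in> C \<Longrightarrow> insert v \<tau> \<in> A"
  shows "scycle C i \<subseteq> (sbd ` schain A (Suc i) :: ('k::field ^ 'v set) set)"
proof
  fix z :: "'k ^ 'v set" assume z: "z \<in> scycle C i"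
  have "\<sigma> \<in> faces A (Suc i)" if "vcone v z $ \<sigma> \<noteq> 0" for \<sigma>
  proof -
    have v: "v \<in> \<sigma>" "z $ (\<sigma> - {v}) \<noteq> 0" using that by (auto simp: vcone_def cone_def split: if_splits)
    then have "\<sigma> - {v} \<in> faces C i" using z by (auto simp: scycle_def schain_def)
    then have "\<sigma> - {v} \<in> C" "card (\<sigma> - {v}) = i" by (simp_all add: faces_def)
    have "card \<sigma> = Suc (card (\<sigma> - {v}))" by (rule card.remove[OF finite v(1)])
    with \<open>card (\<sigma> - {v}) = i\<close> have "card \<sigma> = Suc i" by (simp only:)
    moreover have "insert v (\<sigma> - {v}) \<in> A" using \<open>\<sigma> - {v} \<in> C\<close> by (rule assms)
    ultimately show ?thesis using v(1) by (simp add: faces_def insert_absorb)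
  qed
  then have "vcone v z \<in> schain A (Suc i)" by (auto simp: schain_def)
  moreover have "sbd (vcone v z) = z" using z by (simp add: sbd_vcone scycle_def)
  ultimately show "z \<in> sbd ` schain A (Suc i)" by force
qed

lemma hdim_cone:
  fixes \<Delta> :: "'v::finite set set"
  assumes \<Delta>: "down_closed \<Delta>" and "\<And>\<tau>. \<tau> \<in> \<Delta> \<Longrightarrow> insert v \<tau> \<in> \<Delta>"
  shows "hdim F i \<Delta> = 0"
proof -
  have "vec.dim (scycle \<Delta> i :: ('a ^ 'v set) set) \<le> srank F (Suc i) \<Delta>"
    unfolding srank_def by (rule vec.dim_subset[OF scycle_subset_boundary]) (rule assms(2))
  then show ?thesis
    using dim_scycle[where 'k = 'a, of i \<Delta>] hdim_plus_ranks[OF \<Delta>, of F i]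
    by (simp add: srank_def)
qed

text \<open>Boundaries of the union are sums of boundaries of \<open>A\<close> and of
  \<open>B\<close>. Boundaries common to both are cycles of \<open>A \<inter> B\<close>, and the
  cone hypotheses make every cycle of \<open>A \<inter> B\<close> such a common boundary; the rest
  is the dimension formula for sums of subspaces.\<close>

lemma srank_Un:
  fixes A B :: "'v::finite set set"
  assumes A: "down_closed A" and B: "down_closed B"
    and v: "\<And>\<tau>. \<tau> \<in> A \<inter> B \<Longrightarrow> insert v \<tau> \<in> A" and u: "\<And>\<tau>. \<tau> \<in> A \<inter> B \<Longrightarrow> insert u \<tau> \<in> B"
  shows "srank TYPE('k::field) (Suc i) (A \<union> B) +
      vec.dim (scycle (A \<inter> B) i :: ('k ^ 'v set) set) =
    srank TYPE('k) (Suc i) A + srank TYPE('k) (Suc i) B"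
proof -
  interpret sbd: module_hom "(*s)" "(*s)" "sbd :: 'k ^ 'v set \<Rightarrow> _"
    by (simp add: module_hom_iff_linear linear_sbd)
  let ?c = "\<lambda>\<Delta>. schain \<Delta> (Suc i) :: ('k ^ 'v set) set"
  have "?c (A \<union> B) = {x + y |x y. x \<in> ?c A \<and> y \<in> ?c B}"
  proof (intro set_eqI iffI)
    fix g assume g: "g \<in> ?c (A \<union> B)"
    define x y :: "'k ^ 'v set"
      where "x = (\<chi> \<sigma>. if \<sigma> \<in> A then g $ \<sigma> else 0)" and "y = (\<chi> \<sigma>. if \<sigma> \<in> A then 0 else g $ \<sigma>)"
    have "g = x + y" by (simp add: vec_eq_iff x_def y_def)
    moreover have "x \<in> ?c A" "y \<in> ?c B"
      using g by (auto simp: x_def y_def schain_def faces_def)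
    ultimately show "g \<in> {x + y |x y. x \<in> ?c A \<and> y \<in> ?c B}" by blast
  qed (auto simp: schain_def faces_def)
  then have sum: "sbd ` ?c (A \<union> B) = {x + y |x y. x \<in> sbd ` ?c A \<and> y \<in> sbd ` ?c B}"
    by (auto simp: sbd.add image_iff) (metis sbd.add)+
  have int: "sbd ` ?c A \<inter> sbd ` ?c B = scycle (A \<inter> B) i"
  proof (intro equalityI Int_greatest)
    show "sbd ` ?c A \<inter> sbd ` ?c B \<subseteq> scycle (A \<inter> B) i"
      using boundary_subset_scycle[OF A, of i] boundary_subset_scycle[OF B, of i]
      by (fastforce simp: scycle_def schain_Int)
  qed (intro scycle_subset_boundary; fact v u)+
  have "vec.dim (sbd ` ?c (A \<union> B)) + vec.dim (sbd ` ?c A \<inter> sbd ` ?c B) =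
      vec.dim (sbd ` ?c A) + vec.dim (sbd ` ?c B)"
    unfolding sum by (rule vec.dim_sums_Int; rule subspace_sbd_schain)
  then show ?thesis by (simp add: int srank_def)
qed

text \<open>
  The Mayer--Vietoris sequence splits into short exact sequences when \<open>A \<inter> B\<close> is contained in a
  cone inside \<open>A\<close> and in a cone inside \<open>B\<close>.
\<close>

lemma hdim_Un:
  fixes A B :: "'v::finite set set"
  assumes A: "down_closed A" and B: "down_closed B"
    and v: "\<And>\<tau>. \<tau> \<in> A \<inter> B \<Longrightarrow> insert v \<tau> \<in> A" and u: "\<And>\<tau>. \<tau> \<in> A \<inter> B \<Longrightarrow> insert u \<tau> \<in> B"
  shows "hdim F i (A \<union> B) =
    hdim F i A + hdim F i B + (case i of 0 \<Rightarrow> 0 | Suc j \<Rightarrow> hdim F j (A \<inter> B))"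
proof -
  have Un: "down_closed (A \<union> B)" and Int: "down_closed (A \<inter> B)"
    using A B by (auto simp: down_closed_def)
  have card: "card (faces (A \<union> B) i) + card (faces (A \<inter> B) i) = card (faces A i) + card (faces B i)"
    using card_Un_Int[of "faces A i" "faces B i"] by (simp add: faces_Un faces_Int)
  \<comment> \<open>Cycles of \<open>A \<inter> B\<close> are counted as faces minus rank. In the
    final computation the faces of \<open>A \<inter> B\<close> in degree \<open>i\<close> cancel
    against the face count of the union, and those in degree \<open>i - 1\<close> leave the homology
    of the intersection.\<close>
  have srank: "srank F (Suc j) (A \<union> B) + card (faces (A \<inter> B) j) =
      srank F (Suc j) A + srank F (Suc j) B + srank F j (A \<inter> B)" for j
    using srank_Un[where 'k = 'a, OF A B v u, of j] dim_scycle[where 'k = 'a, of j "A \<inter> B"]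
    by (simp add: srank_def)
  note ranks = hdim_plus_ranks[OF A, of F] hdim_plus_ranks[OF B, of F]
    hdim_plus_ranks[OF Un, of F] hdim_plus_ranks[OF Int, of F]
  show ?thesis
  proof (cases i)
    case 0
    then show ?thesis
      using card srank[of 0] ranks(1,2,3,4)[of 0] by simp
  next
    case (Suc j)
    then show ?thesis
      using card srank[of i] srank[of j] ranks(1,2,3)[of i] ranks(4)[of j] by simp
  qed
qed

section \<open>Dependence of homology on the field\<close>

text \<open>
  A primitive integer relation between the vectors stays nontrivial after reduction to any field.
\<close>

lemma integer_relation_reduce:
  fixes m :: "'i \<Rightarrow> 'n \<Rightarrow> int"
  assumes "finite N" "\<And>\<tau>. (\<Sum>\<sigma>\<in>N. c \<sigma> * m \<sigma> \<tau>) = 0" "\<sigma>0 \<in> N" "c \<sigma>0 \<noteq> 0"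
  shows "\<exists>c'. (\<forall>\<tau>. (\<Sum>\<sigma>\<in>N. c' \<sigma> * m \<sigma> \<tau>) = 0) \<and> (\<exists>\<sigma>\<in>N. of_int (c' \<sigma>) \<noteq> (0 :: 'f::field))"
  using assms(2,4)
proof (induction "nat \<bar>c \<sigma>0\<bar>" arbitrary: c rule: less_induct)
  case less
  show ?case
  proof (cases "\<exists>\<sigma>\<in>N. of_int (c \<sigma>) \<noteq> (0 :: 'f)")
    case True
    then show ?thesis using less.prems by blast
  next
    case False
    define p where "p = int CHAR('f)"
    \<comment> \<open>If every coefficient vanishes in \<open>'f\<close>, its characteristic divides
      all of them. It is not \<open>0\<close> since \<open>c \<sigma>0\<close> is not, and dividing
      by it makes \<open>c \<sigma>0\<close> smaller.\<close>
    have dvd: "p dvd c \<sigma>" if "\<sigma> \<in> N" for \<sigma>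
      using False that by (auto simp: p_def of_int_eq_0_iff_char_dvd)
    then have p0: "p \<noteq> 0" using assms(3) less.prems(2) by fastforce
    have p1: "p > 1" using p0 CHAR_not_1'[where 'a = 'f] unfolding p_def by linarith
    define d where "d = (\<lambda>\<sigma>. c \<sigma> div p)"
    have cd: "c \<sigma> = p * d \<sigma>" if "\<sigma> \<in> N" for \<sigma> using dvd[OF that] by (simp add: d_def)
    have "p * (\<Sum>\<sigma>\<in>N. d \<sigma> * m \<sigma> \<tau>) = 0" for \<tau>
      using less.prems(1)[of \<tau>] by (simp add: sum_distrib_left cd mult.assoc cong: sum.cong)
    then have "(\<Sum>\<sigma>\<in>N. d \<sigma> * m \<sigma> \<tau>) = 0" for \<tau> using p0 by simp
    moreover have "d \<sigma>0 \<noteq> 0" using cd[OF assms(3)] less.prems(2) by auto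
    moreover have "nat \<bar>d \<sigma>0\<bar> < nat \<bar>c \<sigma>0\<bar>"
      using cd[OF assms(3)] p1 \<open>d \<sigma>0 \<noteq> 0\<close> by (simp add: abs_mult)
    ultimately show ?thesis using less.hyps by blast
  qed
qed

text \<open>Columns independent over \<open>'f\<close> stay independent over the rationals: a
  rational relation becomes integral after clearing denominators and then, by
  \<open>integer_relation_reduce\<close>, yields a nontrivial relation over
  \<open>'f\<close>.\<close>

lemma integer_rank_le:
  fixes m :: "'i \<Rightarrow> 'n::finite \<Rightarrow> int"
  assumes "finite N"
  shows "vec.dim ((\<lambda>\<sigma>. (\<chi> \<tau>. of_int (m \<sigma> \<tau>)) :: 'f::field ^ 'n) ` N) \<le>
    vec.dim ((\<lambda>\<sigma>. (\<chi> \<tau>. of_int (m \<sigma> \<tau>)) :: rat ^ 'n) ` N)" (is "vec.dim (?f ` N) \<le> vec.dim (?q ` N)")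
proof -
  obtain D where D: "D \<subseteq> ?f ` N" "vec.independent D" "?f ` N \<subseteq> vec.span D" "card D = vec.dim (?f ` N)"
    by (rule vec.basis_exists)
  obtain M where M: "M \<subseteq> N" "inj_on ?f M" "?f ` M = D"
    using D(1) unfolding subset_image_inj by blast
  have finM: "finite M" using M assms finite_subset by blast
  have no_int_relation: False
    if rel: "\<And>\<tau>. (\<Sum>\<sigma>\<in>M. c \<sigma> * m \<sigma> \<tau>) = 0" "\<sigma>0 \<in> M" "c \<sigma>0 \<noteq> 0" for c :: "'i \<Rightarrow> int" and \<sigma>0
  proof -
    obtain c' \<sigma>1 where c': "\<And>\<tau>. (\<Sum>\<sigma>\<in>M. c' \<sigma> * m \<sigma> \<tau>) = 0" "\<sigma>1 \<in> M" "of_int (c' \<sigma>1) \<noteq> (0 :: 'f)"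
      using integer_relation_reduce[where 'f = 'f and m = m, OF finM rel] by blast
    have "(\<Sum>x\<in>D. of_int (c' (inv_into M ?f x)) *s x) = (\<Sum>\<sigma>\<in>M. of_int (c' \<sigma>) *s ?f \<sigma>)"
      using M(2) inv_into_f_f[OF M(2)] unfolding M(3)[symmetric]
      by (simp add: sum.reindex cong: sum.cong)
    also have "\<dots> = 0"
    proof -
      have "(\<Sum>\<sigma>\<in>M. of_int (c' \<sigma>) * of_int (m \<sigma> \<tau>)) = (of_int (\<Sum>\<sigma>\<in>M. c' \<sigma> * m \<sigma> \<tau>) :: 'f)" for \<tau>
        by simp
      then show ?thesis by (simp add: vec_eq_iff c'(1))
    qed
    finally have *: "(\<Sum>x\<in>D. of_int (c' (inv_into M ?f x)) *s x) = 0" .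
    have "finite D" using M finM by blast
    from vec.independentD[OF D(2) this order_refl *, of "?f \<sigma>1"] inv_into_f_f[OF M(2) c'(2)] M c'(2,3)
    show False by auto
  qed
  have indep: "u \<sigma>0 = 0" if "(\<Sum>\<sigma>\<in>M. u \<sigma> *s ?q \<sigma>) = 0" "\<sigma>0 \<in> M" for u \<sigma>0
  proof (rule ccontr)
    assume u0: "u \<sigma>0 \<noteq> 0"
    \<comment> \<open>A common denominator of all coefficients: the product of their reduced
      denominators.\<close>
    define d where "d = (\<Prod>\<sigma>\<in>M. snd (quotient_of (u \<sigma>)))"
    have pos: "snd (quotient_of (u \<sigma>)) > 0" for \<sigma> by (rule quotient_of_denom_pos')
    have "\<exists>z :: int. of_int d * u \<sigma> = of_int z" if "\<sigma> \<in> M" for \<sigma>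
    proof -
      let ?q = "quotient_of (u \<sigma>)"
      have "u \<sigma> = of_int (fst ?q) / of_int (snd ?q)" by (rule quotient_of_div) simp
      then have "of_int (snd ?q) * u \<sigma> = of_int (fst ?q)" using pos[of \<sigma>] by (simp add: field_simps)
      moreover have "d = (\<Prod>\<sigma>\<in>M - {\<sigma>}. snd (quotient_of (u \<sigma>))) * snd ?q"
        using finM that by (simp add: d_def prod.remove)
      ultimately have "of_int d * u \<sigma> = of_int ((\<Prod>\<sigma>\<in>M - {\<sigma>}. snd (quotient_of (u \<sigma>))) * fst ?q)"
        by simp
      then show ?thesis by blast
    qed
    then obtain z where z: "\<And>\<sigma>. \<sigma> \<in> M \<Longrightarrow> of_int d * u \<sigma> = of_int (z \<sigma> :: int)" by metis
    have "d > 0" unfolding d_def using pos by (intro prod_pos) auto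
    have "(\<Sum>\<sigma>\<in>M. z \<sigma> * m \<sigma> \<tau>) = 0" for \<tau>
    proof -
      have "(\<Sum>\<sigma>\<in>M. u \<sigma> * of_int (m \<sigma> \<tau>)) = 0"
        using that(1) by (simp add: vec_eq_iff)
      then have "0 = of_int d * (\<Sum>\<sigma>\<in>M. u \<sigma> * of_int (m \<sigma> \<tau>))" by simp
      also have "\<dots> = of_int (\<Sum>\<sigma>\<in>M. z \<sigma> * m \<sigma> \<tau>)"
        by (simp add: sum_distrib_left z flip: mult.assoc cong: sum.cong)
      finally show ?thesis by (simp only: of_int_eq_0_iff)
    qed
    moreover have "z \<sigma>0 \<noteq> 0" using z[OF that(2)] u0 \<open>d > 0\<close> by auto
    ultimately show False using no_int_relation that(2) by blast
  qed
  \<comment> \<open>Equal columns would satisfy a relation with coefficients \<open>1\<close> and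
    \<open>-1\<close>; so \<open>M\<close> can be counted through its columns over the
    rationals.\<close>
  have inj: "inj_on ?q M"
  proof (rule inj_onI, rule ccontr)
    fix x y assume xy: "x \<in> M" "y \<in> M" "?q x = ?q y" "x \<noteq> y"
    let ?u = "\<lambda>\<sigma>. if \<sigma> = x then 1 else if \<sigma> = y then -1 else 0"
    have "(\<Sum>\<sigma>\<in>M. ?u \<sigma> *s ?q \<sigma>) = (\<Sum>\<sigma>\<in>{x, y}. ?u \<sigma> *s ?q \<sigma>)"
      by (rule sum.mono_neutral_right) (use xy finM in auto)
    also have "\<dots> = 0" using xy by simp
    finally show False using indep[of ?u x] xy by simp
  qed
  have "vec.independent (?q ` M)"
  proof (rule vec.independent_if_scalars_zero)
    fix u v assume "(\<Sum>x\<in>?q ` M. u x *s x) = 0" "v \<in> ?q ` M"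
    then show "u v = 0" using indep[of "\<lambda>\<sigma>. u (?q \<sigma>)"] inj by (auto simp: sum.reindex)
  qed (use finM in simp)
  then have "card (?q ` M) \<le> vec.dim (?q ` N)"
    using M(1) by (intro vec.independent_card_le_dim) auto
  moreover have "card (?q ` M) = card D" using inj M(2,3) by (metis card_image)
  ultimately show ?thesis using D(4) by simp
qed

text \<open>Both boundary ranks are at least as large over the rationals, the number of faces is the
  same for all fields, and homology is faces minus ranks.\<close>

lemma hdim_rat_le:
  fixes \<Delta> :: "'v::finite set set"
  assumes "down_closed \<Delta>"
  shows "hdim TYPE(rat) i \<Delta> \<le> hdim TYPE('f::field) i \<Delta>"
proof -
  \<comment> \<open>The boundary matrix over the integers: \<open>m \<sigma>\<close> is the boundary
    of the single face \<open>\<sigma>\<close>, and mapping its entries to a field gives the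
    boundary there.\<close>
  define m :: "'v set \<Rightarrow> 'v set \<Rightarrow> int"
    where "m = (\<lambda>\<sigma>. kd (*) (\<lambda>_. 1) (\<lambda>\<rho>. if \<rho> = \<sigma> then 1 else 0))"
  have of_int_ksgn: "of_int (ksgn v \<tau>) = (ksgn v \<tau> :: 'a::field)" for v :: 'v and \<tau>
    by (simp add: ksgn_def)
  have axis: "sbd (axis \<sigma> 1 :: 'a::field ^ 'v set) = (\<chi> \<tau>. of_int (m \<sigma> \<tau>))" for \<sigma>
    by (auto simp: vec_eq_iff sbd_nth kd_def m_def axis_def of_int_ksgn intro!: sum.cong)
  have rank: "srank TYPE('a::field) j \<Delta> = vec.dim ((\<lambda>\<sigma>. (\<chi> \<tau>. of_int (m \<sigma> \<tau>)) :: 'a ^ 'v set) ` faces \<Delta> j)" for j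
  proof -
    interpret sbd: module_hom "(*s)" "(*s)" "sbd :: 'a ^ 'v set \<Rightarrow> _"
      by (simp add: module_hom_iff_linear linear_sbd)
    have "schain \<Delta> j = vec.span ((\<lambda>\<sigma>. axis \<sigma> 1 :: 'a ^ 'v set) ` faces \<Delta> j)"
    proof (rule vec.span_unique[symmetric])
      fix T assume T: "(\<lambda>\<sigma>. axis \<sigma> 1 :: 'a ^ 'v set) ` faces \<Delta> j \<subseteq> T" "vec.subspace T"
      show "schain \<Delta> j \<subseteq> T"
      proof
        fix g :: "'a ^ 'v set" assume g: "g \<in> schain \<Delta> j"
        have "g = (\<Sum>\<sigma>\<in>faces \<Delta> j. g $ \<sigma> *s axis \<sigma> 1)"
          using g by (auto simp: vec_eq_iff axis_def schain_def if_distrib cong: if_cong)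
        also have "\<dots> \<in> T" using T by (intro vec.subspace_sum vec.subspace_scale) auto
        finally show "g \<in> T" .
      qed
    qed (use subspace_schain in \<open>auto simp: schain_def axis_def\<close>)
    then show ?thesis
      unfolding srank_def by (simp add: sbd.span_image[symmetric] image_image axis)
  qed
  have "srank TYPE('f) j \<Delta> \<le> srank TYPE(rat) j \<Delta>" for j
    unfolding rank by (rule integer_rank_le) simp
  from this[of i] this[of "Suc i"] show ?thesis
    using hdim_plus_ranks[OF assms, of "TYPE(rat)" i] hdim_plus_ranks[OF assms, of "TYPE('f)" i]
    by linarith
qed

section \<open>Monomial ideals\<close>

abbreviation expon :: "'v expo \<Rightarrow> 'v \<Rightarrow> nat" where
  "expon \<equiv> Poly_Mapping.lookup"

abbreviation coef :: "('v, 'k::field) mpoly \<Rightarrow> 'v expo \<Rightarrow> 'k" where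
  "coef \<equiv> Poly_Mapping.lookup"

definition ediv :: "'v expo \<Rightarrow> 'v expo \<Rightarrow> bool" where
  "ediv a b \<longleftrightarrow> (\<forall>v. expon a v \<le> expon b v)"

definition esum :: "'v expo set \<Rightarrow> 'v expo set \<Rightarrow> 'v expo set" where
  "esum A B = {a + b |a b. a \<in> A \<and> b \<in> B}"

text \<open>The zeroth power is everything, like the unit ideal in \<open>ideal_pow\<close>; thus
  every \<open>epow E n\<close> is \<open>up_closed\<close>, whatever \<open>E\<close> is.\<close>

primrec epow :: "'v expo set \<Rightarrow> nat \<Rightarrow> 'v expo set" where
  "epow E 0 = UNIV"
| "epow E (Suc n) = esum E (epow E n)"

definition up_closed :: "'v expo set \<Rightarrow> bool" where
  "up_closed E \<longleftrightarrow> (\<forall>a\<in>E. \<forall>c. a + c \<in> E)"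

definition min_exps :: "'v expo set \<Rightarrow> 'v expo set" where
  "min_exps E = {a \<in> E. \<forall>b\<in>E. ediv b a \<longrightarrow> b = a}"

text \<open>For \<open>up_closed E\<close> this is the monomial ideal whose monomials have their
  exponents in \<open>E\<close>. One \<open>E\<close> describes the ideal over every coefficient
  field.\<close>

definition poly_on :: "'v expo set \<Rightarrow> ('v, 'k::field) mpoly set" where
  "poly_on E = {p. Poly_Mapping.keys p \<subseteq> E}"

lemma ediv_minus_add: "ediv a b \<Longrightarrow> (b - a) + a = b"
  by (rule poly_mapping_eqI) (simp add: ediv_def lookup_add lookup_minus)

lemma ediv_add [simp]: "ediv a (a + c)" "ediv a (c + a)"
  by (simp_all add: ediv_def lookup_add)

lemma ediv_iff: "ediv a b \<longleftrightarrow> (\<exists>c. b = a + c)"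
  by (metis add.commute ediv_add(1) ediv_minus_add)

lemma ediv_trans: "ediv a b \<Longrightarrow> ediv b c \<Longrightarrow> ediv a c"
  unfolding ediv_def by (meson order_trans)

lemma up_closedD: "up_closed E \<Longrightarrow> a \<in> E \<Longrightarrow> ediv a b \<Longrightarrow> b \<in> E"
  by (auto simp: up_closed_def ediv_iff)

lemma up_closed_esum_right: "up_closed B \<Longrightarrow> up_closed (esum A B)"
  unfolding up_closed_def esum_def by (auto simp: add.assoc) metis

lemma up_closed_UNIV [simp]: "up_closed UNIV"
  by (simp add: up_closed_def)

lemma up_closed_epow: "up_closed (epow E n)"
  by (induction n) (simp_all add: up_closed_esum_right)

lemma esum_UNIV_subset: "up_closed E \<Longrightarrow> esum E A \<subseteq> E"
  by (auto simp: esum_def up_closed_def)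

lemma in_esum_UNIV: "b \<in> esum A UNIV \<longleftrightarrow> (\<exists>a\<in>A. ediv a b)"
  by (auto simp: esum_def ediv_iff)

lemma poly_mapping_sum_single:
  "(\<Sum>a\<in>Poly_Mapping.keys p. Poly_Mapping.single a (Poly_Mapping.lookup p a)) = p"
  by (rule poly_mapping_eqI)
    (auto simp: lookup_sum lookup_single when_def in_keys_iff)

lemma single_eq_mult_monomial:
  "Poly_Mapping.single (a + c) x = Poly_Mapping.single c x * monomial a"
  by (simp add: monomial_def mult_single add.commute)

lemma keys_monomial [simp]: "Poly_Mapping.keys (monomial a :: ('v, 'k::field) mpoly) = {a}"
  by (simp add: monomial_def)

lemma monomial_in_poly_on [simp]: "monomial a \<in> poly_on E \<longleftrightarrow> a \<in> E"
  by (simp add: poly_on_def)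

lemma poly_on_inject [simp]: "poly_on A = (poly_on B :: ('v, 'k::field) mpoly set) \<longleftrightarrow> A = B"
  by (metis monomial_in_poly_on set_eqI)

lemma poly_on_UNIV [simp]: "poly_on UNIV = UNIV"
  by (simp add: poly_on_def)

interpretation ring_module: module "(*) :: 'r::comm_ring_1 \<Rightarrow> 'r \<Rightarrow> 'r"
  by (rule module_ring_self)

declare ring_module.scale_scale [simp del] \<comment> \<open>loops with \<open>mult.assoc\<close>\<close>

lemma subspace_poly_on:
  assumes "up_closed E"
  shows "ring_module.subspace (poly_on E :: ('v, 'k::field) mpoly set)"
proof (rule ring_module.subspaceI)
  fix p q :: "('v, 'k) mpoly"
  show "p + q \<in> poly_on E" if "p \<in> poly_on E" "q \<in> poly_on E"
    using that keys_add[of p q] by (auto simp: poly_on_def)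
  show "p * q \<in> poly_on E" if "q \<in> poly_on E"
  proof -
    have "a + b \<in> E" if "b \<in> E" for a b
      using assms that by (metis add.commute up_closed_def)
    then show ?thesis using that keys_mult[of p q] by (fastforce simp: poly_on_def)
  qed
qed (simp add: poly_on_def)

lemma poly_on_subset_ideal:
  fixes T :: "('v, 'k::field) mpoly set"
  assumes T: "ring_module.subspace T" and "\<And>a. a \<in> E \<Longrightarrow> monomial a \<in> T"
  shows "poly_on E \<subseteq> T"
proof
  fix p :: "('v, 'k) mpoly" assume p: "p \<in> poly_on E"
  have "(\<Sum>a\<in>Poly_Mapping.keys p. Poly_Mapping.single a (Poly_Mapping.lookup p a)) \<in> T"
  proof (rule ring_module.subspace_sum[OF T])
    fix a assume "a \<in> Poly_Mapping.keys p"
    then have "monomial a \<in> T" using p assms(2) by (auto simp: poly_on_def)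
    from ring_module.subspace_scale[OF T this, of "Poly_Mapping.single 0 (Poly_Mapping.lookup p a)"]
    show "Poly_Mapping.single a (Poly_Mapping.lookup p a) \<in> T"
      unfolding single_eq_mult_monomial[of a 0 "coef p a", simplified] .
  qed
  then show "p \<in> T" by (simp add: poly_mapping_sum_single)
qed

lemma ideal_of_monomials:
  "ideal_of (monomial ` A) = (poly_on (esum A UNIV) :: ('v, 'k::field) mpoly set)"
proof (rule ring_module.span_unique)
  show "monomial ` A \<subseteq> (poly_on (esum A UNIV) :: ('v, 'k) mpoly set)"
    by (force simp: in_esum_UNIV ediv_def)
  show "ring_module.subspace (poly_on (esum A UNIV) :: ('v, 'k) mpoly set)"
    by (intro subspace_poly_on up_closed_esum_right up_closed_UNIV)
  show "poly_on (esum A UNIV) \<subseteq> T"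
    if "monomial ` A \<subseteq> T" "ring_module.subspace T" for T :: "('v, 'k) mpoly set"
  proof (rule poly_on_subset_ideal[OF that(2)])
    fix b assume "b \<in> esum A UNIV"
    then obtain a c where "b = a + c" "a \<in> A" by (auto simp: esum_def)
    then have "monomial a \<in> T" using that(1) by blast
    then have "monomial c * monomial a \<in> T" by (rule ring_module.subspace_scale[OF that(2)])
    then show "monomial b \<in> T" using \<open>b = a + c\<close> by (simp add: monomial_def mult_single add.commute)
  qed
qed

lemma monomial_idealE:
  assumes "monomial_ideal I"
  obtains E where "up_closed E" "I = poly_on E"
  using assms unfolding monomial_ideal_def ideal_of_monomials
  by (metis up_closed_UNIV up_closed_esum_right)

text \<open>Descent on the total degree: an exponent that is not minimal has a divisor in
  \<open>E\<close> of smaller degree.\<close>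

lemma esum_min_exps:
  fixes E :: "'v::finite expo set"
  assumes "up_closed E"
  shows "esum (min_exps E) UNIV = E"
proof
  show "esum (min_exps E) UNIV \<subseteq> E"
    using assms by (auto simp: esum_def min_exps_def up_closed_def)
  have "\<exists>b\<in>min_exps E. ediv b a" if "a \<in> E" for a
    using that
  proof (induction "\<Sum>v\<in>UNIV. expon a v" arbitrary: a rule: less_induct)
    case less
    show ?case
    proof (cases "a \<in> min_exps E")
      case True
      then show ?thesis by (metis add_0_right ediv_add(1))
    next
      case False
      then obtain b where b: "b \<in> E" "ediv b a" "b \<noteq> a" using less.prems by (auto simp: min_exps_def)
      then obtain v where v: "expon b v \<noteq> expon a v" by (metis poly_mapping_eqI)
      have "(\<Sum>v\<in>UNIV. expon b v) < (\<Sum>v\<in>UNIV. expon a v)"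
        by (rule sum_strict_mono_ex1) (use b v in \<open>auto simp: ediv_def intro: exI[of _ v] le_neq_implies_less\<close>)
      from less.hyps[OF this b(1)] b(2) show ?thesis by (meson ediv_trans)
    qed
  qed
  then show "E \<subseteq> esum (min_exps E) UNIV" by (auto simp: in_esum_UNIV)
qed

text \<open>A minimal exponent is its own only divisor in \<open>E\<close>, so every generating set
  contains it. Hence \<open>min_exps E\<close> is the only irredundant generating set, which
  justifies the definite description in \<open>min_gens\<close>.\<close>

lemma min_gens_poly_on:
  fixes E :: "'v::finite expo set"
  assumes E: "up_closed E"
  shows "min_gens (poly_on E :: ('v, 'k::field) mpoly set) = min_exps E"
proof -
  have refl: "ediv a a" for a :: "'v expo" by (simp add: ediv_def)
  have min: "min_exps E \<subseteq> A" if "esum A UNIV = E" for A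
  proof
    fix a assume a: "a \<in> min_exps E"
    then have "a \<in> esum A UNIV" using that by (simp add: min_exps_def)
    then obtain b where b: "b \<in> A" "ediv b a" by (auto simp: in_esum_UNIV)
    then have "b \<in> E" unfolding that[symmetric] using refl by (auto simp: in_esum_UNIV)
    then show "a \<in> A" using a b by (auto simp: min_exps_def)
  qed
  show ?thesis
    unfolding min_gens_def ideal_of_monomials poly_on_inject
  proof (rule the_equality)
    show "E = esum (min_exps E) UNIV \<and> (\<forall>B\<subset>min_exps E. esum B UNIV \<noteq> E)"
      using esum_min_exps[OF E] min by blast
    show "A = min_exps E" if "E = esum A UNIV \<and> (\<forall>B\<subset>A. esum B UNIV \<noteq> E)" for A
      using that min[of A] esum_min_exps[OF E] by blast
  qed
qed

lemma betti_poly_on: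
  fixes E :: "'v::finite expo set"
  assumes "up_closed E"
  shows "betti TYPE('f::field) i (poly_on E :: ('v, 'k::field) mpoly set) =
    dim_tor (*) (poly_on E :: ('v, 'f) mpoly set) i"
  unfolding betti_def min_gens_poly_on[OF assms] ideal_of_monomials esum_min_exps[OF assms] ..

section \<open>Arithmetic of monomial ideals on exponent sets\<close>

lemma ideal_mult_poly_on:
  assumes B: "up_closed B"
  shows "ideal_mult (poly_on A) (poly_on B) = (poly_on (esum A B) :: ('v, 'k::field) mpoly set)"
  unfolding ideal_mult_def
proof (rule ring_module.span_unique)
  show "{p * q |p q. p \<in> poly_on A \<and> q \<in> poly_on B} \<subseteq> (poly_on (esum A B) :: ('v, 'k) mpoly set)"
    using keys_mult by (fastforce simp: poly_on_def esum_def)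
  show "ring_module.subspace (poly_on (esum A B) :: ('v, 'k) mpoly set)"
    by (intro subspace_poly_on up_closed_esum_right B)
  show "poly_on (esum A B) \<subseteq> T"
    if T: "{p * q |p q. p \<in> poly_on A \<and> q \<in> poly_on B} \<subseteq> T" "ring_module.subspace T"
    for T :: "('v, 'k) mpoly set"
  proof (rule poly_on_subset_ideal[OF T(2)])
    fix c assume "c \<in> esum A B"
    then obtain a b where ab: "c = a + b" "a \<in> A" "b \<in> B" by (auto simp: esum_def)
    then have "monomial c = (monomial a * monomial b :: ('v, 'k) mpoly)"
      by (simp add: monomial_def mult_single)
    moreover have "monomial a * monomial b \<in> T"
    proof (rule subsetD[OF T(1)], intro CollectI exI conjI)
      show "monomial a * monomial b = (monomial a * monomial b :: ('v, 'k) mpoly)" ..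
    qed (use ab in simp_all)
    ultimately show "monomial c \<in> T" by simp
  qed
qed

lemma ideal_add_poly_on:
  "ideal_add (poly_on A) (poly_on B) = (poly_on (A \<union> B) :: ('v, 'k::field) mpoly set)"
proof (intro equalityI subsetI)
  fix p :: "('v, 'k) mpoly" assume "p \<in> ideal_add (poly_on A) (poly_on B)"
  then show "p \<in> poly_on (A \<union> B)"
    using keys_add by (fastforce simp: poly_on_def ideal_add_def)
next
  fix p :: "('v, 'k) mpoly" assume p: "p \<in> poly_on (A \<union> B)"
  let ?K = "Poly_Mapping.keys p" and ?s = "\<lambda>a. Poly_Mapping.single a (Poly_Mapping.lookup p a)"
  have sub: "(\<Sum>a\<in>S. ?s a) \<in> poly_on S" for S
  proof -
    have "Poly_Mapping.keys (\<Sum>a\<in>S. ?s a) \<subseteq> S"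
      using keys_sum[of ?s S] by (auto split: if_splits)
    then show ?thesis by (simp add: poly_on_def)
  qed
  have "p = (\<Sum>a\<in>?K \<inter> A. ?s a) + (\<Sum>a\<in>?K - A. ?s a)"
    by (subst sum.Int_Diff[symmetric]) (simp_all add: poly_mapping_sum_single)
  moreover have "(\<Sum>a\<in>?K \<inter> A. ?s a) \<in> poly_on A" "(\<Sum>a\<in>?K - A. ?s a) \<in> poly_on B"
    using sub[of "?K \<inter> A"] sub[of "?K - A"] p by (auto simp: poly_on_def)
  ultimately show "p \<in> ideal_add (poly_on A) (poly_on B)" unfolding ideal_add_def by blast
qed

lemma ideal_pow_poly_on:
  "ideal_pow (poly_on E) n = (poly_on (epow E n) :: ('v, 'k::field) mpoly set)"
  by (induction n) (simp_all add: ideal_mult_poly_on up_closed_epow)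

section \<open>Dickson's lemma\<close>

lemma mono_subseq_nat:
  fixes g :: "nat \<Rightarrow> nat"
  shows "\<exists>r :: nat \<Rightarrow> nat. strict_mono r \<and> mono (g \<circ> r)"
proof -
  obtain f where f: "strict_mono f" "monoseq (\<lambda>n. g (f n))" using seq_monosub[of g] by blast
  show ?thesis
  proof (cases "\<forall>m. \<forall>n\<ge>m. g (f m) \<le> g (f n)")
    case True
    then show ?thesis using f(1) by (auto simp: mono_def intro!: exI[of _ f])
  next
    case False
    then have dec: "\<And>m n. m \<le> n \<Longrightarrow> g (f n) \<le> g (f m)" using f(2) by (auto simp: monoseq_def)
    \<comment> \<open>A non-increasing sequence of naturals is constant from its minimum on, and a
      constant tail is monotone.\<close>
    obtain m where m: "\<And>n. g (f m) \<le> g (f n)"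
      using ex_has_least_nat[of "\<lambda>_. True" _ "\<lambda>n. g (f n)"] by auto
    have "strict_mono (\<lambda>n. f (m + n))" using f(1) by (simp add: strict_mono_def)
    moreover have "g (f (m + n)) = g (f m)" for n using dec[of m "m + n"] m by (simp add: le_antisym)
    ultimately show ?thesis by (intro exI[of _ "\<lambda>n. f (m + n)"]) (simp add: mono_def)
  qed
qed

text \<open>The sequence is thinned out for one variable after another; further thinning preserves
  monotonicity in the variables already treated.\<close>

lemma dickson_subseq:
  fixes f :: "nat \<Rightarrow> 'v expo"
  assumes "finite V"
  shows "\<exists>r :: nat \<Rightarrow> nat. strict_mono r \<and> (\<forall>v\<in>V. mono (\<lambda>n. expon (f (r n)) v))"
  using assms
proof (induction V)
  case empty
  have "strict_mono (id :: nat \<Rightarrow> nat)" by (simp add: strict_mono_def)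
  then show ?case by blast
next
  case (insert u V)
  then obtain r :: "nat \<Rightarrow> nat" where r: "strict_mono r" "\<And>v. v \<in> V \<Longrightarrow> mono (\<lambda>n. expon (f (r n)) v)" by blast
  obtain q :: "nat \<Rightarrow> nat" where q: "strict_mono q" "mono ((\<lambda>n. expon (f (r n)) u) \<circ> q)"
    using mono_subseq_nat by blast
  have "mono q" using q(1) by (rule strict_mono_mono)
  then have "mono (\<lambda>n. expon (f (r (q n))) v)" if "v \<in> V" for v
    using r(2)[OF that] by (simp add: mono_def)
  then show ?case
    using r(1) q by (intro exI[of _ "r \<circ> q"]) (auto simp: strict_mono_def o_def)
qed

text \<open>An infinite sequence of distinct minimal exponents would contain two of which one
  divides the other. Finiteness later bounds the multidegrees in which homology occurs.\<close>

lemma finite_min_exps: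
  fixes E :: "'v::finite expo set"
  shows "finite (min_exps E)"
proof (rule ccontr)
  assume "infinite (min_exps E)"
  then obtain f :: "nat \<Rightarrow> 'v expo" where f: "inj f" "range f \<subseteq> min_exps E"
    by (metis infinite_countable_subset)
  obtain r :: "nat \<Rightarrow> nat" where r: "strict_mono r" "\<And>v. mono (\<lambda>n. expon (f (r n)) v)"
    using dickson_subseq[of UNIV f] by auto
  have "ediv (f (r 0)) (f (r 1))" using r(2) by (simp add: ediv_def mono_def)
  moreover have "f (r 0) \<in> E" "f (r 1) \<in> min_exps E" using f(2) by (auto simp: min_exps_def)
  ultimately have "f (r 0) = f (r 1)" by (simp add: min_exps_def)
  then have "r 0 = r 1" using f(1) by (simp add: inj_eq)
  then show False using r(1) by (metis strict_mono_eq zero_neq_one)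
qed

section \<open>Free resolutions exist\<close>

definition lin_ext :: "('r::comm_ring_1 \<Rightarrow> 'm::ab_group_add \<Rightarrow> 'm) \<Rightarrow> ('b \<Rightarrow> 'm) \<Rightarrow> ('b \<Rightarrow>\<^sub>0 'r) \<Rightarrow> 'm" where
  "lin_ext s g f = (\<Sum>n\<in>Poly_Mapping.keys f. s (Poly_Mapping.lookup f n) (g n))"

lemma keys_fscale_subset: "Poly_Mapping.keys (fscale r f) \<subseteq> Poly_Mapping.keys f"
  by (auto simp: in_keys_iff lookup_fscale)

lemma subspace_free_on: "module.subspace fscale (free_on S)"
proof -
  interpret module fscale by (rule module_fscale)
  show ?thesis
  proof (rule subspaceI)
    show "x + y \<in> free_on S" if "x \<in> free_on S" "y \<in> free_on S" for x y :: "'b \<Rightarrow>\<^sub>0 'a"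
      using that keys_add[of x y] by (auto simp: free_on_def)
    show "fscale c x \<in> free_on S" if "x \<in> free_on S" for c and x :: "'b \<Rightarrow>\<^sub>0 'a"
      using that keys_fscale_subset[of c x] by (auto simp: free_on_def)
  qed (simp add: free_on_def)
qed

context module
begin

lemma lin_ext_superset:
  assumes "finite N" "Poly_Mapping.keys f \<subseteq> N"
  shows "lin_ext scale g f = (\<Sum>n\<in>N. scale (Poly_Mapping.lookup f n) (g n))"
  unfolding lin_ext_def by (rule sum.mono_neutral_left) (use assms in \<open>auto simp: in_keys_iff\<close>)

lemma module_hom_lin_ext: "module_hom fscale scale (lin_ext scale g)"
proof -
  interpret f: module "fscale :: 'a \<Rightarrow> ('c \<Rightarrow>\<^sub>0 'a) \<Rightarrow> _" by (rule module_fscale)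
  have add: "lin_ext scale g (f + f') = lin_ext scale g f + lin_ext scale g f'" for f f' :: "'c \<Rightarrow>\<^sub>0 'a"
  proof -
    let ?N = "Poly_Mapping.keys f \<union> Poly_Mapping.keys f'"
    have "lin_ext scale g (f + f') = (\<Sum>n\<in>?N. scale (Poly_Mapping.lookup (f + f') n) (g n))"
      by (rule lin_ext_superset) (use keys_add[of f f'] in auto)
    also have "\<dots> = lin_ext scale g f + lin_ext scale g f'"
      by (subst (1 2) lin_ext_superset[where N = ?N])
        (auto simp: lookup_add scale_left_distrib sum.distrib)
    finally show ?thesis .
  qed
  have "lin_ext scale g (fscale r f) = scale r (lin_ext scale g f)" for r and f :: "'c \<Rightarrow>\<^sub>0 'a"
  proof -
    show ?thesis
      using keys_fscale_subset[of r f] by (subst lin_ext_superset[where N = "Poly_Mapping.keys f"])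
        (auto simp: lookup_fscale lin_ext_def scale_sum_right)
  qed
  then show ?thesis using add by unfold_locales auto
qed

lemma lin_ext_single [simp]: "lin_ext scale g (Poly_Mapping.single n r) = scale r (g n)"
  by (auto simp: lin_ext_def)

lemma lin_ext_image_free_on: "lin_ext scale g ` free_on S = span (g ` S)"
proof -
  interpret l: module_hom fscale scale "lin_ext scale g" by (rule module_hom_lin_ext)
  show ?thesis
  proof (rule span_unique[symmetric])
    show "g ` S \<subseteq> lin_ext scale g ` free_on S"
    proof
      fix x assume "x \<in> g ` S"
      then obtain n where "n \<in> S" "x = lin_ext scale g (Poly_Mapping.single n 1)" by auto
      moreover have "Poly_Mapping.single n 1 \<in> free_on S" using \<open>n \<in> S\<close> by (simp add: free_on_def)
      ultimately show "x \<in> lin_ext scale g ` free_on S" by blast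
    qed
    show "subspace (lin_ext scale g ` free_on S)"
      by (rule l.subspace_image[OF subspace_free_on])
    show "lin_ext scale g ` free_on S \<subseteq> T" if "g ` S \<subseteq> T" "subspace T" for T
      using that by (auto simp: lin_ext_def free_on_def intro!: subspace_sum subspace_scale)
  qed
qed

end

lemma hom_eq_lin_ext:
  assumes "module_hom fscale s h"
  shows "h f = lin_ext s (\<lambda>n. h (Poly_Mapping.single n 1)) f"
proof -
  interpret h: module_hom fscale s h by fact
  have "f = (\<Sum>n\<in>Poly_Mapping.keys f. fscale (Poly_Mapping.lookup f n) (Poly_Mapping.single n 1))"
    by (rule poly_mapping_eqI) (auto simp: lookup_sum lookup_fscale lookup_single when_def in_keys_iff if_distrib cong: if_cong)
  then have "h f = h (\<Sum>n\<in>Poly_Mapping.keys f. fscale (Poly_Mapping.lookup f n) (Poly_Mapping.single n 1))"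
    by simp
  then show ?thesis by (simp add: h.sum h.scale lin_ext_def)
qed

lemma free_on_UNIV [simp]: "free_on UNIV = UNIV"
  by (simp add: free_on_def)

text \<open>
  A basis of a subspace of a space with countable basis: one element for every possible position of
  the last nonzero coordinate.
\<close>

lemma countably_generated:
  fixes s :: "('v, 'k::field) mpoly \<Rightarrow> 'm::ab_group_add \<Rightarrow> 'm" and \<phi> :: "'m \<Rightarrow> nat \<Rightarrow> 'k"
  assumes s: "module s" and M: "module.subspace s M"
    and diff: "\<And>x y n. \<phi> (x - y) n = \<phi> x n - \<phi> y n"
    and scale: "\<And>c x n. \<phi> (s (Poly_Mapping.single 0 c) x) n = c * \<phi> x n"
    and inj: "\<And>x. (\<And>n. \<phi> x n = 0) \<Longrightarrow> x = 0"
    and fin: "\<And>x. finite {n. \<phi> x n \<noteq> 0}"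
  shows "\<exists>g :: nat \<Rightarrow> 'm. module.span s (range g) = M"
proof -
  interpret module s by fact
  define top where "top n x \<longleftrightarrow> x \<in> M \<and> \<phi> x n \<noteq> 0 \<and> (\<forall>j>n. \<phi> x j = 0)" for n x
  define g where "g n = (if \<exists>x. top n x then SOME x. top n x else 0)" for n
  have g: "top n (g n)" if "top n x" for n x
    using someI[of "top n", OF that] that by (auto simp: g_def)
  have gM: "g n \<in> M" for n
  proof (cases "\<exists>x. top n x")
    case True
    then show ?thesis using g by (auto simp: top_def)
  qed (simp add: g_def subspace_0[OF M])
  have "x \<in> span (range g)" if "x \<in> M" "\<forall>j\<ge>N. \<phi> x j = 0" for x N
    using that
  proof (induction N arbitrary: x)
    case 0
    then have "x = 0" using inj by simp
    then show ?case by (simp add: span_zero)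
  next
    case (Suc N)
    show ?case
    proof (cases "\<phi> x N = 0")
      case True
      have "\<forall>j\<ge>N. \<phi> x j = 0" using True Suc.prems(2) by (metis Suc_leI le_neq_implies_less)
      then show ?thesis using Suc.IH Suc.prems(1) by blast
    next
      case False
      then have "top N x" using Suc.prems by (auto simp: top_def)
      then have tg: "top N (g N)" by (rule g)
      define c where "c = \<phi> x N / \<phi> (g N) N"
      let ?y = "s (Poly_Mapping.single 0 c) (g N)"
      have "\<phi> (x - ?y) j = 0" if "j \<ge> N" for j
        using that tg Suc.prems(2) by (cases "j = N") (auto simp: diff scale c_def top_def)
      then have "x - ?y \<in> span (range g)"
        using Suc.prems(1) gM by (intro Suc.IH subspace_diff[OF M] subspace_scale[OF M]) auto
      moreover have "?y \<in> span (range g)" by (intro span_scale span_base) simp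
      ultimately have "x - ?y + ?y \<in> span (range g)" by (rule span_add)
      then show ?thesis by simp
    qed
  qed
  moreover have "\<exists>N. \<forall>j\<ge>N. \<phi> x j = 0" for x
  proof -
    obtain N where "{n. \<phi> x n \<noteq> 0} \<subseteq> {..<N}" using finite_nat_iff_bounded fin by blast
    then show ?thesis by (intro exI[of _ N]) force
  qed
  ultimately have "M \<subseteq> span (range g)" by blast
  moreover have "span (range g) \<subseteq> M" using gM M by (intro span_minimal) auto
  ultimately show ?thesis by blast
qed

lemma ex_inj_expo: "\<exists>\<iota> :: 'v::finite expo \<Rightarrow> nat. inj \<iota>"
proof -
  have "inj (\<lambda>a :: 'v expo. to_nat (expon a))"
  proof (rule injI)
    fix a b :: "'v expo" assume "to_nat (expon a) = to_nat (expon b)"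
    then have "expon a = expon b" by simp
    then show "a = b" by (simp add: poly_mapping_eqI)
  qed
  then show ?thesis by blast
qed

lemma coef_single_0_mult: "coef (Poly_Mapping.single 0 c * p) a = c * coef p a"
  by (simp add: mult_map_scale_conv_mult[symmetric] Poly_Mapping.map.rep_eq when_def)

text \<open>The coordinates are the coefficients, numbered by an injection of exponents into
  \<open>nat\<close>. Countable generation takes the place of the Hilbert basis theorem, since bases
  in \<open>free_resolution\<close> may be infinite.\<close>

lemma ex_hom_onto_ideal:
  fixes M :: "('v::finite, 'k::field) mpoly set"
  assumes "ring_module.subspace M"
  shows "\<exists>e :: (nat \<Rightarrow>\<^sub>0 ('v, 'k) mpoly) \<Rightarrow> _. module_hom fscale (*) e \<and> range e = M"
proof -
  obtain \<iota> :: "'v expo \<Rightarrow> nat" where \<iota>: "inj \<iota>" using ex_inj_expo by blast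
  define \<phi> where "\<phi> p n = (if n \<in> range \<iota> then coef p (inv \<iota> n) else 0)" for p :: "('v, 'k) mpoly" and n
  have "\<exists>g :: nat \<Rightarrow> ('v, 'k) mpoly. ring_module.span (range g) = M"
  proof (rule countably_generated[OF module_ring_self assms, where \<phi> = \<phi>])
    show "x = 0" if "\<And>n. \<phi> x n = 0" for x
    proof (rule poly_mapping_eqI)
      fix a show "coef x a = coef 0 a" using that[of "\<iota> a"] \<iota> by (simp add: \<phi>_def)
    qed
    show "finite {n. \<phi> x n \<noteq> 0}" for x
    proof (rule finite_subset)
      show "{n. \<phi> x n \<noteq> 0} \<subseteq> \<iota> ` Poly_Mapping.keys x"
        using \<iota> by (auto simp: \<phi>_def in_keys_iff)
    qed simp
  qed (auto simp: \<phi>_def lookup_minus coef_single_0_mult)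
  then obtain g :: "nat \<Rightarrow> ('v, 'k) mpoly" where "ring_module.span (range g) = M" by blast
  then have "range (lin_ext (*) g) = M" using ring_module.lin_ext_image_free_on[of g UNIV] by simp
  then show ?thesis using ring_module.module_hom_lin_ext by blast
qed

text \<open>The coordinates are now indexed by pairs of a basis element and an exponent.\<close>

lemma ex_hom_onto_submodule:
  fixes M :: "(nat \<Rightarrow>\<^sub>0 ('v::finite, 'k::field) mpoly) set"
  assumes "module.subspace fscale M"
  shows "\<exists>d :: (nat \<Rightarrow>\<^sub>0 ('v, 'k) mpoly) \<Rightarrow> _. module_hom fscale fscale d \<and> range d = M"
proof -
  interpret f: module "fscale :: ('v, 'k) mpoly \<Rightarrow> (nat \<Rightarrow>\<^sub>0 ('v, 'k) mpoly) \<Rightarrow> _"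
    by (rule module_fscale)
  obtain \<iota>' :: "'v expo \<Rightarrow> nat" where \<iota>': "inj \<iota>'" using ex_inj_expo by blast
  define \<iota> where "\<iota> = (\<lambda>(n, a). to_nat (n :: nat, \<iota>' a))"
  have \<iota>: "inj \<iota>" using \<iota>' by (auto simp: \<iota>_def inj_def)
  define \<phi> where "\<phi> p n = (if n \<in> range \<iota> then coef (Poly_Mapping.lookup p (fst (inv \<iota> n))) (snd (inv \<iota> n)) else 0)"
    for p :: "nat \<Rightarrow>\<^sub>0 ('v, 'k) mpoly" and n
  have "\<exists>g :: nat \<Rightarrow> (nat \<Rightarrow>\<^sub>0 ('v, 'k) mpoly). f.span (range g) = M"
  proof (rule countably_generated[OF module_fscale assms, where \<phi> = \<phi>])
    show "x = 0" if "\<And>n. \<phi> x n = 0" for x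
    proof (intro poly_mapping_eqI)
      fix n a show "coef (Poly_Mapping.lookup x n) a = coef (Poly_Mapping.lookup 0 n) a"
        using that[of "\<iota> (n, a)"] \<iota> by (simp add: \<phi>_def)
    qed
    show "finite {n. \<phi> x n \<noteq> 0}" for x
    proof (rule finite_subset)
      show "{n. \<phi> x n \<noteq> 0} \<subseteq>
          \<iota> ` (Sigma (Poly_Mapping.keys x) (\<lambda>n. Poly_Mapping.keys (Poly_Mapping.lookup x n)))"
      proof
        fix m assume "m \<in> {n. \<phi> x n \<noteq> 0}"
        then obtain n a where na: "m = \<iota> (n, a)" "\<phi> x m \<noteq> 0" by (auto simp: \<phi>_def split: if_splits)
        then have nz: "coef (Poly_Mapping.lookup x n) a \<noteq> 0" using \<iota> by (simp add: \<phi>_def)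
        then have "Poly_Mapping.lookup x n \<noteq> 0" by auto
        with nz na(1) show "m \<in> \<iota> ` (Sigma (Poly_Mapping.keys x) (\<lambda>n. Poly_Mapping.keys (Poly_Mapping.lookup x n)))"
          by (auto simp: in_keys_iff)
      qed
    qed (intro finite_imageI finite_SigmaI; simp)
  qed (auto simp: \<phi>_def lookup_minus lookup_fscale coef_single_0_mult)
  then obtain g :: "nat \<Rightarrow> (nat \<Rightarrow>\<^sub>0 ('v, 'k) mpoly)" where "f.span (range g) = M" by blast
  then have "range (lin_ext fscale g) = M" using f.lin_ext_image_free_on[of g UNIV] by simp
  then show ?thesis using f.module_hom_lin_ext by blast
qed

lemma ex_free_resolution:
  fixes M :: "('v::finite, 'k::field) mpoly set"
  assumes "ring_module.subspace M"
  shows "\<exists>S d e. free_resolution (*) M S d e"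
proof -
  obtain e :: "(nat \<Rightarrow>\<^sub>0 ('v, 'k) mpoly) \<Rightarrow> ('v, 'k) mpoly"
    where e: "module_hom fscale (*) e" "range e = M"
    using ex_hom_onto_ideal[OF assms] by blast
  define D :: "(nat \<Rightarrow>\<^sub>0 ('v, 'k) mpoly) set \<Rightarrow> (nat \<Rightarrow>\<^sub>0 ('v, 'k) mpoly) \<Rightarrow> (nat \<Rightarrow>\<^sub>0 ('v, 'k) mpoly)"
    where "D K = (SOME d. module_hom fscale fscale d \<and> range d = K)" for K
  \<comment> \<open>The successive syzygy modules: the kernel of \<open>e\<close>, then the kernel
    of the map chosen onto the preceding one.\<close>
  define K where "K = rec_nat {f. e f = 0} (\<lambda>_ K. {f. D K f = 0})"
  have K: "K 0 = {f. e f = 0}" "K (Suc j) = {f. D (K j) f = 0}" for j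
    by (simp_all add: K_def)
  have D: "module_hom fscale fscale (D L) \<and> range (D L) = L" if "module.subspace fscale L" for L
    using someI_ex[OF ex_hom_onto_submodule[OF that]] unfolding D_def .
  have sub: "module.subspace fscale (K j)" for j
  proof (induction j)
    case 0
    show ?case unfolding K(1) by (rule module_hom.subspace_kernel[OF e(1)])
  next
    case (Suc j)
    show ?case unfolding K(2) by (rule module_hom.subspace_kernel) (use D[OF Suc] in blast)
  qed
  have "free_resolution (*) M (\<lambda>_. UNIV) (\<lambda>j. D (K j)) e"
    unfolding free_resolution_def using e D[OF sub] by (simp flip: K)
  then show ?thesis by blast
qed

section \<open>Tor in terms of constant coefficients\<close>

lemma coef_single_mult:
  "coef (Poly_Mapping.single a x * q) b = (if ediv a b then x * coef q (b - a) else 0)"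
proof -
  have iff: "a + c = b \<longleftrightarrow> ediv a b \<and> c = b - a" for c
    using ediv_minus_add[of a b] by (auto simp: add.commute)
  have "Poly_Mapping.single a x * q =
      (\<Sum>c\<in>Poly_Mapping.keys q. Poly_Mapping.single a x * Poly_Mapping.single c (coef q c))"
    by (simp add: poly_mapping_sum_single flip: sum_distrib_left)
  then have "coef (Poly_Mapping.single a x * q) b = (\<Sum>c\<in>Poly_Mapping.keys q. if a + c = b then x * coef q c else 0)"
    by (simp add: lookup_sum mult_single lookup_single when_def)
  also have "\<dots> = (if ediv a b then x * coef q (b - a) else 0)"
    by (auto simp: iff in_keys_iff sum.neutral)
  finally show ?thesis .
qed

lemma coef_mult_0:
  fixes p q :: "('v, 'k::field) mpoly"
  shows "coef (p * q) 0 = coef p 0 * coef q 0"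
proof -
  have iff: "ediv a 0 \<longleftrightarrow> a = 0" for a :: "'v expo"
    by (auto simp: ediv_def intro: poly_mapping_eqI)
  have "p * q = (\<Sum>a\<in>Poly_Mapping.keys p. Poly_Mapping.single a (coef p a) * q)"
    by (simp add: poly_mapping_sum_single flip: sum_distrib_right)
  then have "coef (p * q) 0 = (\<Sum>a\<in>Poly_Mapping.keys p. if ediv a 0 then coef p a * coef q (0 - a) else 0)"
    by (simp add: lookup_sum coef_single_mult)
  also have "\<dots> = (\<Sum>a\<in>Poly_Mapping.keys p. if a = 0 then coef p 0 * coef q 0 else 0)"
    by (intro sum.cong) (simp_all add: iff)
  finally show ?thesis by (auto simp: in_keys_iff)
qed

text \<open>Reduction modulo the variables: a free module tensored with the residue field is the
  vector space on the same basis.\<close>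

definition const :: "('b \<Rightarrow>\<^sub>0 ('v, 'k::field) mpoly) \<Rightarrow> ('b \<Rightarrow>\<^sub>0 'k)" where
  "const f = Poly_Mapping.map (\<lambda>p. coef p 0) f"

definition const_scale :: "('v, 'k::field) mpoly \<Rightarrow> ('b \<Rightarrow>\<^sub>0 'k) \<Rightarrow> ('b \<Rightarrow>\<^sub>0 'k)" where
  "const_scale r f = fscale (coef r 0) f"

text \<open>A section of \<open>const\<close> that is linear over the field, not over the polynomial
  ring.\<close>

definition of_const :: "('b \<Rightarrow>\<^sub>0 'k::field) \<Rightarrow> ('b \<Rightarrow>\<^sub>0 ('v, 'k) mpoly)" where
  "of_const f = Poly_Mapping.map (Poly_Mapping.single 0) f"

abbreviation const_fscale :: "'k::field \<Rightarrow> ('b \<Rightarrow>\<^sub>0 ('v, 'k) mpoly) \<Rightarrow> ('b \<Rightarrow>\<^sub>0 ('v, 'k) mpoly)" where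
  "const_fscale \<equiv> \<lambda>c. fscale (Poly_Mapping.single 0 c)"

lemma lookup_const: "Poly_Mapping.lookup (const f) n = coef (Poly_Mapping.lookup f n) 0"
  by (simp add: const_def Poly_Mapping.map.rep_eq when_def)

lemma lookup_of_const: "Poly_Mapping.lookup (of_const f) n = Poly_Mapping.single 0 (Poly_Mapping.lookup f n)"
  by (simp add: of_const_def Poly_Mapping.map.rep_eq when_def)

lemma const_of_const [simp]: "const (of_const f) = f"
  by (rule poly_mapping_eqI) (simp add: lookup_const lookup_of_const)

lemma keys_const_subset: "Poly_Mapping.keys (const f) \<subseteq> Poly_Mapping.keys f"
  by (auto simp: in_keys_iff lookup_const)

lemma single_eq_0_iff: "Poly_Mapping.single n x = 0 \<longleftrightarrow> x = 0"
  by (metis lookup_single_eq lookup_zero single_zero)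

lemma of_const_in_free_on [simp]: "of_const f \<in> free_on S \<longleftrightarrow> f \<in> free_on S"
  by (simp add: free_on_def in_keys_iff lookup_of_const single_eq_0_iff subset_iff)

lemma module_const_scale: "module (const_scale :: ('v, 'k::field) mpoly \<Rightarrow> ('b \<Rightarrow>\<^sub>0 'k) \<Rightarrow> _)"
proof 
  show "const_scale a (x + y) = const_scale a x + const_scale a y" for a :: "('v, 'k::field) mpoly" and x y :: "'b \<Rightarrow>\<^sub>0 'k"
    by (rule poly_mapping_eqI) (simp add: const_scale_def lookup_fscale lookup_add  distrib_left)
  show "const_scale (a+b) x = const_scale a x + const_scale b x" for a b :: "('v, 'k::field) mpoly" and x y :: "'b \<Rightarrow>\<^sub>0 'k"
    by (rule poly_mapping_eqI) (simp add: const_scale_def lookup_fscale lookup_add  distrib_right)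
  show "const_scale a (const_scale b x) = const_scale (a*b) x" for a b :: "('v, 'k::field) mpoly" and x y :: "'b \<Rightarrow>\<^sub>0 'k"
    by (rule poly_mapping_eqI) (simp only: const_scale_def lookup_fscale coef_mult_0 mult.assoc)
  show "const_scale 1 x = x" for x y :: "'b \<Rightarrow>\<^sub>0 'k"
    by (rule poly_mapping_eqI) (simp add: const_scale_def lookup_fscale)
qed

lemma module_hom_const:
  "module_hom fscale const_scale (const :: ('b \<Rightarrow>\<^sub>0 ('v, 'k::field) mpoly) \<Rightarrow> _)"
proof -
  interpret a: module "fscale :: ('v, 'k) mpoly \<Rightarrow> ('b \<Rightarrow>\<^sub>0 ('v, 'k) mpoly) \<Rightarrow> _" by (rule module_fscale)
  interpret b: module "const_scale :: ('v, 'k) mpoly \<Rightarrow> ('b \<Rightarrow>\<^sub>0 'k) \<Rightarrow> _" by (rule module_const_scale)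
  show ?thesis
  proof
    show "const (x + y) = const x + const y" for x y :: "'b \<Rightarrow>\<^sub>0 ('v, 'k) mpoly"
      by (rule poly_mapping_eqI) (simp add: lookup_add lookup_const)
    show "const (fscale r x) = const_scale r (const x)" for r and x :: "'b \<Rightarrow>\<^sub>0 ('v, 'k) mpoly"
      by (rule poly_mapping_eqI) (simp only: const_scale_def lookup_fscale lookup_const coef_mult_0)
  qed
qed

lemma vector_space_restrict_scalars:
  fixes s :: "('v, 'k::field) mpoly \<Rightarrow> 'm::ab_group_add \<Rightarrow> 'm"
  assumes "module s"
  shows "vector_space (\<lambda>c. s (Poly_Mapping.single 0 c))"
proof -
  interpret module s by fact
  show ?thesis
    by unfold_locales
      (simp_all add: scale_right_distrib single_add scale_left_distrib mult_single)
qed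

lemma vector_space_fscale: "vector_space (fscale :: 'k::field \<Rightarrow> ('b \<Rightarrow>\<^sub>0 'k) \<Rightarrow> _)"
  by (rule module_iff_vector_space[THEN iffD1, OF module_fscale])

text \<open>On representatives, the isomorphism of \<open>F \<otimes> k\<close> with the space of
  constant coefficients: \<open>m \<otimes> n\<close> goes to \<open>n\<close> times the reduction
  of \<open>m\<close>.\<close>

definition tensor_const :: "((nat \<Rightarrow>\<^sub>0 ('v, 'k::field) mpoly) \<times> 'k \<Rightarrow>\<^sub>0 ('v, 'k) mpoly) \<Rightarrow> (nat \<Rightarrow>\<^sub>0 'k)" where
  "tensor_const = lin_ext const_scale (\<lambda>(m, n). fscale n (const m))"

lemma module_hom_tensor_const: "module_hom fscale const_scale tensor_const"
  unfolding tensor_const_def by (rule module.module_hom_lin_ext[OF module_const_scale])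

lemma tensor_const_single:
  "tensor_const (Poly_Mapping.single (m, n) r) = fscale (coef r 0 * n) (const m)"
proof -
  have "tensor_const (Poly_Mapping.single (m, n) r) = const_scale r (fscale n (const m))"
    using module.lin_ext_single[OF module_const_scale, of "\<lambda>(m, n). fscale n (const m)" "(m, n)" r]
    by (simp only: tensor_const_def prod.case)
  also have "\<dots> = fscale (coef r 0 * n) (const m)"
    unfolding const_scale_def by (rule module.scale_scale[OF module_fscale])
  finally show ?thesis .
qed

text \<open>The generating relations die under \<open>tensor_const\<close>. Conversely, modulo
  relations every element is a sum of terms \<open>e_j \<otimes> c_j\<close> with basis vectors
  \<open>e_j\<close> and with \<open>c_j\<close> its coordinates under \<open>tensor_const\<close>;
  if these vanish, the element is a relation.\<close>

lemma tensor_rel_eq: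
  fixes S :: "nat set"
  shows "(tensor_rel fscale residue_scale (free_on S) UNIV ::
      ((nat \<Rightarrow>\<^sub>0 ('v, 'k::field) mpoly) \<times> 'k \<Rightarrow>\<^sub>0 ('v, 'k) mpoly) set) =
    {z \<in> free_on (free_on S \<times> UNIV). tensor_const z = 0}" (is "?T = ?K")
proof
  interpret f: module "fscale :: ('v, 'k) mpoly \<Rightarrow> ((nat \<Rightarrow>\<^sub>0 ('v, 'k) mpoly) \<times> 'k \<Rightarrow>\<^sub>0 ('v, 'k) mpoly) \<Rightarrow> _"
    by (rule module_fscale)
  interpret F: module "fscale :: ('v, 'k) mpoly \<Rightarrow> (nat \<Rightarrow>\<^sub>0 ('v, 'k) mpoly) \<Rightarrow> _"
    by (rule module_fscale)
  interpret t: module_hom fscale const_scale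
    "tensor_const :: ((nat \<Rightarrow>\<^sub>0 ('v, 'k) mpoly) \<times> 'k \<Rightarrow>\<^sub>0 ('v, 'k) mpoly) \<Rightarrow> _"
    by (rule module_hom_tensor_const)
  interpret c: module_hom fscale const_scale "const :: (nat \<Rightarrow>\<^sub>0 ('v, 'k) mpoly) \<Rightarrow> _"
    by (rule module_hom_const)
  note F = subspace_free_on[where 'a = "('v, 'k) mpoly" and 'b = nat, of S]
  have subK: "f.subspace ?K"
    using f.subspace_inter[OF subspace_free_on t.subspace_kernel] by (simp add: Int_def)
  have single: "Poly_Mapping.single (m, n) r \<in> free_on (free_on S \<times> UNIV)"
    if "m \<in> free_on S" for m :: "nat \<Rightarrow>\<^sub>0 ('v, 'k) mpoly" and n :: 'k and r :: "('v, 'k) mpoly"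
    using that by (simp add: free_on_def)
  have subF: "f.subspace (free_on (free_on S \<times> UNIV))" by (rule subspace_free_on)
  show "?T \<subseteq> ?K"
    unfolding tensor_rel_def
  proof (rule f.span_minimal[OF _ subK], intro Un_least subsetI; clarsimp)
    fix m m' :: "nat \<Rightarrow>\<^sub>0 ('v, 'k) mpoly" and n :: 'k assume hyp: "m \<in> free_on S" "m' \<in> free_on S"
    show "(Poly_Mapping.single (m + m', n) 1 - Poly_Mapping.single (m, n) 1 - Poly_Mapping.single (m', n) 1 :: _ \<Rightarrow>\<^sub>0 ('v, 'k) mpoly)
        \<in> free_on (free_on S \<times> UNIV) \<and>
      tensor_const (Poly_Mapping.single (m + m', n) 1 - Poly_Mapping.single (m, n) 1 -
        Poly_Mapping.single (m', n) 1 :: _ \<Rightarrow>\<^sub>0 ('v, 'k) mpoly) = 0"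
      (is "?mem \<and> ?zero")
    proof
      show ?mem using hyp by (intro f.subspace_diff[OF subF] single F.subspace_add[OF F])
      show ?zero by (rule poly_mapping_eqI) (simp add: t.diff tensor_const_single c.add lookup_minus lookup_fscale lookup_add distrib_left distrib_right mult_ac)
    qed
  next
    fix m :: "nat \<Rightarrow>\<^sub>0 ('v, 'k) mpoly" and n n' :: 'k assume hyp: "m \<in> free_on S"
    show "(Poly_Mapping.single (m, n + n') 1 - Poly_Mapping.single (m, n) 1 - Poly_Mapping.single (m, n') 1 :: _ \<Rightarrow>\<^sub>0 ('v, 'k) mpoly)
        \<in> free_on (free_on S \<times> UNIV) \<and>
      tensor_const (Poly_Mapping.single (m, n + n') 1 - Poly_Mapping.single (m, n) 1 -
        Poly_Mapping.single (m, n') 1 :: _ \<Rightarrow>\<^sub>0 ('v, 'k) mpoly) = 0"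
      (is "?mem \<and> ?zero")
    proof
      show ?mem using hyp by (intro f.subspace_diff[OF subF] single)
      show ?zero by (rule poly_mapping_eqI) (simp add: t.diff tensor_const_single lookup_minus lookup_fscale lookup_add distrib_left distrib_right mult_ac)
    qed
  next
    fix r :: "('v, 'k) mpoly" and m :: "nat \<Rightarrow>\<^sub>0 ('v, 'k) mpoly" and n :: 'k assume hyp: "m \<in> free_on S"
    show "Poly_Mapping.single (fscale r m, n) 1 - Poly_Mapping.single (m, n) r
        \<in> free_on (free_on S \<times> UNIV) \<and>
      tensor_const (Poly_Mapping.single (fscale r m, n) 1 - Poly_Mapping.single (m, n) r) = 0"
      (is "?mem \<and> ?zero")
    proof
      show ?mem using hyp by (intro f.subspace_diff[OF subF] single F.subspace_scale[OF F])
      show ?zero by (rule poly_mapping_eqI) (simp add: t.diff tensor_const_single c.scale const_scale_def lookup_minus lookup_fscale distrib_left distrib_right mult_ac)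
    qed
  next
    fix r :: "('v, 'k) mpoly" and m :: "nat \<Rightarrow>\<^sub>0 ('v, 'k) mpoly" and n :: 'k assume hyp: "m \<in> free_on S"
    show "Poly_Mapping.single (m, residue_scale r n) 1 - Poly_Mapping.single (m, n) r
        \<in> free_on (free_on S \<times> UNIV) \<and>
      tensor_const (Poly_Mapping.single (m, residue_scale r n) 1 - Poly_Mapping.single (m, n) r) = 0"
      (is "?mem \<and> ?zero")
    proof
      show ?mem using hyp by (intro f.subspace_diff[OF subF] single)
      show ?zero by (rule poly_mapping_eqI) (simp add: t.diff tensor_const_single residue_scale_def lookup_minus lookup_fscale distrib_left distrib_right mult_ac)
    qed
  qed
  have sub: "f.subspace ?T" unfolding tensor_rel_def by (rule f.subspace_span)
  have add_left: "Poly_Mapping.single (m + m', n) 1 - Poly_Mapping.single (m, n) 1 - Poly_Mapping.single (m', n) 1 \<in> ?T"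
    if "m \<in> free_on S" "m' \<in> free_on S" for m m' n
    unfolding tensor_rel_def by (rule f.span_base) (use that in blast)
  have add_right: "Poly_Mapping.single (m, n + n') 1 - Poly_Mapping.single (m, n) 1 - Poly_Mapping.single (m, n') 1 \<in> ?T"
    if "m \<in> free_on S" for m n n'
    unfolding tensor_rel_def by (rule f.span_base) (use that in blast)
  have scale_left: "Poly_Mapping.single (fscale r m, n) 1 - Poly_Mapping.single (m, n) r \<in> ?T"
    if "m \<in> free_on S" for r m n
    unfolding tensor_rel_def by (rule f.span_base) (use that in blast)
  have scale_right: "Poly_Mapping.single (m, residue_scale r n) 1 - Poly_Mapping.single (m, n) r \<in> ?T"
    if "m \<in> free_on S" for r m n
    unfolding tensor_rel_def by (rule f.span_base) (use that in blast)
  have trans: "x - z \<in> ?T" if "x - y \<in> ?T" "y - z \<in> ?T" for x y z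
    using f.subspace_add[OF sub that] by simp
  have sym: "y - x \<in> ?T" if "x - y \<in> ?T" for x y
    using f.subspace_neg[OF sub that] by simp
  have sum_cong: "sum x N - sum y N \<in> ?T" if "\<And>i. i \<in> N \<Longrightarrow> x i - y i \<in> ?T"
    for x y and N :: "'i set"
    using f.subspace_sum[OF sub that, of N] by (simp add: sum_subtractf)
  have zero_left: "Poly_Mapping.single (0, n) 1 \<in> ?T" for n
    using f.subspace_neg[OF sub add_left[of 0 0 n]] by (simp add: free_on_def)
  have zero_right: "Poly_Mapping.single (m, 0) 1 \<in> ?T" if "m \<in> free_on S" for m
    using f.subspace_neg[OF sub add_right[OF that, of 0 0]] by simp
  have sum_left: "Poly_Mapping.single (sum x N, n) 1 - (\<Sum>i\<in>N. Poly_Mapping.single (x i, n) 1) \<in> ?T"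
    if "finite N" "\<And>i. i \<in> N \<Longrightarrow> x i \<in> free_on S" for x n and N :: "'i set"
    using that
  proof (induction N)
    case (insert i N)
    have "sum x N \<in> free_on S" using insert by (intro F.subspace_sum[OF F]) auto
    then have "Poly_Mapping.single (x i + sum x N, n) 1 - Poly_Mapping.single (x i, n) 1 - Poly_Mapping.single (sum x N, n) 1 \<in> ?T"
      using insert by (intro add_left) auto
    from f.subspace_add[OF sub this insert.IH] insert show ?case by (simp add: algebra_simps)
  qed (simp add: zero_left)
  have sum_right: "Poly_Mapping.single (m, sum x N) 1 - (\<Sum>i\<in>N. Poly_Mapping.single (m, x i) 1) \<in> ?T"
    if "finite N" "m \<in> free_on S" for x m and N :: "'i set"
    using that(1)
  proof (induction N)
    case (insert i N)
    from f.subspace_add[OF sub add_right[OF that(2), of "x i" "sum x N"] insert.IH] insert(1,2)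
    show ?case by (simp add: algebra_simps)
  qed (simp add: zero_right that(2))
  let ?e = "\<lambda>j :: nat. Poly_Mapping.single j (1 :: ('v, 'k) mpoly)"
  \<comment> \<open>Normal form of one generator: move the scalar to the right factor, expand
    \<open>m\<close> in the basis, then move its coefficients to the right as well, where only
    constant terms act.\<close>
  have normal: "Poly_Mapping.single (m, n) r -
      (\<Sum>j\<in>N. Poly_Mapping.single (?e j, coef r 0 * n * coef (Poly_Mapping.lookup m j) 0) 1) \<in> ?T"
    if m: "m \<in> free_on S" and N: "Poly_Mapping.keys m \<subseteq> N" "finite N" "N \<subseteq> S" for m n r N
  proof -
    have e: "?e j \<in> free_on S" if "j \<in> N" for j using that N by (auto simp: free_on_def)
    let ?n = "residue_scale r n"
    have m_eq: "m = (\<Sum>j\<in>N. fscale (Poly_Mapping.lookup m j) (?e j))"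
      by (rule poly_mapping_eqI)
        (use N(1,2) in \<open>auto simp: lookup_sum lookup_fscale lookup_single when_def in_keys_iff
          if_distrib subset_iff cong: if_cong\<close>)
    have 1: "Poly_Mapping.single (m, n) r - Poly_Mapping.single (m, ?n) 1 \<in> ?T"
      by (rule sym[OF scale_right[OF m]])
    have 2: "Poly_Mapping.single (m, ?n) 1 - (\<Sum>j\<in>N. Poly_Mapping.single (fscale (Poly_Mapping.lookup m j) (?e j), ?n) 1) \<in> ?T"
      by (subst (1) m_eq, rule sum_left[OF N(2)]) (use e F.subspace_scale[OF F] in blast)
    have 3: "(\<Sum>j\<in>N. Poly_Mapping.single (fscale (Poly_Mapping.lookup m j) (?e j), ?n) 1) -
        (\<Sum>j\<in>N. Poly_Mapping.single (?e j, residue_scale (Poly_Mapping.lookup m j) ?n) 1) \<in> ?T"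
      by (rule sum_cong, rule trans[OF scale_left sym[OF scale_right]]; rule e)
    show ?thesis
      using trans[OF trans[OF 1 2] 3] by (simp add: residue_scale_def mult_ac)
  qed
  show "?K \<subseteq> ?T"
  proof
    fix z assume z: "z \<in> ?K"
    let ?Z = "Poly_Mapping.keys z"
    define N where "N = (\<Union>p\<in>?Z. Poly_Mapping.keys (fst p))"
    have Z: "fst p \<in> free_on S" if "p \<in> ?Z" for p
      using z that unfolding free_on_def[of "_ \<times> _"] by (auto simp: mem_Times_iff)
    then have keys_S: "Poly_Mapping.keys (fst p) \<subseteq> S" if "p \<in> ?Z" for p
      using that by (simp add: free_on_def)
    have N: "finite N" "N \<subseteq> S" "\<And>p. p \<in> ?Z \<Longrightarrow> Poly_Mapping.keys (fst p) \<subseteq> N"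
      unfolding N_def using keys_S by (auto simp del: fst_conv)
    let ?c = "\<lambda>j p. coef (Poly_Mapping.lookup z p) 0 * snd p * coef (Poly_Mapping.lookup (fst p) j) 0"
    have "(\<Sum>p\<in>?Z. Poly_Mapping.single p (Poly_Mapping.lookup z p)) -
        (\<Sum>p\<in>?Z. \<Sum>j\<in>N. Poly_Mapping.single (?e j, ?c j p) 1) \<in> ?T"
    proof (rule sum_cong)
      fix p assume p: "p \<in> ?Z"
      show "Poly_Mapping.single p (Poly_Mapping.lookup z p) -
          (\<Sum>j\<in>N. Poly_Mapping.single (?e j, ?c j p) 1) \<in> ?T"
        using normal[OF Z[OF p] N(3)[OF p] N(1,2), of "snd p" "Poly_Mapping.lookup z p"] by simp
    qed
    then have 1: "z - (\<Sum>j\<in>N. \<Sum>p\<in>?Z. Poly_Mapping.single (?e j, ?c j p) 1) \<in> ?T"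
      by (subst sum.swap) (simp add: poly_mapping_sum_single)
    have "(\<Sum>p\<in>?Z. ?c j p) = Poly_Mapping.lookup (tensor_const z) j" for j
      by (simp add: tensor_const_def lin_ext_def lookup_sum const_scale_def lookup_fscale
          lookup_const case_prod_unfold mult.assoc)
    \<comment> \<open>For each basis vector the right factors add up to a coordinate of
      \<open>tensor_const z\<close>, which is zero; by additivity on the right the terms at this
      basis vector sum to a relation.\<close>
    then have 0: "(\<Sum>p\<in>?Z. ?c j p) = 0" for j using z by simp
    have "Poly_Mapping.single (?e j, \<Sum>p\<in>?Z. ?c j p) 1 -
        (\<Sum>p\<in>?Z. Poly_Mapping.single (?e j, ?c j p) 1) \<in> ?T" if "j \<in> N" for j
      by (rule sum_right) (use that N in \<open>auto simp: free_on_def\<close>)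
    moreover have "Poly_Mapping.single (?e j, 0) 1 \<in> ?T" if "j \<in> N" for j
      by (rule zero_right) (use that N in \<open>auto simp: free_on_def\<close>)
    ultimately have "(\<Sum>p\<in>?Z. Poly_Mapping.single (?e j, ?c j p) 1) \<in> ?T" if "j \<in> N" for j
      using f.subspace_diff[OF sub, of "Poly_Mapping.single (?e j, 0) 1"] that unfolding 0 by fastforce
    then have "(\<Sum>j\<in>N. \<Sum>p\<in>?Z. Poly_Mapping.single (?e j, ?c j p) 1) \<in> ?T"
      by (rule f.subspace_sum[OF sub])
    from f.subspace_add[OF sub 1 this] show "z \<in> ?T" by simp
  qed
qed

lemma tensor_map_eq_lin_ext:
  "tensor_map f z = lin_ext fscale (\<lambda>(m, n). Poly_Mapping.single (f m, n) 1) z"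
  unfolding tensor_map_def lin_ext_def
proof (intro sum.cong refl)
  fix p
  show "(case p of (m, n) \<Rightarrow> Poly_Mapping.single (f m, n) (Poly_Mapping.lookup z (m, n))) =
    fscale (Poly_Mapping.lookup z p) (case p of (m, n) \<Rightarrow> Poly_Mapping.single (f m, n) 1)"
    by (cases p) (auto intro!: poly_mapping_eqI simp: lookup_fscale lookup_single when_def)
qed

definition const_map ::
  "((nat \<Rightarrow>\<^sub>0 ('v, 'k::field) mpoly) \<Rightarrow> (nat \<Rightarrow>\<^sub>0 ('v, 'k) mpoly)) \<Rightarrow> (nat \<Rightarrow>\<^sub>0 'k) \<Rightarrow> (nat \<Rightarrow>\<^sub>0 'k)" where
  "const_map d y = const (d (of_const y))"

text \<open>\<open>f\<close> and \<open>of_const (const f)\<close> differ by an element without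
  constant coefficients, and linear maps preserve this property; so any lift of a constant vector
  may be used.\<close>

lemma const_map_const:
  fixes d :: "(nat \<Rightarrow>\<^sub>0 ('v, 'k::field) mpoly) \<Rightarrow> (nat \<Rightarrow>\<^sub>0 ('v, 'k) mpoly)"
  assumes d: "module_hom fscale fscale d"
  shows "const_map d (const f) = const (d f)"
proof -
  interpret cd: module_hom fscale const_scale "const \<circ> d"
    by (rule module_hom_compose[OF d module_hom_const])
  let ?x = "f - of_const (const f)"
  have "coef (Poly_Mapping.lookup ?x n) 0 = 0" for n
    by (simp add: lookup_minus lookup_of_const lookup_const)
  then have "const_scale (Poly_Mapping.lookup ?x n) y = 0" for n and y :: "nat \<Rightarrow>\<^sub>0 'k"
    by (auto intro!: poly_mapping_eqI simp: const_scale_def lookup_fscale)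
  then have "(const \<circ> d) ?x = 0"
    by (subst hom_eq_lin_ext[OF cd.module_hom_axioms]) (simp add: lin_ext_def)
  then show ?thesis by (simp only: const_map_def cd.diff) simp
qed

lemma tensor_const_tensor_map:
  fixes d :: "(nat \<Rightarrow>\<^sub>0 ('v, 'k::field) mpoly) \<Rightarrow> (nat \<Rightarrow>\<^sub>0 ('v, 'k) mpoly)"
  assumes d: "module_hom fscale fscale d"
  shows "tensor_const (tensor_map d z) = const_map d (tensor_const z)"
proof -
  interpret t: module_hom fscale const_scale
    "tensor_const :: ((nat \<Rightarrow>\<^sub>0 ('v, 'k) mpoly) \<times> 'k \<Rightarrow>\<^sub>0 ('v, 'k) mpoly) \<Rightarrow> _"
    by (rule module_hom_tensor_const)
  interpret d: module_hom fscale fscale d by (rule d)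
  interpret c: module_hom fscale const_scale "const :: (nat \<Rightarrow>\<^sub>0 ('v, 'k) mpoly) \<Rightarrow> _"
    by (rule module_hom_const)
  have d_smult: "const_map d (fscale n y) = fscale n (const_map d y)" for n y
  proof -
    have "of_const (fscale n y) =
        (fscale (Poly_Mapping.single 0 n) (of_const y) :: nat \<Rightarrow>\<^sub>0 ('v, 'k) mpoly)"
      by (rule poly_mapping_eqI) (simp add: lookup_of_const lookup_fscale mult_single)
    then show ?thesis by (simp only: const_map_def d.scale c.scale const_scale_def lookup_single_eq)
  qed
  have d_add: "const_map d (x + y) = const_map d x + const_map d y" for x y
  proof -
    have "of_const (x + y) = (of_const x + of_const y :: nat \<Rightarrow>\<^sub>0 ('v, 'k) mpoly)"
      by (rule poly_mapping_eqI) (simp add: lookup_of_const lookup_add single_add)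
    then show ?thesis by (simp add: const_map_def d.add c.add)
  qed
  have "module_hom fscale const_scale 
      (\<lambda>z :: (nat \<Rightarrow>\<^sub>0 ('v, 'k) mpoly) \<times> 'k \<Rightarrow>\<^sub>0 ('v, 'k) mpoly. const_map d (tensor_const z))"
    by unfold_locales (simp_all add: t.add t.scale d_add const_scale_def d_smult)
  then have "const_map d (tensor_const z) =
      lin_ext const_scale (\<lambda>p. const_map d (tensor_const (Poly_Mapping.single p 1))) z"
    by (rule hom_eq_lin_ext)
  moreover have "module_hom fscale const_scale 
      (\<lambda>z :: (nat \<Rightarrow>\<^sub>0 ('v, 'k) mpoly) \<times> 'k \<Rightarrow>\<^sub>0 ('v, 'k) mpoly. tensor_const (tensor_map d z))"
    using module_hom_compose[OF module.module_hom_lin_ext[OF module_fscale] t.module_hom_axioms]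
    by (simp add: tensor_map_eq_lin_ext[abs_def] o_def)
  then have "tensor_const (tensor_map d z) =
      lin_ext const_scale (\<lambda>p. tensor_const (tensor_map d (Poly_Mapping.single p 1))) z"
    by (rule hom_eq_lin_ext)
  moreover have "tensor_const (tensor_map d (Poly_Mapping.single p 1)) =
      const_map d (tensor_const (Poly_Mapping.single p 1))" for p
  proof -
    have "tensor_map d (Poly_Mapping.single p 1) =
        (Poly_Mapping.single (d (fst p), snd p) 1 :: _ \<Rightarrow>\<^sub>0 ('v, 'k) mpoly)"
      by (simp add: tensor_map_def case_prod_unfold)
    then show ?thesis
      by (cases p) (simp add: tensor_const_single d_smult const_map_const[OF d])
  qed
  ultimately show ?thesis by simp
qed

text \<open>Cycles and boundaries of the resolution modulo the variables, pulled back to the free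
  modules themselves: a cycle is a chain whose image under the differential has no constant
  coefficients. Dimension shifting produces them in this shape.\<close>

definition res_cycles ::
  "(nat \<Rightarrow> nat set) \<Rightarrow> (nat \<Rightarrow> (nat \<Rightarrow>\<^sub>0 ('v, 'k::field) mpoly) \<Rightarrow> (nat \<Rightarrow>\<^sub>0 ('v, 'k) mpoly)) \<Rightarrow>
    nat \<Rightarrow> (nat \<Rightarrow>\<^sub>0 ('v, 'k) mpoly) set" where
  "res_cycles S d i = {f \<in> free_on (S i). case i of 0 \<Rightarrow> True | Suc j \<Rightarrow> const (d j f) = 0}"

definition res_boundaries ::
  "(nat \<Rightarrow> nat set) \<Rightarrow> (nat \<Rightarrow> (nat \<Rightarrow>\<^sub>0 ('v, 'k::field) mpoly) \<Rightarrow> (nat \<Rightarrow>\<^sub>0 ('v, 'k) mpoly)) \<Rightarrow>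
    nat \<Rightarrow> (nat \<Rightarrow>\<^sub>0 ('v, 'k) mpoly) set" where
  "res_boundaries S d i = {f \<in> res_cycles S d i. const f \<in> const ` d i ` free_on (S (Suc i))}"

lemma tensor_map_in_free_on:
  assumes "\<And>m. m \<in> F \<Longrightarrow> f m \<in> G" "z \<in> free_on (F \<times> N)"
  shows "tensor_map f z \<in> free_on (G \<times> N)"
proof -
  interpret module fscale by (rule module_fscale)
  show ?thesis
    unfolding tensor_map_def
  proof (rule subspace_sum[OF subspace_free_on])
    fix p assume "p \<in> Poly_Mapping.keys z"
    then have "p \<in> F \<times> N" using assms(2) by (auto simp: free_on_def)
    then show "(case p of (m, n) \<Rightarrow> Poly_Mapping.single (f m, n) (Poly_Mapping.lookup z (m, n))) \<in> free_on (G \<times> N)"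
      using assms(1) by (auto simp: free_on_def split: if_splits)
  qed
qed

text \<open>\<open>tensor_const\<close> and \<open>const\<close> map the two presentations onto the
  same subquotient of the space of constant coefficients.\<close>

lemma dim_tor_eq_res:
  fixes M :: "'m::ab_group_add set" and s :: "('v, 'k::field) mpoly \<Rightarrow> 'm \<Rightarrow> 'm"
  assumes res: "free_resolution s M S d e"
  shows "quot_dim const_fscale (tor_cycles residue_scale UNIV S d i) (tor_boundaries residue_scale UNIV S d i) =
    quot_dim const_fscale (res_cycles S d i) (res_boundaries S d i)"
proof -
  have d: "module_hom fscale fscale (d j)" for j using res by (simp add: free_resolution_def)
  have d_in: "d j f \<in> free_on (S j)" if "f \<in> free_on (S (Suc j))" for j f
  proof -
    have "d j ` free_on (S (Suc j)) \<subseteq> free_on (S j)"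
      using res unfolding free_resolution_def by (cases j) (simp_all add: Collect_mono subset_eq)
    then show ?thesis using that by blast
  qed
  interpret t: module_hom fscale const_scale
    "tensor_const :: ((nat \<Rightarrow>\<^sub>0 ('v, 'k) mpoly) \<times> 'k \<Rightarrow>\<^sub>0 ('v, 'k) mpoly) \<Rightarrow> _"
    by (rule module_hom_tensor_const)
  interpret c: module_hom fscale const_scale "const :: (nat \<Rightarrow>\<^sub>0 ('v, 'k) mpoly) \<Rightarrow> _"
    by (rule module_hom_const)
  interpret tv: vector_space "const_fscale :: 'k \<Rightarrow> ((nat \<Rightarrow>\<^sub>0 ('v, 'k) mpoly) \<times> 'k \<Rightarrow>\<^sub>0 ('v, 'k) mpoly) \<Rightarrow> _"
    by (rule vector_space_restrict_scalars[OF module_fscale])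
  interpret fv: vector_space "const_fscale :: 'k \<Rightarrow> (nat \<Rightarrow>\<^sub>0 ('v, 'k) mpoly) \<Rightarrow> _"
    by (rule vector_space_restrict_scalars[OF module_fscale])
  interpret kv: vector_space "fscale :: 'k \<Rightarrow> (nat \<Rightarrow>\<^sub>0 'k) \<Rightarrow> _"
    by (rule vector_space_fscale)
  have tlin: "module_hom const_fscale fscale
      (tensor_const :: ((nat \<Rightarrow>\<^sub>0 ('v, 'k) mpoly) \<times> 'k \<Rightarrow>\<^sub>0 ('v, 'k) mpoly) \<Rightarrow> _)"
    by unfold_locales (simp_all add: t.add t.scale const_scale_def)
  have clin: "module_hom const_fscale fscale (const :: (nat \<Rightarrow>\<^sub>0 ('v, 'k) mpoly) \<Rightarrow> _)"
    by unfold_locales (simp_all add: c.add c.scale const_scale_def)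
  let ?F = "\<lambda>i. free_on (S i) :: (nat \<Rightarrow>\<^sub>0 ('v, 'k) mpoly) set"
  let ?B = "const ` d i ` ?F (Suc i)"
  have fsub: "fv.subspace (free_on A)" "tv.subspace (free_on A')" for A A'
    using subspace_free_on[where 'a = "('v, 'k) mpoly" and 'b = nat]
      subspace_free_on[where 'a = "('v, 'k) mpoly" and 'b = "(nat \<Rightarrow>\<^sub>0 ('v, 'k) mpoly) \<times> 'k"]
    by (auto simp: fv.subspace_def tv.subspace_def t.m1.subspace_def c.m1.subspace_def)
  have dlin: "module_hom const_fscale const_fscale (d j)" for j
  proof -
    interpret d: module_hom fscale fscale "d j" by (rule d)
    show ?thesis by unfold_locales (simp_all add: d.add d.scale)
  qed
  have Bsub: "kv.subspace ?B"
    by (intro module_hom.subspace_image[OF clin] module_hom.subspace_image[OF dlin] fsub)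
  have tensor_const_in: "of_const (tensor_const z) \<in> ?F j" if "z \<in> free_on (?F j \<times> UNIV)" for z j
  proof -
    have "tensor_const z \<in> free_on (S j)"
      unfolding tensor_const_def lin_ext_def const_scale_def
    proof (intro kv.subspace_sum[OF subspace_free_on] kv.subspace_scale[OF subspace_free_on])
      fix p assume "p \<in> Poly_Mapping.keys z"
      then have "fst p \<in> ?F j" using that unfolding free_on_def[of "_ \<times> _"] by (auto simp: mem_Times_iff)
      then have "const (fst p) \<in> free_on (S j)"
        using keys_const_subset[of "fst p"] by (auto simp: free_on_def)
      then show "(case p of (m, n) \<Rightarrow> fscale n (const m)) \<in> free_on (S j)"
        by (simp add: case_prod_unfold kv.subspace_scale[OF subspace_free_on])
    qed
    then show ?thesis by simp
  qed
  have single_in: "(Poly_Mapping.single (f, 1 :: 'k) 1 :: _ \<Rightarrow>\<^sub>0 ('v, 'k) mpoly) \<in> free_on (?F j \<times> UNIV)" if "f \<in> ?F j" for f j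
    using that by (simp add: free_on_def)
  have tensor_single: "tensor_const (Poly_Mapping.single (f, 1) 1) = const f"
    for f :: "nat \<Rightarrow>\<^sub>0 ('v, 'k) mpoly"
    by (simp add: tensor_const_single)
  have map_const: "tensor_const (tensor_map (d j) z) = const (d j (of_const (tensor_const z)))" for j z
    by (simp add: tensor_const_tensor_map[OF d] const_map_def)
  have map_in: "tensor_map (d j) z \<in> free_on (?F j \<times> UNIV)"
    if "z \<in> free_on (?F (Suc j) \<times> UNIV)" for j and z :: "(nat \<Rightarrow>\<^sub>0 ('v, 'k) mpoly) \<times> 'k \<Rightarrow>\<^sub>0 ('v, 'k) mpoly"
    by (rule tensor_map_in_free_on[OF d_in that])
  have cyc: "z \<in> tor_cycles residue_scale UNIV S d i \<longleftrightarrow>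
      z \<in> free_on (?F i \<times> UNIV) \<and> of_const (tensor_const z) \<in> res_cycles S d i" for z
    using map_in tensor_const_in
    by (auto simp: tor_cycles_def res_cycles_def tensor_rel_eq map_const split: nat.splits)
  have bdry: "z \<in> tor_boundaries residue_scale UNIV S d i \<longleftrightarrow>
      z \<in> free_on (?F i \<times> UNIV) \<and> tensor_const z \<in> ?B" for z
  proof
    assume "z \<in> tor_boundaries residue_scale UNIV S d i"
    then obtain y x where yx: "z = tensor_map (d i) y + x" "y \<in> free_on (?F (Suc i) \<times> UNIV)"
        "x \<in> free_on (?F i \<times> UNIV)" "tensor_const x = 0"
      by (auto simp: tor_boundaries_def tensor_rel_eq)
    have "z \<in> free_on (?F i \<times> UNIV)"
      unfolding yx(1) by (rule tv.subspace_add[OF fsub(2) map_in[OF yx(2)] yx(3)])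
    moreover have "tensor_const z \<in> ?B"
      using tensor_const_in[OF yx(2)] yx(1,4) by (simp add: t.add map_const)
    ultimately show "z \<in> free_on (?F i \<times> UNIV) \<and> tensor_const z \<in> ?B" ..
  next
    assume z: "z \<in> free_on (?F i \<times> UNIV) \<and> tensor_const z \<in> ?B"
    then obtain g where g: "g \<in> ?F (Suc i)" "tensor_const z = const (d i g)" by auto
    let ?y = "Poly_Mapping.single (g, 1) 1 :: _ \<Rightarrow>\<^sub>0 ('v, 'k) mpoly"
    have "tensor_const (z - tensor_map (d i) ?y) = 0"
      by (simp add: t.diff g(2) tensor_const_tensor_map[OF d] tensor_single const_map_const[OF d])
    moreover have "z - tensor_map (d i) ?y \<in> free_on (?F i \<times> UNIV)"
      using z map_in[OF single_in[OF g(1)]] by (simp add: tv.subspace_diff[OF fsub(2)])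
    moreover have "z = tensor_map (d i) ?y + (z - tensor_map (d i) ?y)" by simp
    ultimately show "z \<in> tor_boundaries residue_scale UNIV S d i"
      unfolding tor_boundaries_def tensor_rel_eq using single_in[OF g(1)] by blast
  qed
  have res_iff: "of_const (const f) \<in> res_cycles S d i \<longleftrightarrow> f \<in> res_cycles S d i" if "f \<in> ?F i" for f
  proof -
    have "const f \<in> free_on (S i)" using that keys_const_subset[of f] by (auto simp: free_on_def)
    then show ?thesis
      using that const_map_const[OF d, of _ f] by (auto simp: res_cycles_def const_map_def split: nat.splits)
  qed
  interpret tl: module_hom const_fscale fscale
    "tensor_const :: ((nat \<Rightarrow>\<^sub>0 ('v, 'k) mpoly) \<times> 'k \<Rightarrow>\<^sub>0 ('v, 'k) mpoly) \<Rightarrow> _" by (rule tlin)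
  interpret cl: module_hom const_fscale fscale "const :: (nat \<Rightarrow>\<^sub>0 ('v, 'k) mpoly) \<Rightarrow> _" by (rule clin)
  have subZ: "fv.subspace (res_cycles S d i)"
  proof (cases i)
    case 0
    then show ?thesis using fsub(1) by (simp add: res_cycles_def)
  next
    case (Suc j)
    have "fv.subspace {f. (const \<circ> d j) f = 0}"
      by (rule module_hom.subspace_kernel[OF module_hom_compose[OF dlin clin]])
    from fv.subspace_inter[OF fsub(1) this] Suc show ?thesis by (simp add: res_cycles_def Int_def)
  qed
  have subB: "fv.subspace (res_boundaries S d i)"
    unfolding res_boundaries_def
    using fv.subspace_inter[OF subZ cl.subspace_linear_preimage[OF Bsub]] by (simp add: Int_def)
  have pre: "tv.subspace {z \<in> free_on (?F i \<times> UNIV). tensor_const z \<in> W}" if "kv.subspace W" for W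
    using tv.subspace_inter[OF fsub(2) tl.subspace_linear_preimage[OF that]] by (simp add: Int_def)
  have of_const_iff: "of_const y \<in> res_cycles S d i \<longleftrightarrow> y \<in> const ` res_cycles S d i" for y
    by (metis (no_types, lifting) const_of_const image_iff mem_Collect_eq res_cycles_def res_iff)
  have subT: "tv.subspace (tor_cycles residue_scale UNIV S d i)"
    "tv.subspace (tor_boundaries residue_scale UNIV S d i)"
  proof -
    have "tor_cycles residue_scale UNIV S d i =
        {z \<in> free_on (?F i \<times> UNIV). tensor_const z \<in> const ` res_cycles S d i}"
      by (intro set_eqI) (simp only: cyc of_const_iff mem_Collect_eq)
    then show "tv.subspace (tor_cycles residue_scale UNIV S d i)"
      by (simp only: pre[OF cl.subspace_image[OF subZ]])
    have "tor_boundaries residue_scale UNIV S d i = {z \<in> free_on (?F i \<times> UNIV). tensor_const z \<in> ?B}"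
      by (intro set_eqI) (simp only: bdry mem_Collect_eq)
    then show "tv.subspace (tor_boundaries residue_scale UNIV S d i)"
      by (simp only: pre[OF Bsub])
  qed
  have "quot_dim const_fscale (tor_cycles residue_scale UNIV S d i) (tor_boundaries residue_scale UNIV S d i) =
      quot_dim fscale (const ` res_cycles S d i) ?B"
  proof (rule quot_dim_image[OF tv.vector_space_axioms kv.vector_space_axioms tlin subT(1,2) Bsub])
    show "tensor_const ` tor_cycles residue_scale UNIV S d i = const ` res_cycles S d i"
    proof (intro equalityI subsetI)
      fix y assume "y \<in> tensor_const ` tor_cycles residue_scale UNIV S d i"
      then obtain z :: "(nat \<Rightarrow>\<^sub>0 ('v, 'k) mpoly) \<times> 'k \<Rightarrow>\<^sub>0 ('v, 'k) mpoly" where "y = tensor_const z" "of_const (tensor_const z) \<in> res_cycles S d i"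
        by (auto simp: cyc)
      then show "y \<in> const ` res_cycles S d i" by (metis const_of_const imageI)
    next
      fix y assume "y \<in> const ` res_cycles S d i"
      then obtain f where f: "y = const f" "f \<in> res_cycles S d i" "f \<in> ?F i" by (auto simp: res_cycles_def)
      then have "(Poly_Mapping.single (f, 1) 1 :: _ \<Rightarrow>\<^sub>0 ('v, 'k) mpoly) \<in> tor_cycles residue_scale UNIV S d i"
        by (simp add: cyc single_in tensor_single res_iff)
      then show "y \<in> tensor_const ` tor_cycles residue_scale UNIV S d i"
        using tensor_single[of f] f(1) by force
    qed
  qed (simp add: cyc bdry)
  also have "\<dots> = quot_dim const_fscale (res_cycles S d i) (res_boundaries S d i)"
    by (rule sym, rule quot_dim_image[OF fv.vector_space_axioms kv.vector_space_axioms clin subZ subB Bsub refl])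
      (simp add: res_boundaries_def)
  finally show ?thesis .
qed

section \<open>Koszul homology\<close>

definition vkd :: "('r::comm_ring_1 \<Rightarrow> 'm::ab_group_add \<Rightarrow> 'm) \<Rightarrow> ('v::finite \<Rightarrow> 'r) \<Rightarrow>
    'm ^ 'v set \<Rightarrow> 'm ^ 'v set" where
  "vkd s x c = (\<chi> \<tau>. kd s x (($) c) \<tau>)"

definition var :: "'v \<Rightarrow> ('v, 'k::field) mpoly" where
  "var v = monomial (Poly_Mapping.single v 1)"

text \<open>Degree \<open>i\<close> of the Koszul complex with coefficients in \<open>M\<close>; the
  coordinate at \<open>\<sigma>\<close> belongs to the exterior basis element of
  \<open>\<sigma>\<close>.\<close>

definition kchain :: "'m::zero set \<Rightarrow> nat \<Rightarrow> ('m ^ 'v::finite set) set" where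
  "kchain M i = {c. \<forall>\<sigma>. c $ \<sigma> \<in> M \<and> (card \<sigma> \<noteq> i \<longrightarrow> c $ \<sigma> = 0)}"

definition kscale :: "(('v::finite, 'k::field) mpoly \<Rightarrow> 'm \<Rightarrow> 'm) \<Rightarrow> 'k \<Rightarrow> 'm ^ 'v set \<Rightarrow> 'm ^ 'v set" where
  "kscale s c x = (\<chi> \<sigma>. s (Poly_Mapping.single 0 c) (x $ \<sigma>))"

definition vmap :: "('m \<Rightarrow> 'n) \<Rightarrow> 'm ^ 'i \<Rightarrow> 'n ^ 'i" where
  "vmap f c = (\<chi> i. f (c $ i))"

definition kcycle :: "(('v::finite, 'k::field) mpoly \<Rightarrow> 'm::ab_group_add \<Rightarrow> 'm) \<Rightarrow> 'm set \<Rightarrow> nat \<Rightarrow> ('m ^ 'v set) set" where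
  "kcycle s M i = {c \<in> kchain M i. vkd s var c = 0}"

definition kboundary :: "(('v::finite, 'k::field) mpoly \<Rightarrow> 'm::ab_group_add \<Rightarrow> 'm) \<Rightarrow> 'm set \<Rightarrow> nat \<Rightarrow> ('m ^ 'v set) set" where
  "kboundary s M i = vkd s var ` kchain M (Suc i)"

lemma vkd_nth: "vkd s x c $ \<tau> = (\<Sum>v\<in>-\<tau>. s (ksgn v \<tau> * x v) (c $ insert v \<tau>))"
  by (simp add: vkd_def kd_def)

lemma vmap_nth [simp]: "vmap f c $ i = f (c $ i)"
  by (simp add: vmap_def)

lemma kscale_nth [simp]: "kscale s c x $ \<sigma> = s (Poly_Mapping.single 0 c) (x $ \<sigma>)"
  by (simp add: kscale_def)

lemma vkd_vkd:
  assumes "module s"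
  shows "vkd s x (vkd s x c) = 0"
proof -
  have "($) (vkd s x c) = kd s x (($) c)" by (simp add: vkd_def fun_eq_iff)
  then show ?thesis using kd_kd[OF assms, of x "($) c"] by (simp add: vkd_def vec_eq_iff)
qed

lemma vector_space_kscale:
  fixes s :: "('v::finite, 'k::field) mpoly \<Rightarrow> 'm::ab_group_add \<Rightarrow> 'm"
  assumes "module s"
  shows "vector_space (kscale s)"
proof -
  interpret module s by fact
  show ?thesis
    by unfold_locales
      (simp_all add: vec_eq_iff scale_right_distrib single_add scale_left_distrib mult_single)
qed

lemma module_hom_vkd:
  fixes s :: "('v::finite, 'k::field) mpoly \<Rightarrow> 'm::ab_group_add \<Rightarrow> 'm"
  assumes "module s"
  shows "module_hom (kscale s) (kscale s) (vkd s x)"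
proof -
  interpret module s by fact
  interpret k: vector_space "kscale s" by (rule vector_space_kscale[OF assms])
  show ?thesis
    by unfold_locales
      (auto simp: vec_eq_iff vkd_nth scale_right_distrib sum.distrib scale_sum_right mult.commute)
qed

lemma module_hom_vmap:
  fixes s :: "('v::finite, 'k::field) mpoly \<Rightarrow> 'm::ab_group_add \<Rightarrow> 'm"
    and t :: "('v::finite, 'k::field) mpoly \<Rightarrow> 'n::ab_group_add \<Rightarrow> 'n"
  assumes "module_hom s t f"
  shows "module_hom (kscale s) (kscale t) (vmap f)"
proof -
  interpret module_hom s t f by fact
  interpret ks: vector_space "kscale s" by (rule vector_space_kscale[OF m1.module_axioms])
  interpret kt: vector_space "kscale t" by (rule vector_space_kscale[OF m2.module_axioms])
  show ?thesis by unfold_locales (simp_all add: vec_eq_iff add scale)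
qed

lemma vkd_vmap:
  assumes "module_hom s t f"
  shows "vkd t x (vmap f c) = vmap f (vkd s x c)"
proof -
  interpret module_hom s t f by fact
  show ?thesis by (simp add: vec_eq_iff vkd_nth sum scale)
qed

lemma subspace_kchain:
  fixes s :: "('v::finite, 'k::field) mpoly \<Rightarrow> 'm::ab_group_add \<Rightarrow> 'm"
  assumes "module s" "module.subspace s M"
  shows "module.subspace (kscale s) (kchain M i)"
proof -
  interpret module s by fact
  interpret k: vector_space "kscale s" by (rule vector_space_kscale[OF assms(1)])
  show ?thesis
    using assms(2) by (auto simp: k.subspace_def subspace_def kchain_def)
qed

lemma vkd_kchain:
  assumes "module s" and M: "module.subspace s M" and c: "c \<in> kchain M (Suc i)"
  shows "vkd s x c \<in> kchain M i"
proof -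
  interpret module s by fact
  have "vkd s x c $ \<sigma> \<in> M" for \<sigma>
    using c by (auto simp: vkd_nth kchain_def intro!: subspace_sum[OF M] subspace_scale[OF M])
  moreover have "vkd s x c $ \<sigma> = 0" if "card \<sigma> \<noteq> i" for \<sigma>
    using c that by (auto simp: vkd_nth kchain_def intro!: sum.neutral)
  ultimately show ?thesis by (simp add: kchain_def)
qed

section \<open>Multigraded pieces of the Koszul complex of a monomial ideal\<close>

definition chi :: "'v::finite set \<Rightarrow> 'v expo" where
  "chi \<sigma> = (\<Sum>v\<in>\<sigma>. Poly_Mapping.single v 1)"

text \<open>The upper Koszul simplicial complex of the ideal in degree \<open>a\<close>. Requiring
  \<open>\<sigma>\<close> to lie in the support of \<open>a\<close> makes the truncated subtraction
  a true division by the squarefree monomial of \<open>\<sigma>\<close>.\<close>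

definition kcx :: "'v::finite expo set \<Rightarrow> 'v expo \<Rightarrow> 'v set set" where
  "kcx E a = {\<sigma>. \<sigma> \<subseteq> Poly_Mapping.keys a \<and> a - chi \<sigma> \<in> E}"

text \<open>The component in multidegree \<open>a\<close>, where the basis element of
  \<open>\<sigma>\<close> has degree \<open>chi \<sigma>\<close>.\<close>

definition piece :: "'v::finite expo \<Rightarrow> ('v, 'k::field) mpoly ^ 'v set \<Rightarrow> 'k ^ 'v set" where
  "piece a c = (\<chi> \<sigma>. if \<sigma> \<subseteq> Poly_Mapping.keys a then coef (c $ \<sigma>) (a - chi \<sigma>) else 0)"

definition incl :: "'v::finite expo \<Rightarrow> 'k::field ^ 'v set \<Rightarrow> ('v, 'k) mpoly ^ 'v set" where
  "incl a g = (\<chi> \<sigma>. if \<sigma> \<subseteq> Poly_Mapping.keys a then Poly_Mapping.single (a - chi \<sigma>) (g $ \<sigma>) else 0)"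

lemma lookup_chi [simp]: "expon (chi \<sigma>) v = (if v \<in> \<sigma> then 1 else 0)"
  by (simp add: chi_def lookup_sum lookup_single when_def)

lemma minus_chi_add: "\<sigma> \<subseteq> Poly_Mapping.keys a \<Longrightarrow> a - chi \<sigma> + chi \<sigma> = a"
  by (rule poly_mapping_eqI) (auto simp: lookup_add lookup_minus in_keys_iff)

lemma subset_keys_add_chi: "\<sigma> \<subseteq> Poly_Mapping.keys (b + chi \<sigma>)"
  by (auto simp: in_keys_iff lookup_add)

lemma add_chi_minus [simp]: "b + chi \<sigma> - chi \<sigma> = b"
  by (rule poly_mapping_eqI) (simp add: lookup_add lookup_minus)

lemma piece_nth: "piece a c $ \<sigma> = (if \<sigma> \<subseteq> Poly_Mapping.keys a then coef (c $ \<sigma>) (a - chi \<sigma>) else 0)"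
  by (simp add: piece_def)

lemma incl_nth: "incl a g $ \<sigma> = (if \<sigma> \<subseteq> Poly_Mapping.keys a then Poly_Mapping.single (a - chi \<sigma>) (g $ \<sigma>) else 0)"
  by (simp add: incl_def)

text \<open>The coefficient at exponent \<open>b\<close> in coordinate \<open>\<sigma>\<close> is
  visible in degree \<open>b + chi \<sigma>\<close>.\<close>

lemma piece_eqI:
  assumes "\<And>a. piece a c = piece a c'"
  shows "c = c'"
proof -
  have "coef (c $ \<sigma>) b = coef (c' $ \<sigma>) b" for \<sigma> b
  proof -
    have "piece (b + chi \<sigma>) c $ \<sigma> = piece (b + chi \<sigma>) c' $ \<sigma>" using assms by simp
    then show ?thesis by (simp add: piece_nth subset_keys_add_chi)
  qed
  then show ?thesis by (simp add: vec_eq_iff poly_mapping_eqI)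
qed

lemma piece_incl:
  "piece b (incl a g) = (if a = b then (\<chi> \<sigma>. if \<sigma> \<subseteq> Poly_Mapping.keys a then g $ \<sigma> else 0) else 0)"
proof -
  have ne: "a - chi \<sigma> \<noteq> b - chi \<sigma>"
    if "a \<noteq> b" "\<sigma> \<subseteq> Poly_Mapping.keys a" "\<sigma> \<subseteq> Poly_Mapping.keys b" for \<sigma>
    using that minus_chi_add by metis
  show ?thesis
  proof (cases "a = b")
    case True
    then show ?thesis by (simp add: vec_eq_iff piece_nth incl_nth)
  next
    case False
    then show ?thesis using ne by (simp add: vec_eq_iff piece_nth incl_nth lookup_single_not_eq)
  qed
qed

text \<open>The differential trades an element \<open>v\<close> of the set for a factor
  \<open>var v\<close> and so preserves the multidegree; within one degree only the signs
  remain.\<close>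

lemma piece_vkd:
  fixes c :: "('v::finite, 'k::field) mpoly ^ 'v set"
  shows "piece a (vkd (*) var c) = sbd (piece a c)"
proof -
  have "piece a (vkd (*) var c) $ \<tau> = sbd (piece a c) $ \<tau>" for \<tau>
  proof (cases "\<tau> \<subseteq> Poly_Mapping.keys a")
    case True
    have "coef (ksgn v \<tau> * var v * c $ insert v \<tau>) (a - chi \<tau>) =
        ksgn v \<tau> * piece a c $ insert v \<tau>" if "v \<notin> \<tau>" for v
    proof -
      have div: "ediv (Poly_Mapping.single v 1) (a - chi \<tau>) \<longleftrightarrow> insert v \<tau> \<subseteq> Poly_Mapping.keys a"
        using True that by (auto simp: ediv_def lookup_single when_def lookup_minus in_keys_iff)
      have eq: "a - chi \<tau> - Poly_Mapping.single v 1 = a - chi (insert v \<tau>)"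
        using that by (intro poly_mapping_eqI) (auto simp: lookup_minus lookup_single when_def)
      have sgn: "ksgn v \<tau> = (Poly_Mapping.single 0 (ksgn v \<tau>) :: ('v, 'k) mpoly)"
      proof -
        have "Poly_Mapping.single 0 ((- 1) ^ n) = ((- 1) ^ n :: ('v, 'k) mpoly)" for n
        proof (induction n)
          case (Suc n)
          have "Poly_Mapping.single 0 (- 1 * (- 1) ^ n) =
              Poly_Mapping.single 0 (- 1 :: 'k) * (Poly_Mapping.single 0 ((- 1) ^ n) :: ('v, 'k) mpoly)"
            by (simp add: mult_single)
          also have "Poly_Mapping.single 0 (- 1 :: 'k) = (- 1 :: ('v, 'k) mpoly)"
            by (simp only: single_uminus single_one)
          finally show ?case using Suc by simp
        qed simp
        then show ?thesis by (simp add: ksgn_def)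
      qed
      have "ksgn v \<tau> * var v = (Poly_Mapping.single (Poly_Mapping.single v 1) (ksgn v \<tau>) :: ('v, 'k) mpoly)"
        unfolding sgn by (simp add: var_def monomial_def mult_single)
      then show ?thesis by (simp only: coef_single_mult piece_nth div eq) simp
    qed
    then show ?thesis
      using True by (simp add: piece_nth[of a "vkd (*) var c"] vkd_nth lookup_sum sbd_nth kd_def)
  next
    case False
    then show ?thesis by (auto simp: piece_nth sbd_nth kd_def intro!: sum.neutral)
  qed
  then show ?thesis by (simp add: vec_eq_iff)
qed

lemma piece_0 [simp]: "piece a 0 = 0"
  by (simp add: vec_eq_iff piece_nth)

lemma piece_sum: "piece a (sum f A) = (\<Sum>x\<in>A. piece a (f x))"
  by (simp add: vec_eq_iff piece_nth lookup_sum)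

lemma piece_kscale: "piece a (kscale (*) x c) = x *s piece a c"
  by (simp add: vec_eq_iff piece_nth coef_single_0_mult)

lemma down_closed_kcx:
  assumes "up_closed E"
  shows "down_closed (kcx E a)"
  unfolding down_closed_def
proof (intro ballI allI impI)
  fix \<sigma> \<tau> assume \<sigma>: "\<sigma> \<in> kcx E a" and "\<tau> \<subseteq> \<sigma>"
  then have "ediv (a - chi \<sigma>) (a - chi \<tau>)" by (auto simp: ediv_def lookup_minus)
  then show "\<tau> \<in> kcx E a" using \<sigma> \<open>\<tau> \<subseteq> \<sigma>\<close> up_closedD[OF assms] by (auto simp: kcx_def)
qed

lemma schain_kcx_nth: "g \<in> schain (kcx E a) i \<Longrightarrow> \<not> \<sigma> \<subseteq> Poly_Mapping.keys a \<Longrightarrow> g $ \<sigma> = 0"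
  by (auto simp: schain_def faces_def kcx_def)

lemma piece_incl_schain:
  "g \<in> schain (kcx E a) i \<Longrightarrow> piece b (incl a g) = (if a = b then g else 0)"
  using schain_kcx_nth[of g E a i] by (auto simp: piece_incl vec_eq_iff)

lemma piece_in_schain: "c \<in> kchain (poly_on E) i \<Longrightarrow> piece a c \<in> schain (kcx E a) i"
  by (auto simp: schain_def faces_def kcx_def piece_nth kchain_def poly_on_def in_keys_iff subset_iff)

lemma incl_in_kchain: "g \<in> schain (kcx E a) i \<Longrightarrow> incl a g \<in> kchain (poly_on E) i"
  by (auto simp: schain_def faces_def kcx_def incl_nth kchain_def poly_on_def)

lemma vkd_incl:
  assumes "up_closed E" "g \<in> schain (kcx E a) (Suc i)"
  shows "vkd (*) var (incl a g) = incl a (sbd g)"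
proof (rule piece_eqI)
  fix b
  have "sbd g \<in> schain (kcx E a) i" by (rule sbd_schain[OF down_closed_kcx[OF assms(1)] assms(2)])
  moreover have "sbd 0 = (0 :: 'b ^ 'a set)" by (simp add: vec_eq_iff sbd_nth kd_def)
  ultimately show "piece b (vkd (*) var (incl a g)) = piece b (incl a (sbd g))"
    using assms(2) by (simp add: piece_vkd piece_incl_schain)
qed

lemma finite_pieces: "finite {a. piece a c \<noteq> 0}"
proof (rule finite_subset)
  show "{a. piece a c \<noteq> 0} \<subseteq> (\<Union>\<sigma>. (\<lambda>b. b + chi \<sigma>) ` Poly_Mapping.keys (c $ \<sigma>))"
  proof
    fix a assume "a \<in> {a. piece a c \<noteq> 0}"
    then obtain \<sigma> where "piece a c $ \<sigma> \<noteq> 0" by (auto simp: vec_eq_iff)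
    then have \<sigma>: "\<sigma> \<subseteq> Poly_Mapping.keys a" "a - chi \<sigma> \<in> Poly_Mapping.keys (c $ \<sigma>)"
      by (auto simp: piece_nth in_keys_iff split: if_splits)
    have "a = a - chi \<sigma> + chi \<sigma>" using minus_chi_add[OF \<sigma>(1)] by (rule sym)
    then show "a \<in> (\<Union>\<sigma>. (\<lambda>b. b + chi \<sigma>) ` Poly_Mapping.keys (c $ \<sigma>))"
      using \<sigma>(2) by blast
  qed
qed simp

lemma sum_incl_piece:
  assumes "finite D" "{a. piece a c \<noteq> 0} \<subseteq> D" "c \<in> kchain (poly_on E) i"
  shows "c = (\<Sum>a\<in>D. incl a (piece a c))"
proof (rule piece_eqI)
  fix b
  have "(\<Sum>a\<in>D. piece b (incl a (piece a c))) = (\<Sum>a\<in>D. if a = b then piece a c else 0)"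
    using piece_incl_schain[OF piece_in_schain[OF assms(3)]] by (intro sum.cong) auto
  also have "\<dots> = piece b c" using assms(1,2) by auto
  finally show "piece b c = piece b (\<Sum>a\<in>D. incl a (piece a c))" by (simp add: piece_sum)
qed

abbreviation kdim :: "(('v::finite, 'k::field) mpoly \<Rightarrow> 'm::ab_group_add \<Rightarrow> 'm) \<Rightarrow> 'm set \<Rightarrow> nat \<Rightarrow> nat" where
  "kdim s M i \<equiv> quot_dim (kscale s) (kcycle s M i) (kboundary s M i)"

lemma piece_kcycle:
  assumes "c \<in> kcycle (*) (poly_on E) i"
  shows "piece a c \<in> scycle (kcx E a) i"
proof -
  have "sbd (piece a c) = 0"
    using assms by (simp add: kcycle_def flip: piece_vkd)
  then show ?thesis using assms by (simp add: scycle_def kcycle_def piece_in_schain)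
qed

text \<open>Exactness is checked degree by degree, where the Koszul complex is that of a full simplex.\<close>

lemma koszul_exact_ring:
  fixes c :: "('v::finite, 'k::field) mpoly ^ 'v set"
  assumes c: "c \<in> kcycle (*) UNIV i" and c0: "coef (c $ {}) 0 = 0"
  shows "\<exists>b\<in>kchain UNIV (Suc i). vkd (*) var b = c"
proof -
  interpret k: vector_space "kscale ((*) :: ('v, 'k) mpoly \<Rightarrow> _)"
    by (rule vector_space_kscale[OF module_ring_self])
  interpret d: module_hom "kscale ((*) :: ('v, 'k) mpoly \<Rightarrow> _)" "kscale (*)" "vkd (*) var"
    by (rule module_hom_vkd[OF module_ring_self])
  have kc: "c \<in> kchain (poly_on UNIV) i" using c by (simp add: kcycle_def)
  have "\<exists>g\<in>schain (kcx UNIV a) (Suc i). sbd g = piece a c" for a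
  proof (cases "a = 0")
    \<comment> \<open>Degree \<open>0\<close> is the only one without a variable. Its only face is
      \<open>{}\<close>, and the coefficient there is the constant term excluded by
      \<open>c0\<close>.\<close>
    case True
    have "chi ({} :: 'v set) = 0" by (simp add: chi_def)
    then have "piece a c = 0" using True c0 by (auto simp: vec_eq_iff piece_nth)
    moreover have "sbd 0 = (0 :: 'k ^ 'v set)" by (simp add: vec_eq_iff sbd_nth kd_def)
    moreover have "0 \<in> schain (kcx UNIV a) (Suc i)" by (simp add: schain_def)
    ultimately show ?thesis by metis
  next
    case False
    then obtain v where "v \<in> Poly_Mapping.keys a" by (metis all_not_in_conv keys_eq_empty)
    then have "scycle (kcx UNIV a) i \<subseteq> (sbd ` schain (kcx UNIV a) (Suc i) :: ('k ^ 'v set) set)"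
      by (intro scycle_subset_boundary[where v = v]) (auto simp: kcx_def)
    moreover have "piece a c \<in> scycle (kcx UNIV a) i" using c by (intro piece_kcycle) simp
    ultimately show ?thesis by force
  qed
  then obtain g where g: "\<And>a. g a \<in> schain (kcx UNIV a) (Suc i)" "\<And>a. sbd (g a) = piece a c" by metis
  define D where "D = {a. piece a c \<noteq> 0}"
  have "(\<Sum>a\<in>D. incl a (g a)) \<in> kchain (poly_on UNIV) (Suc i)"
    by (intro k.subspace_sum subspace_kchain[OF module_ring_self] incl_in_kchain[OF g(1)] subspace_poly_on)
      simp
  moreover have "vkd (*) var (\<Sum>a\<in>D. incl a (g a)) = (\<Sum>a\<in>D. incl a (piece a c))"
    by (simp add: d.sum vkd_incl[OF up_closed_UNIV g(1)] g(2))
  moreover have "\<dots> = c"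
    by (rule sum_incl_piece[OF _ _ kc, symmetric]) (simp_all add: D_def finite_pieces)
  ultimately show ?thesis by auto
qed

text \<open>A direct sum of copies of the complex of the ring, treated coordinate by coordinate;
  only finitely many coordinates occur in \<open>c\<close>. For \<open>i > 0\<close> the assumption
  \<open>c0\<close> holds by itself, since \<open>c\<close> vanishes at \<open>{}\<close>.\<close>

lemma koszul_exact_free:
  fixes c :: "(nat \<Rightarrow>\<^sub>0 ('v::finite, 'k::field) mpoly) ^ 'v set"
  assumes c: "c \<in> kcycle fscale (free_on S) i" and c0: "const (c $ {}) = 0"
  shows "\<exists>b\<in>kchain (free_on S) (Suc i). vkd fscale var b = c"
proof -
  interpret f: module "fscale :: ('v, 'k) mpoly \<Rightarrow> (nat \<Rightarrow>\<^sub>0 ('v, 'k) mpoly) \<Rightarrow> _" by (rule module_fscale)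
  interpret k: vector_space "kscale (fscale :: ('v, 'k) mpoly \<Rightarrow> (nat \<Rightarrow>\<^sub>0 ('v, 'k) mpoly) \<Rightarrow> _)"
    by (rule vector_space_kscale[OF module_fscale])
  interpret d: module_hom "kscale (fscale :: ('v, 'k) mpoly \<Rightarrow> (nat \<Rightarrow>\<^sub>0 ('v, 'k) mpoly) \<Rightarrow> _)" "kscale fscale" "vkd fscale var"
    by (rule module_hom_vkd[OF module_fscale])
  let ?l = "\<lambda>(n :: nat) f. Poly_Mapping.lookup f n :: ('v, 'k) mpoly"
  have hom_l: "module_hom fscale (*) (?l n)" for n
    by unfold_locales (simp_all add: lookup_add lookup_fscale)
  have hom_s: "module_hom (*) fscale (Poly_Mapping.single n :: ('v, 'k) mpoly \<Rightarrow> _)" for n :: nat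
    by unfold_locales
      (auto simp: single_add intro!: poly_mapping_eqI simp: lookup_fscale lookup_single when_def)
  have "\<exists>b\<in>kchain UNIV (Suc i). vkd (*) var b = vmap (?l n) c" for n
  proof (rule koszul_exact_ring)
    show "vmap (?l n) c \<in> kcycle (*) UNIV i"
      using c by (auto simp: kcycle_def kchain_def vkd_vmap[OF hom_l]) (simp add: vec_eq_iff)
    show "coef (vmap (?l n) c $ {}) 0 = 0"
      using c0 by (metis lookup_const lookup_zero vmap_nth)
  qed
  then obtain b where b: "\<And>n. b n \<in> kchain UNIV (Suc i)" "\<And>n. vkd (*) var (b n) = vmap (?l n) c"
    by metis
  define N where "N = (\<Union>\<sigma>. Poly_Mapping.keys (c $ \<sigma>))"
  have N: "finite N" "N \<subseteq> S"
    using c by (auto simp: N_def kcycle_def kchain_def free_on_def)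
  let ?b = "\<Sum>n\<in>N. vmap (Poly_Mapping.single n) (b n)"
  have "?b \<in> kchain (free_on S) (Suc i)"
  proof (rule k.subspace_sum[OF subspace_kchain[OF module_fscale subspace_free_on]])
    fix n assume "n \<in> N"
    then show "vmap (Poly_Mapping.single n) (b n) \<in> kchain (free_on S) (Suc i)"
      using b(1)[of n] N by (auto simp: kchain_def free_on_def)
  qed
  moreover have "vkd fscale var ?b = c"
  proof -
    have "(\<Sum>n\<in>N. vmap (Poly_Mapping.single n) (vmap (?l n) c)) $ \<sigma> = c $ \<sigma>" for \<sigma>
    proof -
      have "Poly_Mapping.keys (c $ \<sigma>) \<subseteq> N" by (auto simp: N_def)
      then have "(\<Sum>n\<in>N. Poly_Mapping.single n (?l n (c $ \<sigma>))) =
          (\<Sum>n\<in>Poly_Mapping.keys (c $ \<sigma>). Poly_Mapping.single n (?l n (c $ \<sigma>)))"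
        using N(1) by (intro sum.mono_neutral_right) (auto simp: in_keys_iff)
      then show ?thesis by (simp add: poly_mapping_sum_single)
    qed
    then show ?thesis by (simp add: vec_eq_iff d.sum vkd_vmap[OF hom_s] b(2))
  qed
  ultimately show ?thesis by blast
qed

text \<open>Koszul homology is the direct sum of its multigraded pieces: the bases
  \<open>C a\<close> of the pieces, embedded by \<open>incl\<close>, together form a basis.\<close>

lemma kdim_poly_on:
  fixes E :: "'v::finite expo set"
  assumes E: "up_closed E" and A: "finite A" "\<And>a. a \<notin> A \<Longrightarrow> hdim TYPE('k::field) i (kcx E a) = 0"
  shows "kdim (*) (poly_on E :: ('v, 'k) mpoly set) i = (\<Sum>a\<in>A. hdim TYPE('k) i (kcx E a))"
proof -
  interpret k: vector_space "kscale ((*) :: ('v, 'k) mpoly \<Rightarrow> _)"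
    by (rule vector_space_kscale[OF module_ring_self])
  interpret d: module_hom "kscale ((*) :: ('v, 'k) mpoly \<Rightarrow> _)" "kscale (*)" "vkd (*) var"
    by (rule module_hom_vkd[OF module_ring_self])
  let ?J = "poly_on E :: ('v, 'k) mpoly set"
  let ?Z = "\<lambda>a. scycle (kcx E a) i :: ('k ^ 'v set) set"
  let ?B = "\<lambda>a. sbd ` schain (kcx E a) (Suc i) :: ('k ^ 'v set) set"
  note dc = down_closed_kcx[OF E]
  note sub = subspace_kchain[OF module_ring_self subspace_poly_on[OF E]]
  have Bsub: "k.subspace (kboundary (*) ?J i)"
    unfolding kboundary_def by (rule d.subspace_image[OF sub])
  have incl_lin: "incl a (g + g') = incl a g + incl a g'" "incl a (x *s g) = kscale (*) x (incl a g)"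
    "incl a 0 = 0" for a :: "'v expo" and g g' and x :: 'k
    by (simp_all add: vec_eq_iff incl_nth single_add mult_single)
  have "\<exists>C. finite C \<and> quot_basis (*s) (?Z a) (?B a) C" for a
    by (rule quot_dim_scycle(2)[OF dc])
  then obtain C where C: "\<And>a. finite (C a)" "\<And>a. quot_basis (*s) (?Z a) (?B a) (C a)" by metis
  have card_C: "card (C a) = hdim TYPE('k) i (kcx E a)" for a
    using vec.quot_dim_eq_card[OF subspace_sbd_schain C(2)] quot_dim_scycle(1)[OF dc] by metis
  have C_empty: "C a = {}" if "a \<notin> A" for a using card_C[of a] C(1)[of a] A(2)[OF that] by simp
  have CZ: "C a \<subseteq> ?Z a" for a using C(2)[of a] by (simp add: quot_basis_def)
  have C_indep: "\<forall>c\<in>T. u c = 0" if "T \<subseteq> C a" "(\<Sum>c\<in>T. u c *s c) \<in> ?B a" for a T u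
    using C(2)[of a, unfolded quot_basis_def, THEN conjunct2, THEN conjunct1, rule_format, of T u]
      that finite_subset[OF that(1) C(1)] by blast
  have C_span: "\<exists>x\<in>vec.span (C a). z - x \<in> ?B a" if "z \<in> ?Z a" for a z
    using C(2)[of a] that by (auto simp: quot_basis_def)
  have C_nz: "0 \<notin> C a" for a
    using C_indep[of "{0}" a "\<lambda>_. 1"] vec.subspace_0[OF subspace_sbd_schain] by auto
  have C_chain: "g \<in> schain (kcx E a) i" if "g \<in> C a" for g a
    using CZ that by (auto simp: scycle_def)
  have piece_C: "piece b (incl a g) = (if a = b then g else 0)" if "g \<in> C a" for a b g
    by (rule piece_incl_schain[OF C_chain[OF that]])
  have incl_inj: "inj_on (incl a) (C a)" for a
    by (rule inj_on_inverseI[where g = "piece a"]) (simp add: piece_C)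
  define D where "D = (\<Union>a\<in>A. incl a ` C a)"
  have "quot_basis (kscale (*)) (kcycle (*) ?J i) (kboundary (*) ?J i) D"
    unfolding quot_basis_def
  proof (intro conjI allI impI ballI)
    show "D \<subseteq> kcycle (*) ?J i"
    proof
      fix c assume "c \<in> D"
      then obtain a g where ag: "c = incl a g" "g \<in> C a" by (auto simp: D_def)
      have "vkd (*) var c = 0"
      proof (rule piece_eqI)
        fix b
        have "sbd g = 0" using ag CZ by (auto simp: scycle_def)
        then show "piece b (vkd (*) var c) = piece b 0"
          unfolding ag(1) piece_vkd piece_C[OF ag(2)] by (auto simp: vec_eq_iff sbd_nth kd_def)
      qed
      then show "c \<in> kcycle (*) ?J i"
        using incl_in_kchain[OF C_chain[OF ag(2)]] ag(1) by (simp add: kcycle_def)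
    qed
  next
    fix T u c0
    assume T: "finite T \<and> T \<subseteq> D \<and> (\<Sum>c\<in>T. kscale (*) (u c) c) \<in> kboundary (*) ?J i" and c0: "c0 \<in> T"
    obtain a g0 where ag: "a \<in> A" "g0 \<in> C a" "c0 = incl a g0" using T c0 by (auto simp: D_def)
    \<comment> \<open>The component in degree \<open>a\<close> turns the relation into one among
      elements of \<open>C a\<close>, because elements from other degrees have no component
      there.\<close>
    define T0 where "T0 = {g \<in> C a. incl a g \<in> T}"
    have "T0 \<subseteq> C a" by (auto simp: T0_def)
    then have inj: "inj_on (incl a) T0" by (rule inj_on_subset[OF incl_inj])
    have "piece a (\<Sum>c\<in>T. kscale (*) (u c) c) = (\<Sum>c\<in>T. u c *s piece a c)"
      by (simp add: piece_sum piece_kscale)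
    also have "\<dots> = (\<Sum>c\<in>incl a ` T0. u c *s piece a c)"
    proof (rule sum.mono_neutral_right)
      show "\<forall>c\<in>T - incl a ` T0. u c *s piece a c = 0"
      proof
        fix c assume c: "c \<in> T - incl a ` T0"
        then obtain b g where bg: "c = incl b g" "g \<in> C b" using T by (auto simp: D_def)
        then have "b \<noteq> a" using c by (auto simp: T0_def)
        then show "u c *s piece a c = 0" using piece_C[OF bg(2)] bg(1) by simp
      qed
    qed (use T in \<open>auto simp: T0_def\<close>)
    also have "\<dots> = (\<Sum>g\<in>T0. u (incl a g) *s g)"
      unfolding sum.reindex[OF inj] o_def by (intro sum.cong) (auto simp: T0_def piece_C)
    finally have eq: "piece a (\<Sum>c\<in>T. kscale (*) (u c) c) = (\<Sum>g\<in>T0. u (incl a g) *s g)" .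
    obtain y where y: "y \<in> kchain ?J (Suc i)" "(\<Sum>c\<in>T. kscale (*) (u c) c) = vkd (*) var y"
      using T by (auto simp: kboundary_def)
    have "(\<Sum>g\<in>T0. u (incl a g) *s g) = sbd (piece a y)" using eq y(2) by (simp add: piece_vkd)
    then have "(\<Sum>g\<in>T0. u (incl a g) *s g) \<in> ?B a"
      using piece_in_schain[OF y(1)] by (rule image_eqI)
    then have "\<forall>g\<in>T0. u (incl a g) = 0" using C_indep[of T0 a "\<lambda>g. u (incl a g)"] by (auto simp: T0_def)
    then show "u c0 = 0" using ag c0 by (auto simp: T0_def)
  next
    fix z assume z: "z \<in> kcycle (*) ?J i"
    have "\<exists>x y. x \<in> vec.span (C a) \<and> y \<in> schain (kcx E a) (Suc i) \<and> piece a z - x = sbd y" for a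
      using C_span[OF piece_kcycle[OF z]] by blast
    then obtain x y where xy: "\<And>a. x a \<in> vec.span (C a)" "\<And>a. y a \<in> schain (kcx E a) (Suc i)"
        "\<And>a. piece a z - x a = sbd (y a)" by metis
    define P where "P = {a. piece a z \<noteq> 0}"
    have "incl a (x a) \<in> k.span D" for a
    proof -
      have "incl a g \<in> k.span D" if "g \<in> vec.span (C a)" for g
        using that
      proof (induction rule: vec.span_induct_alt)
        case base
        then show ?case by (simp add: incl_lin k.span_zero)
      next
        case (step r g h)
        then have "a \<in> A" using C_empty by blast
        then have "incl a g \<in> k.span D" using step(1) by (intro k.span_base) (auto simp: D_def)
        then show ?case using step by (simp add: incl_lin k.span_add k.span_scale)
      qed
      then show ?thesis using xy(1) by blast
    qed
    then have "(\<Sum>a\<in>P. incl a (x a)) \<in> k.span D" by (rule k.span_sum)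
    moreover have "z - (\<Sum>a\<in>P. incl a (x a)) \<in> kboundary (*) ?J i"
    proof -
      have zJ: "z \<in> kchain ?J i" using z by (simp add: kcycle_def)
      have "z = (\<Sum>a\<in>P. incl a (piece a z))"
        by (rule sum_incl_piece[OF _ _ zJ]) (simp_all add: P_def finite_pieces)
      also have "\<dots> = (\<Sum>a\<in>P. incl a (x a) + incl a (sbd (y a)))"
        by (simp add: xy(3)[symmetric] flip: incl_lin(1))
      finally have "z - (\<Sum>a\<in>P. incl a (x a)) = (\<Sum>a\<in>P. vkd (*) var (incl a (y a)))"
        by (simp add: sum.distrib vkd_incl[OF E xy(2)])
      moreover have "\<dots> = vkd (*) var (\<Sum>a\<in>P. incl a (y a))" by (simp add: d.sum)
      moreover have "(\<Sum>a\<in>P. incl a (y a)) \<in> kchain ?J (Suc i)"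
        by (intro k.subspace_sum[OF sub] incl_in_kchain xy(2))
      ultimately show ?thesis by (simp add: kboundary_def)
    qed
    ultimately show "\<exists>x\<in>k.span D. z - x \<in> kboundary (*) ?J i" by blast
  qed
  then have "kdim (*) ?J i = card D" by (rule k.quot_dim_eq_card[OF Bsub])
  also have "\<dots> = (\<Sum>a\<in>A. card (incl a ` C a))"
    unfolding D_def
  proof (rule card_UN_disjoint[OF A(1)])
    show "\<forall>a\<in>A. \<forall>b\<in>A. a \<noteq> b \<longrightarrow> incl a ` C a \<inter> incl b ` C b = {}"
    proof (intro ballI impI equals0I)
      fix a b c assume "a \<noteq> b" "c \<in> incl a ` C a \<inter> incl b ` C b"
      then obtain g g' where "c = incl a g" "c = incl b g'" "g \<in> C a" "g' \<in> C b" by blast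
      then show False using piece_C[of g a a] piece_C[of g' b a] \<open>a \<noteq> b\<close> C_nz[of a] by simp
    qed
  qed (simp add: C(1))
  also have "\<dots> = (\<Sum>a\<in>A. hdim TYPE('k) i (kcx E a))"
  proof (intro sum.cong refl)
    fix a
    show "card (incl a ` C a) = hdim TYPE('k) i (kcx E a)" by (simp add: card_image[OF incl_inj] card_C)
  qed
  finally show ?thesis .
qed

section \<open>Tor from Koszul homology by dimension shifting\<close>

definition unit0 :: "'m::zero \<Rightarrow> 'm ^ 'v::finite set" where
  "unit0 m = (\<chi> \<sigma>. if \<sigma> = {} then m else 0)"

lemma unit0_nth: "unit0 m $ \<sigma> = (if \<sigma> = {} then m else 0)"
  by (simp add: unit0_def)

lemma vkd_unit0:
  assumes "module s"
  shows "vkd s x (unit0 m) = 0"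
proof -
  interpret module s by fact
  show ?thesis by (auto simp: vec_eq_iff vkd_nth unit0_nth intro!: sum.neutral)
qed

lemma unit0_in_kchain: "m \<in> M \<Longrightarrow> 0 \<in> M \<Longrightarrow> unit0 m \<in> kchain M 0"
  by (auto simp: kchain_def unit0_nth)

lemma kchain_0_eq:
  assumes "c \<in> kchain M 0"
  shows "c = unit0 (c $ {})"
  using assms by (auto simp: kchain_def vec_eq_iff unit0_nth card_eq_0_iff)

lemma kcycle_0_eq:
  assumes "module s" "0 \<in> M"
  shows "kcycle s M 0 = unit0 ` M"
proof (intro equalityI subsetI)
  fix c assume "c \<in> kcycle s M 0"
  then have "c \<in> kchain M 0" by (simp add: kcycle_def)
  from kchain_0_eq[OF this] this show "c \<in> unit0 ` M" by (auto simp: kchain_def)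
qed (auto simp: kcycle_def vkd_unit0[OF assms(1)] assms(2) unit0_in_kchain)

lemma const_0 [simp]: "const 0 = 0"
  by (rule poly_mapping_eqI) (simp add: lookup_const)

lemma subspace_restrict_scalars:
  fixes s :: "('v, 'k::field) mpoly \<Rightarrow> 'm::ab_group_add \<Rightarrow> 'm"
  assumes "module s" "module.subspace s N"
  shows "module.subspace (\<lambda>c. s (Poly_Mapping.single 0 c)) N"
proof -
  interpret module s by fact
  interpret v: vector_space "\<lambda>c. s (Poly_Mapping.single 0 c)"
    by (rule vector_space_restrict_scalars[OF assms(1)])
  show ?thesis using assms(2) by (simp add: v.subspace_def subspace_def)
qed

text \<open>Every term carries a factor \<open>var v\<close>, which has no constant term.\<close>

lemma const_vkd:
  fixes x :: "('b \<Rightarrow>\<^sub>0 ('v::finite, 'k::field) mpoly) ^ 'v set"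
  shows "const (vkd fscale var x $ \<sigma>) = 0"
proof -
  have "coef (var v :: ('v, 'k) mpoly) 0 = 0" for v
    by (simp add: var_def monomial_def lookup_single when_def single_eq_0_iff)
  then show ?thesis
    by (intro poly_mapping_eqI)
      (simp add: lookup_const vkd_nth lookup_sum lookup_fscale coef_mult_0)
qed

lemma lift_kchain:
  fixes c :: "'n::zero ^ 'v::finite set" and \<phi> :: "'m::zero \<Rightarrow> 'n"
  assumes "c \<in> kchain (\<phi> ` F) i" "0 \<in> F" "\<phi> 0 = 0"
  obtains x where "x \<in> kchain F i" "vmap \<phi> x = c"
proof
  \<comment> \<open>\<open>0\<close> is lifted to \<open>0\<close> rather than to an arbitrary
    preimage, so that the lift stays supported on sets of cardinality \<open>i\<close>.\<close>
  let ?x = "\<chi> \<sigma>. if c $ \<sigma> = 0 then 0 else inv_into F \<phi> (c $ \<sigma>)"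
  show "?x \<in> kchain F i"
    using assms by (auto simp: kchain_def intro: inv_into_into)
  show "vmap \<phi> ?x = c"
    using assms by (auto simp: vec_eq_iff kchain_def intro: f_inv_into_f)
qed

text \<open>One step of a resolution: the short exact sequence formed by \<open>Syz\<close>,
  \<open>F\<close> and \<open>N\<close>.\<close>

locale free_cover = module_hom fscale s \<phi>
  for s :: "('v::finite, 'k::field) mpoly \<Rightarrow> 'm::ab_group_add \<Rightarrow> 'm"
    and \<phi> :: "(nat \<Rightarrow>\<^sub>0 ('v, 'k) mpoly) \<Rightarrow> 'm" +
  fixes S :: "nat set"
begin

abbreviation F :: "(nat \<Rightarrow>\<^sub>0 ('v, 'k) mpoly) set" where
  "F \<equiv> free_on S"

abbreviation N :: "'m set" where
  "N \<equiv> \<phi> ` F"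

definition Syz :: "(nat \<Rightarrow>\<^sub>0 ('v, 'k) mpoly) set" where
  "Syz = {f \<in> F. \<phi> f = 0}"

lemmas subF = subspace_free_on[where 'a = "('v, 'k) mpoly" and 'b = nat, of S]

lemma subN: "m2.subspace N"
  by (rule subspace_image[OF subF])

lemma subSyz: "m1.subspace Syz"
  unfolding Syz_def using m1.subspace_inter[OF subF subspace_kernel] by (simp add: Int_def)

sublocale kF: vector_space "kscale (fscale :: ('v, 'k) mpoly \<Rightarrow> (nat \<Rightarrow>\<^sub>0 ('v, 'k) mpoly) \<Rightarrow> _)"
  by (rule vector_space_kscale[OF m1.module_axioms])

sublocale kN: vector_space "kscale s"
  by (rule vector_space_kscale[OF m2.module_axioms])

sublocale dF: module_hom "kscale fscale" "kscale fscale"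
  "vkd fscale var :: (nat \<Rightarrow>\<^sub>0 ('v, 'k) mpoly) ^ 'v set \<Rightarrow> _"
  by (rule module_hom_vkd[OF m1.module_axioms])

sublocale dN: module_hom "kscale s" "kscale s" "vkd s var"
  by (rule module_hom_vkd[OF m2.module_axioms])

sublocale \<Phi>: module_hom "kscale fscale" "kscale s" "vmap \<phi> :: (nat \<Rightarrow>\<^sub>0 ('v, 'k) mpoly) ^ 'v set \<Rightarrow> _"
  by (rule module_hom_vmap[OF module_hom_axioms])

lemmas vkd_\<Phi> = vkd_vmap[OF module_hom_axioms]
lemmas chF = subspace_kchain[OF m1.module_axioms subF]
lemmas chN = subspace_kchain[OF m2.module_axioms subN]
lemmas chSyz = subspace_kchain[OF m1.module_axioms subSyz]

lemma kboundary_subspace: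
  "kF.subspace (kboundary fscale Syz i)" "kN.subspace (kboundary s N i)"
  unfolding kboundary_def by (rule dF.subspace_image[OF chSyz], rule dN.subspace_image[OF chN])

lemma \<Phi>_kchain: "x \<in> kchain F i \<Longrightarrow> vmap \<phi> x \<in> kchain N i"
  by (auto simp: kchain_def)

lemma kchain_Syz_iff: "x \<in> kchain Syz i \<longleftrightarrow> x \<in> kchain F i \<and> vmap \<phi> x = 0"
  by (auto simp: kchain_def Syz_def vec_eq_iff)

lemma lift:
  assumes "c \<in> kchain N i"
  obtains x where "x \<in> kchain F i" "vmap \<phi> x = c"
  by (rule lift_kchain[OF assms m1.subspace_0[OF subF] zero])

text \<open>The connecting map of the sequence of \<open>Syz\<close>, \<open>F\<close> and
  \<open>N\<close>. The lifts \<open>P\<close> of cycles of \<open>N\<close> map by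
  \<open>\<phi>\<close> onto these cycles and by the differential onto cycles of \<open>Syz\<close>;
  exactness for \<open>F\<close> shows that \<open>Q\<close> is what becomes trivial on either side.
  The condition on constants cuts out the classes that vanish in \<open>F\<close> and matters for
  \<open>i = 0\<close>.\<close>

lemma kdim_shift:
  "kdim s N (Suc i) =
    quot_dim (kscale fscale) {c \<in> kcycle fscale Syz i. const (c $ {}) = 0} (kboundary fscale Syz i)"
proof -
  define P where "P = {x \<in> kchain F (Suc i). vmap \<phi> (vkd fscale var x) = 0}"
  define Q where "Q = {x \<in> P. vmap \<phi> x \<in> kboundary s N (Suc i)}"
  have P: "kF.subspace P"
    unfolding P_def
    using kF.subspace_inter[OF chF module_hom.subspace_kernel[OF
          module_hom_compose[OF dF.module_hom_axioms \<Phi>.module_hom_axioms]]]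
    by (simp add: Int_def)
  have Q: "kF.subspace Q"
    unfolding Q_def
    using kF.subspace_inter[OF P \<Phi>.subspace_linear_preimage[OF kboundary_subspace(2)]]
    by (simp add: Int_def)
  have "quot_dim (kscale fscale) P Q = kdim s N (Suc i)"
  proof (rule quot_dim_image[OF kF.vector_space_axioms kN.vector_space_axioms \<Phi>.module_hom_axioms
        P Q kboundary_subspace(2)])
    show "vmap \<phi> ` P = kcycle s N (Suc i)"
    proof (intro equalityI subsetI)
      fix c assume c: "c \<in> kcycle s N (Suc i)"
      then have "c \<in> kchain N (Suc i)" by (simp add: kcycle_def)
      then obtain x where "x \<in> kchain F (Suc i)" "vmap \<phi> x = c" by (rule lift)
      then have "x \<in> P" "c = vmap \<phi> x" using c by (auto simp: P_def kcycle_def simp flip: vkd_\<Phi>)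
      then show "c \<in> vmap \<phi> ` P" by blast
    qed (auto simp: P_def kcycle_def \<Phi>_kchain vkd_\<Phi>)
  qed (simp add: Q_def)
  moreover have "quot_dim (kscale fscale) P Q =
    quot_dim (kscale fscale) {c \<in> kcycle fscale Syz i. const (c $ {}) = 0} (kboundary fscale Syz i)"
  proof (rule quot_dim_image[OF kF.vector_space_axioms kF.vector_space_axioms dF.module_hom_axioms
        P Q kboundary_subspace(1)])
    show "vkd fscale var ` P = {c \<in> kcycle fscale Syz i. const (c $ {}) = 0}"
    proof (intro equalityI subsetI)
      fix c assume "c \<in> {c \<in> kcycle fscale Syz i. const (c $ {}) = 0}"
      then have c: "c \<in> kcycle fscale F i" "const (c $ {}) = 0" "vmap \<phi> c = 0"
        by (auto simp: kcycle_def kchain_Syz_iff)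
      from koszul_exact_free[OF c(1,2)] obtain b where "b \<in> kchain F (Suc i)" "vkd fscale var b = c"
        by blast
      then show "c \<in> vkd fscale var ` P" using c(3) by (auto simp: P_def)
    qed (auto simp: P_def kcycle_def kchain_Syz_iff const_vkd vkd_kchain[OF m1.module_axioms subF]
        vkd_vkd[OF m1.module_axioms])
  next
    fix x assume x: "x \<in> P"
    show "vkd fscale var x \<in> kboundary fscale Syz i \<longleftrightarrow> x \<in> Q"
    proof
      assume "vkd fscale var x \<in> kboundary fscale Syz i"
      then obtain y where y: "y \<in> kchain F (Suc i)" "vmap \<phi> y = 0" "vkd fscale var x = vkd fscale var y"
        by (auto simp: kboundary_def kchain_Syz_iff)
      \<comment> \<open>Two lifts with the same differential differ by a cycle of positive degree in
        \<open>F\<close>, hence by a boundary.\<close>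
      have "x - y \<in> kchain F (Suc i)" using x y(1) kF.subspace_diff[OF chF] by (simp add: P_def)
      then have "x - y \<in> kcycle fscale F (Suc i)" "const ((x - y) $ {}) = 0"
        using y(3) by (auto simp: kcycle_def dF.diff kchain_def)
      from koszul_exact_free[OF this] obtain b
        where b: "b \<in> kchain F (Suc (Suc i))" "vkd fscale var b = x - y" by blast
      have "vmap \<phi> x = vmap \<phi> (vkd fscale var b)" using y(2) by (simp add: b(2) \<Phi>.diff)
      then have "vmap \<phi> x \<in> kboundary s N (Suc i)"
        using \<Phi>_kchain[OF b(1)] by (auto simp: kboundary_def simp flip: vkd_\<Phi>)
      then show "x \<in> Q" using x by (simp add: Q_def)
    next
      assume "x \<in> Q"
      then obtain b' where b': "b' \<in> kchain N (Suc (Suc i))" "vmap \<phi> x = vkd s var b'"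
        by (auto simp: Q_def kboundary_def)
      from b'(1) obtain b where b: "b \<in> kchain F (Suc (Suc i))" "vmap \<phi> b = b'" by (rule lift)
      let ?y = "x - vkd fscale var b"
      have "?y \<in> kchain F (Suc i)"
        using x vkd_kchain[OF m1.module_axioms subF b(1)] kF.subspace_diff[OF chF] by (simp add: P_def)
      moreover have "vmap \<phi> ?y = 0" using b'(2) b(2) by (simp add: \<Phi>.diff flip: vkd_\<Phi>)
      moreover have "vkd fscale var x = vkd fscale var ?y"
        by (simp add: dF.diff vkd_vkd[OF m1.module_axioms])
      ultimately show "vkd fscale var x \<in> kboundary fscale Syz i"
        by (auto simp: kboundary_def kchain_Syz_iff)
    qed
  qed
  ultimately show ?thesis by simp
qed

text \<open>Degree zero homology is \<open>N\<close> modulo its multiples by variables, that is,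
  \<open>F\<close> modulo \<open>Syz\<close> and the elements without constant coefficients.\<close>

lemma unit0_in_kboundary_iff:
  assumes f: "f \<in> F"
  shows "unit0 (\<phi> f) \<in> kboundary s N 0 \<longleftrightarrow> const f \<in> const ` Syz"
proof -
  interpret c: module_hom fscale const_scale "const :: (nat \<Rightarrow>\<^sub>0 ('v, 'k) mpoly) \<Rightarrow> _"
    by (rule module_hom_const)
  have \<Phi>_unit0: "vmap \<phi> (unit0 g) = unit0 (\<phi> g)" for g
    by (simp add: vec_eq_iff unit0_nth zero)
  show ?thesis
  proof
    assume "unit0 (\<phi> f) \<in> kboundary s N 0"
    then obtain b' where b': "b' \<in> kchain N (Suc 0)" "unit0 (\<phi> f) = vkd s var b'"
      by (auto simp: kboundary_def)
    from b'(1) obtain b where b: "b \<in> kchain F (Suc 0)" "vmap \<phi> b = b'" by (rule lift)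
    let ?g = "vkd fscale var b $ {}"
    have g: "?g \<in> F" using vkd_kchain[OF m1.module_axioms subF b(1)] by (simp add: kchain_def)
    have "\<phi> f = \<phi> ?g" using b'(2) b(2) by (metis unit0_nth vkd_\<Phi> vmap_nth)
    then have "f - ?g \<in> Syz" using f g m1.subspace_diff[OF subF] by (simp add: Syz_def diff)
    moreover have "const f = const (f - ?g)" by (simp add: c.diff const_vkd)
    ultimately show "const f \<in> const ` Syz" by blast
  next
    assume "const f \<in> const ` Syz"
    then obtain g where g: "g \<in> F" "\<phi> g = 0" "const f = const g" by (auto simp: Syz_def)
    have "f - g \<in> F" by (rule m1.subspace_diff[OF subF f g(1)])
    then have "unit0 (f - g) \<in> kcycle fscale F 0"
      by (simp add: kcycle_0_eq[OF m1.module_axioms m1.subspace_0[OF subF]])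
    moreover have "const (unit0 (f - g) $ {}) = 0" using g(3) by (simp add: unit0_nth c.diff)
    ultimately obtain b where b: "b \<in> kchain F (Suc 0)" "vkd fscale var b = unit0 (f - g)"
      using koszul_exact_free by blast
    have "unit0 (\<phi> f) = vkd s var (vmap \<phi> b)"
      by (simp add: vkd_\<Phi> b(2) \<Phi>_unit0 diff g(2))
    then show "unit0 (\<phi> f) \<in> kboundary s N 0" using \<Phi>_kchain[OF b(1)] by (auto simp: kboundary_def)
  qed
qed

text \<open>\<open>W\<close> is general to serve two degrees: \<open>W = N\<close> gives degree
  zero, and syzygies without constant coefficients give, through \<open>kdim_shift\<close>, degree
  one.\<close>

lemma quot_dim_unit0:
  assumes W: "module.subspace (\<lambda>c. s (Poly_Mapping.single 0 c)) W" "W \<subseteq> N"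
  shows "quot_dim (kscale s) (unit0 ` W) (kboundary s N 0) =
    quot_dim const_fscale {f \<in> F. \<phi> f \<in> W} {f \<in> F. \<phi> f \<in> W \<and> const f \<in> const ` Syz}"
proof -
  interpret fv: vector_space "const_fscale :: 'k \<Rightarrow> (nat \<Rightarrow>\<^sub>0 ('v, 'k) mpoly) \<Rightarrow> _"
    by (rule vector_space_restrict_scalars[OF m1.module_axioms])
  interpret sv: vector_space "\<lambda>c. s (Poly_Mapping.single 0 c)"
    by (rule vector_space_restrict_scalars[OF m2.module_axioms])
  interpret p: module_hom const_fscale "\<lambda>c. s (Poly_Mapping.single 0 c)" \<phi>
    by unfold_locales (simp_all add: add scale)
  interpret u: module_hom const_fscale "kscale s" "\<lambda>f. unit0 (\<phi> f)"
    by unfold_locales (simp_all add: vec_eq_iff unit0_nth add scale)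
  have fF: "fv.subspace F"
    by (rule subspace_restrict_scalars[OF m1.module_axioms subF])
  have P: "fv.subspace {f \<in> F. \<phi> f \<in> W}"
    using fv.subspace_inter[OF fF p.subspace_linear_preimage[OF W(1)]] by (simp add: Int_def)
  have "{f \<in> F. \<phi> f \<in> W \<and> const f \<in> const ` Syz} =
      {f \<in> F. \<phi> f \<in> W} \<inter> {f. unit0 (\<phi> f) \<in> kboundary s N 0}"
    using unit0_in_kboundary_iff by auto
  then have Q: "fv.subspace {f \<in> F. \<phi> f \<in> W \<and> const f \<in> const ` Syz}"
    using fv.subspace_inter[OF P u.subspace_linear_preimage[OF kboundary_subspace(2)]] by simp
  show ?thesis
    by (rule sym, rule quot_dim_image[OF fv.vector_space_axioms kN.vector_space_axioms
          u.module_hom_axioms P Q kboundary_subspace(2)])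
      (use W(2) unit0_in_kboundary_iff in \<open>auto simp: image_iff\<close>)
qed

end

section \<open>Koszul homology read off a free resolution\<close>

lemma free_resolution_shift:
  assumes "free_resolution s N S d e"
  shows "free_resolution fscale {f \<in> free_on (S 0). e f = 0} (S \<circ> Suc) (d \<circ> Suc) (d 0)"
  using assms by (simp add: free_resolution_def numeral_2_eq_2)

lemma free_resolution_cover:
  assumes "free_resolution s N S d e"
  shows "free_cover s e" "free_cover.Syz e (S 0) = d 0 ` free_on (S 1)" "e ` free_on (S 0) = N"
proof -
  interpret module_hom fscale s e using assms by (simp add: free_resolution_def)
  interpret free_cover s e "S 0" ..
  show "free_cover s e" ..
  show "free_cover.Syz e (S 0) = d 0 ` free_on (S 1)" "e ` free_on (S 0) = N"
    using assms by (simp_all add: Syz_def free_resolution_def)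
qed

lemma kdim_0:
  assumes res: "free_resolution s N S d e"
  shows "kdim s N 0 = quot_dim const_fscale (res_cycles S d 0) (res_boundaries S d 0)"
proof -
  note cover = free_resolution_cover[OF res]
  interpret free_cover s e "S 0" by (rule cover(1))
  have "m2.subspace N" using subN cover(3) by simp
  then have sub: "module.subspace (\<lambda>c. s (Poly_Mapping.single 0 c)) N"
    by (rule subspace_restrict_scalars[OF m2.module_axioms])
  have "kdim s N 0 = quot_dim (kscale s) (unit0 ` N) (kboundary s N 0)"
    using kcycle_0_eq[OF m2.module_axioms m2.subspace_0] \<open>m2.subspace N\<close> by simp
  also have "\<dots> = quot_dim const_fscale {f \<in> free_on (S 0). e f \<in> N}
      {f \<in> free_on (S 0). e f \<in> N \<and> const f \<in> const ` Syz}"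
    using quot_dim_unit0[OF sub] cover(3) by simp
  also have "{f \<in> free_on (S 0). e f \<in> N} = res_cycles S d 0"
    using cover(3) by (auto simp: res_cycles_def)
  also have "{f \<in> free_on (S 0). e f \<in> N \<and> const f \<in> const ` Syz} = res_boundaries S d 0"
    using cover(2,3) by (auto simp: res_boundaries_def res_cycles_def)
  finally show ?thesis .
qed

text \<open>The first homology is the kernel of the map from degree zero homology of the syzygies to
  that of the free module; it is represented by syzygies without constant coefficients, which form
  \<open>?W\<close>.\<close>

lemma kdim_1:
  assumes res: "free_resolution s N S d e"
  shows "kdim s N 1 = quot_dim const_fscale (res_cycles S d 1) (res_boundaries S d 1)"
proof -
  note cover = free_resolution_cover[OF res]
  interpret A: free_cover s e "S 0" by (rule cover(1))
  note cover' = free_resolution_cover[OF free_resolution_shift[OF res]]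
  interpret B: free_cover fscale "d 0" "S 1" by (rule cover'(1))
  have Syz: "A.Syz = d 0 ` free_on (S 1)" by (rule cover(2))
  interpret fv: vector_space "const_fscale :: 'b \<Rightarrow> (nat \<Rightarrow>\<^sub>0 ('a, 'b) mpoly) \<Rightarrow> _"
    by (rule vector_space_restrict_scalars[OF module_fscale])
  interpret c: module_hom const_fscale fscale "const :: (nat \<Rightarrow>\<^sub>0 ('a, 'b) mpoly) \<Rightarrow> _"
  proof -
    interpret c: module_hom fscale const_scale "const :: (nat \<Rightarrow>\<^sub>0 ('a, 'b) mpoly) \<Rightarrow> _"
      by (rule module_hom_const)
    interpret kv: vector_space "fscale :: 'b \<Rightarrow> (nat \<Rightarrow>\<^sub>0 'b) \<Rightarrow> _" by (rule vector_space_fscale)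
    show "module_hom const_fscale fscale (const :: (nat \<Rightarrow>\<^sub>0 ('a, 'b) mpoly) \<Rightarrow> _)"
      by unfold_locales (simp_all add: c.add c.scale const_scale_def)
  qed
  let ?W = "{g \<in> A.Syz. const g = 0}"
  have W: "fv.subspace ?W"
    using fv.subspace_inter[OF subspace_restrict_scalars[OF module_fscale A.subSyz] c.subspace_kernel]
    by (simp add: Int_def)
  have "kdim s N 1 = quot_dim (kscale fscale) {c \<in> kcycle fscale A.Syz 0. const (c $ {}) = 0} (kboundary fscale A.Syz 0)"
    using A.kdim_shift[of 0] cover(3) by simp
  also have "{c \<in> kcycle fscale A.Syz 0. const (c $ {}) = 0} = unit0 ` ?W"
    by (auto simp: kcycle_0_eq[OF module_fscale A.m1.subspace_0[OF A.subSyz]] unit0_nth)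
  also have "quot_dim (kscale fscale) (unit0 ` ?W) (kboundary fscale A.Syz 0) =
      quot_dim const_fscale {f \<in> free_on (S 1). d 0 f \<in> ?W}
        {f \<in> free_on (S 1). d 0 f \<in> ?W \<and> const f \<in> const ` B.Syz}"
    using B.quot_dim_unit0[OF W] Syz by auto
  also have "{f \<in> free_on (S 1). d 0 f \<in> ?W} = res_cycles S d 1"
    unfolding Syz by (auto simp: res_cycles_def)
  also have "{f \<in> free_on (S 1). d 0 f \<in> ?W \<and> const f \<in> const ` B.Syz} = res_boundaries S d 1"
    unfolding Syz using cover'(2) by (auto simp: res_boundaries_def res_cycles_def numeral_2_eq_2)
  finally show ?thesis .
qed

lemma res_shift:
  "res_cycles (S \<circ> Suc) (d \<circ> Suc) (Suc i) = res_cycles S d (Suc (Suc i))"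
  "res_boundaries (S \<circ> Suc) (d \<circ> Suc) (Suc i) = res_boundaries S d (Suc (Suc i))"
  by (simp_all add: res_boundaries_def res_cycles_def)

text \<open>In positive degree the coordinate at \<open>{}\<close> is zero, so the side condition of
  \<open>kdim_shift\<close> is automatic.\<close>

lemma kdim_Suc_Suc:
  assumes res: "free_resolution s N S d e"
  shows "kdim s N (Suc (Suc i)) = kdim fscale {f \<in> free_on (S 0). e f = 0} (Suc i)"
proof -
  note cover = free_resolution_cover[OF res]
  interpret A: free_cover s e "S 0" by (rule cover(1))
  have "{c \<in> kcycle fscale A.Syz (Suc i). const (c $ {}) = 0} = kcycle fscale A.Syz (Suc i)"
    by (auto simp: kcycle_def kchain_def)
  then show ?thesis using A.kdim_shift[of "Suc i"] cover(3) by (simp add: A.Syz_def)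
qed

text \<open>After one shift all modules are submodules of free modules with scalar multiplication
  \<open>fscale\<close>, so the induction stays inside one type; the original module may live in
  another.\<close>

lemma kdim_Suc_fscale:
  fixes N :: "(nat \<Rightarrow>\<^sub>0 ('v::finite, 'k::field) mpoly) set"
  assumes "free_resolution fscale N S d e"
  shows "kdim fscale N (Suc i) = quot_dim const_fscale (res_cycles S d (Suc i)) (res_boundaries S d (Suc i))"
  using assms
proof (induction i arbitrary: N S d e)
  case 0
  then show ?case using kdim_1 by simp
next
  case (Suc i)
  show ?case
    unfolding kdim_Suc_Suc[OF Suc.prems] Suc.IH[OF free_resolution_shift[OF Suc.prems]] res_shift ..
qed

lemma kdim_eq_res:
  assumes res: "free_resolution s N S d e"
  shows "kdim s N i = quot_dim const_fscale (res_cycles S d i) (res_boundaries S d i)"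
proof (cases i)
  case 0
  then show ?thesis using kdim_0[OF res] by simp
next
  case (Suc j)
  show ?thesis
  proof (cases j)
    case 0
    then show ?thesis using Suc kdim_1[OF res] by simp
  next
    case (Suc l)
    then show ?thesis
      using \<open>i = Suc j\<close> kdim_Suc_Suc[OF res] kdim_Suc_fscale[OF free_resolution_shift[OF res]]
      by (simp add: res_shift)
  qed
qed

text \<open>Every resolution computes the Koszul homology, in particular the one chosen in
  \<open>dim_tor\<close>.\<close>

theorem dim_tor_eq_kdim:
  fixes s :: "('v::finite, 'k::field) mpoly \<Rightarrow> 'm::ab_group_add \<Rightarrow> 'm"
  assumes "\<exists>S d e. free_resolution s M S d e"
  shows "dim_tor s M i = kdim s M i"
proof -
  let ?r = "SOME (S, d, e). free_resolution s M S d e"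
  have "case ?r of (S, d, e) \<Rightarrow> free_resolution s M S d e"
    by (rule someI_ex) (use assms in auto)
  then obtain S d e where r: "?r = (S, d, e)" "free_resolution s M S d e"
    by (cases ?r) auto
  show ?thesis
    unfolding dim_tor_def r(1) Let_def prod.case dim_tor_eq_res[OF r(2)] kdim_eq_res[OF r(2)] ..
qed

section \<open>Betti numbers of monomial ideals\<close>

text \<open>A Hochster-type formula: ring and resolution have disappeared, and the field enters only
  through ranks. The range of summation is finite by \<open>finite_hdim_support\<close>.\<close>

definition betti_exp :: "'k::field itself \<Rightarrow> nat \<Rightarrow> 'v::finite expo set \<Rightarrow> nat" where
  "betti_exp F i E = (\<Sum>a | hdim F i (kcx E a) \<noteq> 0. hdim F i (kcx E a))"

lemma finite_bounded_expos: "finite {a :: 'v::finite expo. \<forall>v. expon a v \<le> n}"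
proof (rule finite_imageD)
  have "expon ` {a :: 'v expo. \<forall>v. expon a v \<le> n} \<subseteq> UNIV \<rightarrow>\<^sub>E {..n}" by auto
  then show "finite (expon ` {a :: 'v expo. \<forall>v. expon a v \<le> n})"
    by (rule finite_subset) (simp add: finite_PiE)
  show "inj_on expon {a :: 'v expo. \<forall>v. expon a v \<le> n}"
    by (rule inj_onI) (simp add: poly_mapping_eqI)
qed

text \<open>
  In a degree exceeding all minimal generators in the variable \<open>v\<close>, the complex is a cone with apex \<open>v\<close>.
\<close>

lemma finite_hdim_support:
  fixes E :: "'v::finite expo set"
  assumes E: "up_closed E"
  shows "finite {a. hdim F i (kcx E a) \<noteq> 0}"
proof -
  \<comment> \<open>A crude common bound: the sum of all exponents of all minimal
    generators.\<close>
  define n where "n = (\<Sum>m\<in>min_exps E. \<Sum>v\<in>UNIV. expon m v)"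
  have n: "expon m v \<le> n" if "m \<in> min_exps E" for m v
  proof -
    have "expon m v \<le> (\<Sum>v\<in>UNIV. expon m v)" by (rule member_le_sum) auto
    also have "\<dots> \<le> n" unfolding n_def by (rule member_le_sum) (use that finite_min_exps in auto)
    finally show ?thesis .
  qed
  have "hdim F i (kcx E a) = 0" if "expon a v > n" for a v
  proof (rule hdim_cone[OF down_closed_kcx[OF E]])
    fix \<tau> assume \<tau>: "\<tau> \<in> kcx E a"
    then have "a - chi \<tau> \<in> esum (min_exps E) UNIV" by (simp add: esum_min_exps[OF E] kcx_def)
    then obtain m where m: "m \<in> min_exps E" "ediv m (a - chi \<tau>)" by (auto simp: in_esum_UNIV)
    have "expon m x \<le> expon (a - chi (insert v \<tau>)) x" for x
    proof (cases "x = v")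
      case True
      then show ?thesis using n[OF m(1), of v] that by (simp add: lookup_minus)
    next
      case False
      then show ?thesis using m(2) by (simp add: ediv_def lookup_minus)
    qed
    then have "ediv m (a - chi (insert v \<tau>))" by (simp add: ediv_def)
    moreover have "m \<in> E" using m(1) by (simp add: min_exps_def)
    ultimately have "a - chi (insert v \<tau>) \<in> E" using up_closedD[OF E] by blast
    moreover have "v \<in> Poly_Mapping.keys a" using that by (simp add: in_keys_iff)
    ultimately show "insert v \<tau> \<in> kcx E a" using \<tau> by (simp add: kcx_def)
  qed
  then have "{a. hdim F i (kcx E a) \<noteq> 0} \<subseteq> {a. \<forall>v. expon a v \<le> n}"
    by (auto intro: leI)
  then show ?thesis using finite_bounded_expos by (rule finite_subset)
qed

lemma betti_exp_eq_sum:
  assumes "finite A" "{a. hdim F i (kcx E a) \<noteq> 0} \<subseteq> A"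
  shows "betti_exp F i E = (\<Sum>a\<in>A. hdim F i (kcx E a))"
  unfolding betti_exp_def by (rule sum.mono_neutral_left) (use assms in auto)

theorem betti_eq_betti_exp:
  fixes E :: "'v::finite expo set"
  assumes E: "up_closed E"
  shows "betti TYPE('f::field) i (poly_on E :: ('v, 'k::field) mpoly set) = betti_exp TYPE('f) i E"
proof -
  have "betti TYPE('f) i (poly_on E :: ('v, 'k) mpoly set) = kdim (*) (poly_on E :: ('v, 'f) mpoly set) i"
    unfolding betti_poly_on[OF E]
    by (rule dim_tor_eq_kdim[OF ex_free_resolution[OF subspace_poly_on[OF E]]])
  also have "\<dots> = betti_exp TYPE('f) i E"
    unfolding betti_exp_def by (rule kdim_poly_on[OF E finite_hdim_support[OF E]]) simp
  finally show ?thesis .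
qed

lemma betti_exp_rat_le:
  fixes E :: "'v::finite expo set"
  assumes E: "up_closed E"
  shows "betti_exp TYPE(rat) i E \<le> betti_exp TYPE('f::field) i E"
proof -
  \<comment> \<open>The two fields may have different supports, so both sums are taken over the
    union.\<close>
  let ?A = "{a. hdim TYPE(rat) i (kcx E a) \<noteq> 0} \<union> {a. hdim TYPE('f) i (kcx E a) \<noteq> 0}"
  have fin: "finite ?A" by (intro finite_UnI finite_hdim_support[OF E])
  have "betti_exp TYPE(rat) i E = (\<Sum>a\<in>?A. hdim TYPE(rat) i (kcx E a))"
    by (rule betti_exp_eq_sum[OF fin]) simp
  also have "\<dots> \<le> (\<Sum>a\<in>?A. hdim TYPE('f) i (kcx E a))"
    by (intro sum_mono hdim_rat_le down_closed_kcx[OF E])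
  also have "\<dots> = betti_exp TYPE('f) i E"
    by (rule betti_exp_eq_sum[OF fin, symmetric]) simp
  finally show ?thesis .
qed

section \<open>Unions, intersections and shifts of exponent sets\<close>

lemma kcx_Un: "kcx (A \<union> B) a = kcx A a \<union> kcx B a"
  by (auto simp: kcx_def)

lemma kcx_Int: "kcx (A \<inter> B) a = kcx A a \<inter> kcx B a"
  by (auto simp: kcx_def)

lemma hdim_empty [simp]: "hdim F i {} = 0"
  by (simp add: hdim_def faces_def)

text \<open>Multiplication by the monomial of \<open>w\<close> only translates multidegrees; nothing
  lives in degrees that \<open>w\<close> does not divide.\<close>

lemma kcx_shift: "kcx (esum {w} E) a = (if ediv w a then kcx E (a - w) else {})"
proof -
  have "\<sigma> \<in> kcx (esum {w} E) a \<longleftrightarrow> ediv w a \<and> \<sigma> \<in> kcx E (a - w)" for \<sigma>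
  proof
    assume "\<sigma> \<in> kcx (esum {w} E) a"
    then obtain c where c: "\<sigma> \<subseteq> Poly_Mapping.keys a" "c \<in> E" "a - chi \<sigma> = w + c"
      by (auto simp: kcx_def esum_def)
    have "a = w + (c + chi \<sigma>)" using minus_chi_add[OF c(1)] c(3) by (simp add: add.assoc)
    then show "ediv w a \<and> \<sigma> \<in> kcx E (a - w)"
      using c(2) by (simp add: kcx_def subset_keys_add_chi)
  next
    assume \<sigma>: "ediv w a \<and> \<sigma> \<in> kcx E (a - w)"
    then have a: "a = w + (a - w)" using ediv_minus_add[of w a] by (simp add: add.commute)
    have \<sigma>': "\<sigma> \<subseteq> Poly_Mapping.keys (a - w)" "a - w - chi \<sigma> \<in> E" using \<sigma> by (simp_all add: kcx_def)
    have "a - chi \<sigma> = w + (a - w - chi \<sigma>)"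
    proof (rule poly_mapping_eqI)
      fix v
      have "v \<in> \<sigma> \<Longrightarrow> expon (a - w) v \<noteq> 0" using \<sigma>'(1) by (auto simp: in_keys_iff)
      then show "expon (a - chi \<sigma>) v = expon (w + (a - w - chi \<sigma>)) v"
        using \<sigma> by (auto simp: ediv_def lookup_minus lookup_add)
    qed
    moreover have "\<sigma> \<subseteq> Poly_Mapping.keys a" using \<sigma>'(1) by (auto simp: in_keys_iff lookup_minus)
    ultimately show "\<sigma> \<in> kcx (esum {w} E) a" using \<sigma>'(2) by (auto simp: kcx_def esum_def)
  qed
  then show ?thesis by auto
qed

lemma betti_exp_shift:
  fixes E :: "'v::finite expo set"
  shows "betti_exp F i (esum {w} E) = betti_exp F i E"
proof -
  have supp: "{a. hdim F i (kcx (esum {w} E) a) \<noteq> 0} = (+) w ` {a. hdim F i (kcx E a) \<noteq> 0}"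
  proof (intro set_eqI iffI)
    fix a assume a: "a \<in> {a. hdim F i (kcx (esum {w} E) a) \<noteq> 0}"
    then have "ediv w a" "hdim F i (kcx E (a - w)) \<noteq> 0" by (auto simp: kcx_shift split: if_splits)
    then show "a \<in> (+) w ` {a. hdim F i (kcx E a) \<noteq> 0}"
      using ediv_minus_add[of w a] by (intro image_eqI[of _ _ "a - w"]) (simp_all add: add.commute)
  qed (auto simp: kcx_shift)
  show ?thesis
    unfolding betti_exp_def supp by (subst sum.reindex) (auto simp: kcx_shift)
qed

text \<open>The unit ideal is free of rank one. In degrees other than \<open>0\<close> the complex
  is a cone; in degree \<open>0\<close> it is \<open>{{}}\<close>, whose only homology is that of
  the empty face, hence of index \<open>0\<close>.\<close>

lemma betti_exp_UNIV: "betti_exp F i (UNIV :: 'v::finite expo set) = (if i = 0 then 1 else 0)"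
proof -
  have 0: "hdim F i (kcx UNIV a) = 0" if "a \<noteq> 0" for a :: "'v expo"
  proof -
    obtain v where "v \<in> Poly_Mapping.keys a" using \<open>a \<noteq> 0\<close> by (metis all_not_in_conv keys_eq_empty)
    then show ?thesis
      by (intro hdim_cone[where v = v] down_closed_kcx) (auto simp: kcx_def)
  qed
  have "{a :: 'v expo. hdim F i (kcx UNIV a) \<noteq> 0} \<subseteq> {0}"
  proof
    fix a :: "'v expo" assume "a \<in> {a. hdim F i (kcx UNIV a) \<noteq> 0}"
    then show "a \<in> {0}" using 0[of a] by (cases "a = 0") simp_all
  qed
  then have "betti_exp F i (UNIV :: 'v expo set) = hdim F i (kcx UNIV (0 :: 'v expo))"
    by (subst betti_exp_eq_sum[of "{0}"]) simp_all
  also have "kcx UNIV (0 :: 'v expo) = {{}}" by (auto simp: kcx_def)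
  also have "hdim F i ({{}} :: 'v set set) = (if i = 0 then 1 else 0)"
  proof (cases "i = 0")
    case True
    have "sbd ` schain {{}} (Suc 0) \<subseteq> ({0} :: ('a ^ 'v set) set)"
      by (auto simp: schain_def faces_def vec_eq_iff sbd_nth kd_def)
    from vec.dim_subset[OF this] have "srank F (Suc 0) ({{}} :: 'v set set) = 0"
      by (simp add: srank_def)
    then show ?thesis using True by (simp add: hdim_def faces_def)
  next
    case False
    then have "faces ({{}} :: 'v set set) i = {}" by (auto simp: faces_def)
    then show ?thesis using False by (simp add: hdim_def)
  qed
  finally show ?thesis .
qed

section \<open>Powers of \<open>I + (w)\<close>\<close>

lemma epow_Suc_subset: "epow E (Suc n) \<subseteq> epow E n"
  using up_closed_epow[of E n] by (auto simp: esum_def up_closed_def) (metis add.commute)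

lemma epow_mono: "E \<subseteq> E' \<Longrightarrow> epow E n \<subseteq> epow E' n"
  by (induction n) (auto simp: esum_def)

lemma esum_Un_left: "esum (A \<union> B) C = esum A C \<union> esum B C"
  by (auto simp: esum_def)

lemma esum_Un_right: "esum A (B \<union> C) = esum A B \<union> esum A C"
  by (auto simp: esum_def)

lemma esum_assoc: "esum (esum A B) C = esum A (esum B C)"
proof (intro equalityI subsetI)
  fix x assume "x \<in> esum (esum A B) C"
  then obtain a b c where "x = a + (b + c)" "a \<in> A" "b \<in> B" "c \<in> C"
    by (auto simp: esum_def add.assoc)
  then show "x \<in> esum A (esum B C)" unfolding esum_def by blast
next
  fix x assume "x \<in> esum A (esum B C)"
  then obtain a b c where "x = (a + b) + c" "a \<in> A" "b \<in> B" "c \<in> C"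
    by (auto simp: esum_def add.assoc)
  then show "x \<in> esum (esum A B) C" unfolding esum_def by blast
qed

lemma esum_commute: "esum A B = esum B A"
  by (auto simp: esum_def) (metis add.commute)+

lemma esum_UNIV_right: "up_closed E \<Longrightarrow> esum UNIV E = E"
proof -
  assume E: "up_closed E"
  have "a \<in> esum UNIV E" if "a \<in> E" for a
  proof -
    have "0 + a \<in> esum UNIV E" unfolding esum_def using that by blast
    then show ?thesis by simp
  qed
  then show ?thesis using esum_UNIV_subset[OF E, of UNIV] by (auto simp: esum_commute)
qed

lemma esum_mono: "A \<subseteq> A' \<Longrightarrow> B \<subseteq> B' \<Longrightarrow> esum A B \<subseteq> esum A' B'"
  by (auto simp: esum_def)

text \<open>Splitting off one factor gives \<open>E J\<close> and \<open>w J\<close>. By induction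
  \<open>E J\<close> adds only the pure power of \<open>E\<close>, because a product of
  \<open>E\<close> with \<open>w J\<close> is \<open>w\<close> times \<open>E J\<close> and so lies
  in \<open>w\<close> times the next \<open>J\<close>. No binomial expansion is needed.\<close>

lemma epow_Un_principal:
  defines "J \<equiv> \<lambda>E w n. epow (E \<union> esum {w} UNIV) n"
  shows "J E w (Suc n) = epow E (Suc n) \<union> esum {w} (J E w n)"
proof -
  have J: "J E w (Suc n) = esum E (J E w n) \<union> esum {w} (J E w n)" for n
    by (simp add: J_def esum_Un_left esum_assoc esum_UNIV_right up_closed_epow)
  have "esum E (J E w n) \<subseteq> epow E (Suc n) \<union> esum {w} (J E w n)"
  proof (induction n)
    case 0
    then show ?case by (simp add: J_def)
  next
    case (Suc n)
    have "J E w (Suc n) \<subseteq> epow E (Suc n) \<union> esum {w} (J E w n)" using Suc by (auto simp: J)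
    then have "esum E (J E w (Suc n)) \<subseteq> esum E (epow E (Suc n) \<union> esum {w} (J E w n))"
      by (intro esum_mono order_refl)
    also have "\<dots> = epow E (Suc (Suc n)) \<union> esum {w} (esum E (J E w n))"
      by (simp add: esum_Un_right) (metis esum_assoc esum_commute)
    also have "\<dots> \<subseteq> epow E (Suc (Suc n)) \<union> esum {w} (J E w (Suc n))"
      by (intro Un_mono order_refl esum_mono) (auto simp: J)
    finally show ?case .
  qed
  moreover have "epow E (Suc n) \<subseteq> J E w (Suc n)" unfolding J_def by (rule epow_mono) auto
  ultimately show ?thesis by (auto simp: J)
qed

text \<open>
  Dividing a product of \<open>n + 1\<close> generators by a variable destroys at most one of the factors.
\<close>

lemma epow_minus_var:
  assumes E: "up_closed E"
  shows "q \<in> epow E (Suc n) \<Longrightarrow> expon q u \<noteq> 0 \<Longrightarrow> q - Poly_Mapping.single u 1 \<in> epow E n"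
proof (induction n arbitrary: q)
  case 0
  then show ?case by simp
next
  case (Suc n)
  obtain e p where q: "q = e + p" "e \<in> E" "p \<in> epow E (Suc n)"
    using Suc.prems(1) by (auto simp: esum_def)
  show ?case
  proof (cases "expon e u = 0")
    case False
    then have "q - Poly_Mapping.single u 1 = p + (e - Poly_Mapping.single u 1)"
      by (intro poly_mapping_eqI) (auto simp: q(1) lookup_minus lookup_add lookup_single when_def)
    then show ?thesis using q(3) up_closed_epow[of E "Suc n"] unfolding up_closed_def by metis
  next
    \<comment> \<open>\<open>u\<close> does not occur in \<open>e\<close>, so it divides
      \<open>p\<close>, and the loss of a factor is passed on to \<open>p\<close>.\<close>
    case True
    then have "expon p u \<noteq> 0" using Suc.prems(2) by (simp add: q(1) lookup_add)
    then have "p - Poly_Mapping.single u 1 \<in> epow E n" by (rule Suc.IH[OF q(3)])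
    moreover have "q - Poly_Mapping.single u 1 = e + (p - Poly_Mapping.single u 1)"
      using True \<open>expon p u \<noteq> 0\<close>
      by (intro poly_mapping_eqI) (auto simp: q(1) lookup_minus lookup_add lookup_single when_def)
    ultimately show ?thesis using q(2) by (auto simp: esum_def)
  qed
qed

text \<open>Sets the variables outside \<open>X\<close> to one. An \<open>up_closed\<close> set is
  generated in the variables \<open>X\<close> exactly if it is closed under this operation.\<close>

definition restr :: "'v::finite set \<Rightarrow> 'v expo \<Rightarrow> 'v expo" where
  "restr X a = (\<Sum>v\<in>X. Poly_Mapping.single v (expon a v))"

lemma lookup_restr [simp]: "expon (restr X a) v = (if v \<in> X then expon a v else 0)"
  by (simp add: restr_def lookup_sum lookup_single when_def)

lemma restr_epow:
  assumes "\<And>a. a \<in> E \<Longrightarrow> restr X a \<in> E"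
  shows "a \<in> epow E n \<Longrightarrow> restr X a \<in> epow E n"
proof (induction n arbitrary: a)
  case (Suc n)
  then obtain e p where a: "a = e + p" "e \<in> E" "p \<in> epow E n" by (auto simp: esum_def)
  have "restr X a = restr X e + restr X p"
    by (rule poly_mapping_eqI) (simp add: a(1) lookup_add)
  then show ?case using assms[OF a(2)] Suc.IH[OF a(3)] by (auto simp: esum_def)
qed simp

context
  fixes E :: "'v::finite expo set" and X :: "'v set" and w :: "'v expo"
  assumes E: "up_closed E" and E0: "0 \<notin> E" and X: "\<And>a. a \<in> E \<Longrightarrow> restr X a \<in> E"
    and w: "Poly_Mapping.keys w \<inter> X = {}" "w \<noteq> 0"
begin

abbreviation J :: "nat \<Rightarrow> 'v expo set" where
  "J \<equiv> epow (E \<union> esum {w} UNIV)"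

text \<open>\<open>w + c\<close> and \<open>c\<close> agree on \<open>X\<close>, and
  \<open>X\<close> alone decides membership in a power of \<open>E\<close>, so \<open>w\<close> can
  be cancelled. Conversely, the power \<open>n + 1\<close> of \<open>E\<close> lies in the power
  \<open>n\<close> and thus in \<open>J n\<close>.\<close>

lemma epow_Int_shift: "epow E (Suc n) \<inter> esum {w} (J n) = esum {w} (epow E (Suc n))"
proof (intro equalityI subsetI)
  fix b assume b: "b \<in> epow E (Suc n) \<inter> esum {w} (J n)"
  then obtain c where c: "b = w + c" by (auto simp: esum_def)
  have "restr X b = restr X c"
    using w(1) by (intro poly_mapping_eqI) (auto simp: c lookup_add in_keys_iff disjoint_iff)
  then have "restr X c \<in> epow E (Suc n)" using restr_epow[OF X, of b "Suc n"] b by simp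
  moreover have "ediv (restr X c) c" by (simp add: ediv_def)
  ultimately have "c \<in> epow E (Suc n)" by (rule up_closedD[OF up_closed_epow])
  then show "b \<in> esum {w} (epow E (Suc n))" by (auto simp: esum_def[of "{w}"] c)
next
  fix b assume "b \<in> esum {w} (epow E (Suc n))"
  then obtain c where c: "b = w + c" "c \<in> epow E (Suc n)" by (auto simp: esum_def[of "{w}"])
  have "b \<in> epow E (Suc n)" by (rule up_closedD[OF up_closed_epow c(2)]) (simp add: c(1))
  moreover have "c \<in> J n"
    using c(2) epow_Suc_subset[of E n] epow_mono[of E "E \<union> esum {w} UNIV" n] by blast
  ultimately show "b \<in> epow E (Suc n) \<inter> esum {w} (J n)" by (auto simp: esum_def[of "{w}"] c(1))
qed

lemma hdim_J_Suc:
  "hdim F i (kcx (J (Suc n)) a) =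
    hdim F i (kcx (epow E (Suc n)) a) + hdim F i (kcx (esum {w} (J n)) a) +
    (case i of 0 \<Rightarrow> 0 | Suc j \<Rightarrow> hdim F j (kcx (esum {w} (epow E (Suc n))) a))"
proof -
  let ?A = "kcx (epow E (Suc n)) a" and ?B = "kcx (esum {w} (J n)) a"
  have Int: "?A \<inter> ?B = kcx (esum {w} (epow E (Suc n))) a"
    by (simp only: kcx_Int[symmetric] epow_Int_shift)
  obtain v where v: "v \<in> Poly_Mapping.keys w" using w(2) by (metis all_not_in_conv keys_eq_empty)
  \<comment> \<open>Adding \<open>v\<close> to a face uses up one factor of \<open>w\<close>; what
    remains is still divisible by \<open>c\<close>.\<close>
  have cone_A: "insert v \<tau> \<in> ?A" if \<tau>: "\<tau> \<in> ?A \<inter> ?B" for \<tau>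
  proof (cases "v \<in> \<tau>")
    case False
    obtain c where c: "\<tau> \<subseteq> Poly_Mapping.keys a" "a - chi \<tau> = w + c" "c \<in> epow E (Suc n)"
      using \<tau> unfolding Int by (auto simp: kcx_def esum_def[of "{w}"])
    have vw: "expon w v \<noteq> 0" using v by (simp add: in_keys_iff)
    have "expon (a - chi \<tau>) x = expon w x + expon c x" for x by (simp add: c(2) lookup_add)
    note ac = this[unfolded lookup_minus lookup_chi]
    have "ediv c (a - chi (insert v \<tau>))"
      unfolding ediv_def
    proof
      fix x show "expon c x \<le> expon (a - chi (insert v \<tau>)) x"
        using ac[of x] vw False by (cases "x = v") (simp_all add: lookup_minus)
    qed
    then have "a - chi (insert v \<tau>) \<in> epow E (Suc n)" by (rule up_closedD[OF up_closed_epow c(3)])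
    moreover have "v \<in> Poly_Mapping.keys a" using ac[of v] vw False by (simp add: in_keys_iff)
    ultimately show ?thesis using c(1) by (simp add: kcx_def)
  qed (use \<tau> in \<open>simp add: insert_absorb\<close>)
  \<comment> \<open>The second apex is a variable of the quotient of \<open>a\<close> by
    \<open>w\<close>: it varies with \<open>a\<close>, but one choice serves all faces.\<close>
  have "\<exists>u. \<forall>\<tau>\<in>?A \<inter> ?B. insert u \<tau> \<in> ?B"
  proof (cases "ediv w a \<and> a - w \<noteq> 0")
    case True
    then obtain u where u: "u \<in> Poly_Mapping.keys (a - w)" by (metis all_not_in_conv keys_eq_empty)
    have "insert u \<tau> \<in> ?B" if \<tau>: "\<tau> \<in> ?A \<inter> ?B" for \<tau>
    proof (cases "u \<in> \<tau>")
      case False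
      have \<tau>': "\<tau> \<subseteq> Poly_Mapping.keys (a - w)" "a - w - chi \<tau> \<in> epow E (Suc n)"
        using \<tau> True unfolding Int by (auto simp: kcx_shift) (auto simp: kcx_def)
      have "expon (a - w - chi \<tau>) u \<noteq> 0" using u False by (simp add: lookup_minus in_keys_iff)
      then have "a - w - chi \<tau> - Poly_Mapping.single u 1 \<in> epow E n"
        by (rule epow_minus_var[OF E \<tau>'(2)])
      also have "a - w - chi \<tau> - Poly_Mapping.single u 1 = a - w - chi (insert u \<tau>)"
        using False by (intro poly_mapping_eqI) (auto simp: lookup_minus lookup_single when_def)
      finally have "a - w - chi (insert u \<tau>) \<in> J n" using epow_mono[of E "E \<union> esum {w} UNIV" n] by blast
      then show ?thesis using True u \<tau>'(1) by (simp add: kcx_shift) (simp add: kcx_def)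
    qed (use \<tau> in \<open>simp add: insert_absorb\<close>)
    then show ?thesis by blast
  next
    \<comment> \<open>Either \<open>w\<close> does not divide \<open>a\<close>, or
      \<open>a = w\<close> and no variable is left. In both cases the intersection has no faces, in
      the second because \<open>E\<close> and hence its positive powers do not contain
      \<open>0\<close>.\<close>
    case False
    have "0 \<notin> epow E (Suc n)"
      using E0 esum_UNIV_subset[OF E, of "epow E n"] by auto
    then have "kcx (epow E (Suc n)) 0 = {}"
      by (auto simp: kcx_def chi_def simp del: epow.simps)
    then have "?A \<inter> ?B = {}"
      using False unfolding Int by (auto simp: kcx_shift simp del: epow.simps)
    then show ?thesis by blast
  qed
  then obtain u where u: "\<And>\<tau>. \<tau> \<in> ?A \<inter> ?B \<Longrightarrow> insert u \<tau> \<in> ?B" by blast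
  have "kcx (J (Suc n)) a = ?A \<union> ?B" unfolding epow_Un_principal[of E w n] by (rule kcx_Un)
  then show ?thesis
    using hdim_Un[OF down_closed_kcx[OF up_closed_epow]
        down_closed_kcx[OF up_closed_esum_right[OF up_closed_epow]] cone_A u, of F i]
    by (simp only: Int)
qed

lemma betti_exp_J_Suc:
  "betti_exp F i (J (Suc n)) = betti_exp F i (epow E (Suc n)) + betti_exp F i (J n) +
    (case i of 0 \<Rightarrow> 0 | Suc j \<Rightarrow> betti_exp F j (epow E (Suc n)))"
proof -
  let ?supp = "\<lambda>i E. {a. hdim F i (kcx E a) \<noteq> 0}"
  \<comment> \<open>One finite set of degrees outside which all the summands vanish.\<close>
  define A where "A = ?supp i (J (Suc n)) \<union> ?supp i (epow E (Suc n)) \<union> ?supp i (esum {w} (J n)) \<union>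
    ?supp (i - 1) (esum {w} (epow E (Suc n)))"
  have A: "finite A"
    unfolding A_def by (intro finite_UnI finite_hdim_support up_closed_epow up_closed_esum_right)
  have "betti_exp F i (J (Suc n)) = betti_exp F i (epow E (Suc n)) + betti_exp F i (esum {w} (J n)) +
    (case i of 0 \<Rightarrow> 0 | Suc j \<Rightarrow> betti_exp F j (esum {w} (epow E (Suc n))))"
  proof (cases i)
    case 0
    then show ?thesis
      by (subst (1 2 3) betti_exp_eq_sum[OF A]) (auto simp: A_def hdim_J_Suc sum.distrib simp del: epow.simps)
  next
    case (Suc j)
    then show ?thesis
      by (simp only: nat.case, subst (1 2 3 4) betti_exp_eq_sum[OF A])
        (auto simp: A_def hdim_J_Suc sum.distrib simp del: epow.simps)
  qed
  then show ?thesis by (simp only: betti_exp_shift)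
qed

text \<open>The additional \<open>1\<close> comes from the unit ideal \<open>J 0\<close>.\<close>

lemma betti_exp_J_0: "betti_exp F 0 (J n) = (\<Sum>l=1..n. betti_exp F 0 (epow E l)) + 1"
proof (induction n)
  case 0
  show ?case by (simp add: betti_exp_UNIV)
next
  case (Suc n)
  then show ?case by (simp add: betti_exp_J_Suc del: epow.simps)
qed

lemma betti_exp_J:
  assumes "i \<ge> 1"
  shows "betti_exp F i (J n) = (\<Sum>l=1..n. betti_exp F i (epow E l) + betti_exp F (i - 1) (epow E l))"
proof (induction n)
  case 0
  show ?case using assms by (simp add: betti_exp_UNIV)
next
  case (Suc n)
  obtain j where "i = Suc j" using assms by (cases i) auto
  then show ?case using Suc by (simp add: betti_exp_J_Suc del: epow.simps)
qed

text \<open>No summand is smaller over \<open>'f\<close> than over the rationals, and the one for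
  \<open>l = h\<close> is strictly larger; it occurs in the sum because \<open>q \<ge> h\<close>.
  Hence no cancellation is possible.\<close>

lemma betti_exp_J_neq:
  assumes "i \<ge> 1" "1 \<le> h" "h \<le> q"
    and "betti_exp TYPE('f::field) i (epow E h) \<noteq> betti_exp TYPE(rat) i (epow E h)"
  shows "betti_exp TYPE('f) i (J q) \<noteq> betti_exp TYPE(rat) i (J q)"
proof -
  have le: "betti_exp TYPE(rat) j (epow E l) \<le> betti_exp TYPE('f) j (epow E l)" for j l
    by (rule betti_exp_rat_le[OF up_closed_epow])
  have "betti_exp TYPE(rat) i (J q) < betti_exp TYPE('f) i (J q)"
    unfolding betti_exp_J[OF assms(1)]
  proof (rule sum_strict_mono_ex1)
    show "\<exists>l\<in>{1..q}. betti_exp TYPE(rat) i (epow E l) + betti_exp TYPE(rat) (i - 1) (epow E l) <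
        betti_exp TYPE('f) i (epow E l) + betti_exp TYPE('f) (i - 1) (epow E l)"
      using assms le[of i h] le[of "i - 1" h] by (intro bexI[of _ h]) auto
  qed (auto intro: add_mono le)
  then show ?thesis by simp
qed

end

theorem theorem4p3:
  fixes X Y :: "'v::finite set"
    and I :: "('v, 'k::field) mpoly set"
    and w :: "'v expo"
    and h :: nat
  assumes "X \<union> Y = UNIV" and "X \<inter> Y = {}"
    and "monomial_ideal I" and "I \<noteq> UNIV"
    and "\<forall>a\<in>min_gens I. Poly_Mapping.keys a \<subseteq> X"
    and "Poly_Mapping.keys w \<subseteq> Y" and "w \<noteq> 0"
    and "h \<ge> 1"
  shows
    "betti TYPE('k) 0 (ideal_pow (ideal_add I (ideal_of {monomial w})) h) =
       (\<Sum>l=1..h. betti TYPE('k) 0 (ideal_pow I l)) + 1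
     \<and>
     (\<forall>i\<ge>1. betti TYPE('k) i (ideal_pow (ideal_add I (ideal_of {monomial w})) h) =
       (\<Sum>l=1..h. betti TYPE('k) i (ideal_pow I l) + betti TYPE('k) (i - 1) (ideal_pow I l)))
     \<and>
     (\<forall>p i. prime p \<and> CARD('z) = p \<and> i \<ge> 1 \<and>
        betti TYPE('z::field) i (ideal_pow I h) \<noteq> betti TYPE(rat) i (ideal_pow I h) \<longrightarrow>
        (\<forall>q\<ge>h. betti TYPE('z) i (ideal_pow (ideal_add I (ideal_of {monomial w})) q) \<noteq>
               betti TYPE(rat) i (ideal_pow (ideal_add I (ideal_of {monomial w})) q)))"
proof -
  obtain E where E: "up_closed E" and I: "I = poly_on E"
    using \<open>monomial_ideal I\<close> by (rule monomial_idealE)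
  have "0 \<notin> E"
  proof
    assume "0 \<in> E"
    then have "a \<in> E" for a by (rule up_closedD[OF E]) (simp add: ediv_def)
    then have "E = UNIV" by blast
    then show False using \<open>I \<noteq> UNIV\<close> by (simp add: I)
  qed
  \<comment> \<open>A minimal generator dividing \<open>a\<close> involves only variables in
    \<open>X\<close>, so it still divides the restriction of \<open>a\<close>.\<close>
  have restr: "restr X a \<in> E" if "a \<in> E" for a
  proof -
    have "a \<in> esum (min_exps E) UNIV" using that by (simp add: esum_min_exps[OF E])
    then obtain m where m: "m \<in> min_exps E" "ediv m a" by (auto simp: in_esum_UNIV)
    have "Poly_Mapping.keys m \<subseteq> X" using assms(5) m(1) by (simp add: I min_gens_poly_on[OF E])
    then have "ediv m (restr X a)" using m(2) by (auto simp: ediv_def in_keys_iff subset_iff)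
    then show ?thesis using m(1) up_closedD[OF E] by (auto simp: min_exps_def)
  qed
  have w: "Poly_Mapping.keys w \<inter> X = {}" using assms(2,6) by blast
  note J = betti_exp_J_0[OF E \<open>0 \<notin> E\<close> restr w \<open>w \<noteq> 0\<close>] betti_exp_J[OF E \<open>0 \<notin> E\<close> restr w \<open>w \<noteq> 0\<close>]
    betti_exp_J_neq[OF E \<open>0 \<notin> E\<close> restr w \<open>w \<noteq> 0\<close>]
  have pow: "ideal_pow (ideal_add I (ideal_of {monomial w})) n = poly_on (epow (E \<union> esum {w} UNIV) n)" for n
    by (simp add: I ideal_of_monomials[of "{w}", simplified] ideal_add_poly_on ideal_pow_poly_on)
  show ?thesis
    \<comment> \<open>From here on the statement is about exponent sets only, and fields enter just
      as the first argument of \<open>betti_exp\<close>.\<close>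
    unfolding pow unfolding I ideal_pow_poly_on betti_eq_betti_exp[OF up_closed_epow]
  proof (intro conjI allI impI; (elim conjE)?)
    fix i q :: nat
    assume "i \<ge> 1" "q \<ge> h" "betti_exp TYPE('z) i (epow E h) \<noteq> betti_exp TYPE(rat) i (epow E h)"
    then show "betti_exp TYPE('z) i (epow (E \<union> esum {w} UNIV) q) \<noteq>
        betti_exp TYPE(rat) i (epow (E \<union> esum {w} UNIV) q)"
      using J(3) \<open>h \<ge> 1\<close> by simp
  qed (simp_all only: J(1,2))
qed

end
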